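(* Let $0<p\le1$ and let $r\ge1$ be an integer. Assume that the linear map $\Phi:M_{d_1\times d_2}\to\mathbb{C}^m$ fulfills the strong Schatten-$p$ null space property of order $2r$ with constant $\gamma_{2r}<1$, and that there exists a matrix $X_0\in M_{d_1\times d_2}$ with $\operatorname{rank}(X_0)=r\le\frac{\min(d_1,d_2)}{2}$ such that $\Phi(X_0)=Y$. Let $\Phi$, $Y$, rank estimate $\widetilde r=r$ and $p$ be the input parameters of the algorithm HM-IRLS (described in the context). Let $\kappa=\frac{\sigma_1(X_0)}{\sigma_r(X_0)}$ be the condition number of $X_0$ and let $\eta^{(n)}:=X^{(n)}-X_0$ be the error matrices of the $n$-th output of the algorithm, $n\in\mathbb{N}$. Assume that there exist an iteration $\overline n\in\mathbb{N}$ and a constant $0<\zeta<1$ such that $$\|\eta^{(\overline n)}\|_{S_\infty}\le\zeta\,\sigma_r(X_0)$$ and $\epsilon^{(\overline n)}=\sigma_{r+1}(X^{(\overline n)})$. If additionally $$\mu\,\|\eta^{(\overline n)}\|_{S_\infty}^{p(1-p)}<1$$ with the constant $$\mu:=2^{5p}(1+\gamma_{2r})^p\Big(\frac{\gamma_{2r}(3+\gamma_{2r})(1+\gamma_{2r})}{1-\gamma_{2r}}\Big)^{2-p}\Big(\frac{d-r}{r}\Big)^{2-\frac p2}r^p\,\frac{\sigma_r(X_0)^{p(p-1)}}{(1-\zeta)^{2p}}\,\kappa^p,$$ then $$\|\eta^{(n+1)}\|_{S_\infty}\le\mu^{1/p}\big(\|\eta^{(n)}\|_{S_\infty}\big)^{2-p}\quad\text{and}\quad\|\eta^{(n+1)}\|_{S_p}\le\mu^{1/p}\big(\|\eta^{(n)}\|_{S_p}\big)^{2-p}$$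 for all $n\ge\overline n$.
   Context: Notation. $M_{d_1\times d_2}=\mathbb{C}^{d_1\times d_2}$, $d=\min(d_1,d_2)$, $D=\max(d_1,d_2)$; $\sigma_1(X)\ge\sigma_2(X)\ge\dots\ge\sigma_d(X)\ge 0$ are the singular values of $X$ (with $\sigma_i(X)=0$ for $i>d$). $\|X\|_{S_p}=\big(\sum_{i=1}^d\sigma_i(X)^p\big)^{1/p}$ for $0<p<\infty$, $\|X\|_{S_\infty}=\sigma_1(X)$. $\mathcal N(\Phi)$ is the null space of $\Phi$. $X_{\mathrm{vec}}\in\mathbb{C}^{d_1d_2}$ is the column-stacking vectorization of $X$. For a positive definite $W$, $\|x\|_{\ell_2(W)}=\sqrt{x^*Wx}$. For square $A\in M_{d_1\times d_1}$, $B\in M_{d_2\times d_2}$, $B\otimes A$ denotes the matrix of the map $X\mapsto AXB^*$ on vectorized matrices, i.e. $(B\otimes A)X_{\mathrm{vec}}=(AXB^* )_{\mathrm{vec}}$, and $A\oplus B=(\mathbf I_{d_2}\otimes A)+(B\otimes\mathbf I_{d_1})$ (Kronecker sum), so $(A\oplus B)X_{\mathrm{vec}}=(AX+XB^* )_{\mathrm{vec}}$. Strong Schatten-$p$ null space property of order $k$ with constant $0<\gamma_k\le1$: for all $X\in\mathcal N(\Phi)\setminus\{0\}$, $\big(\sum_{i=1}^k\sigma_i^2(X)\big)^{p/2}<\frac{\gamma_k}{k^{1-p/2}}\sum_{i=k+1}^d\sigma_i^p(X)$. Algorithm HM-IRLS with input $\Phi,Y$, rank estimate $\widetilde r$, $0<p\le1$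 (run without stopping criterion). Set $\epsilon^{(0)}=1$, $\widetilde W^{(0)}=\mathbf I_{d_1d_2}$. For $n=0,1,2,\dots$: $$X^{(n+1)}=\operatorname*{arg\,min}_{\Phi(X)=Y}\|X_{\mathrm{vec}}\|^2_{\ell_2(\widetilde W^{(n)})},\qquad \epsilon^{(n+1)}=\min\big(\epsilon^{(n)},\sigma_{\widetilde r+1}(X^{(n+1)})\big),$$ $$\widetilde W^{(n+1)}=2\Big[U^{(n+1)}(\overline\Sigma_{d_1}^{(n+1)})^{2-p}U^{(n+1)*}\oplus V^{(n+1)}(\overline\Sigma_{d_2}^{(n+1)})^{2-p}V^{(n+1)*}\Big]^{-1},$$ where $X^{(n+1)}=U^{(n+1)}\Sigma^{(n+1)}V^{(n+1)*}$ is a full singular value decomposition ($U^{(n+1)}$, $V^{(n+1)}$ unitary of sizes $d_1$, $d_2$, singular values in decreasing order) and, for $t\in\{1,2\}$, $\overline\Sigma_{d_t}^{(n+1)}\in M_{d_t\times d_t}$ is diagonal with $i$-th diagonal entry $(\sigma_i(X^{(n+1)})^2+(\epsilon^{(n+1)})^2)^{1/2}$ if $i\le d$ and $0$ if $d<i\le D$. The matrix in brackets is positive definite when $\epsilon^{(n+1)}>0$. If $\epsilon^{(n)}=0$ for some $n$, the algorithm stops and one sets $X^{(k)}=X^{(n)}$, $\epsilon^{(k)}=0$ for all $k\ge n$. *)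

theory Defs
  imports
    Complex_Main
    "HOL-Computational_Algebra.Fundamental_Theorem_Algebra"
    "Jordan_Normal_Form.Gauss_Jordan_Elimination"
    "Jordan_Normal_Form.Schur_Decomposition"
    "Jordan_Normal_Form.DL_Rank"
begin

section \<open>Singular values and Schatten (quasi-)norms\<close>

text \<open>The roots of the characteristic polynomial of \<open>X\<^sup>* X\<close>, counted with multiplicity, are
  real and nonnegative, so taking real parts loses nothing.\<close>

definition singular_value_list :: "complex mat \<Rightarrow> real list" where
  "singular_value_list X =
     rev (sorted_list_of_multiset
       (image_mset (\<lambda>z. sqrt (Re z)) (proots (char_poly (mat_adjoint X * X)))))"

text \<open>Indices start at 1. For a wide matrix the list has further entries, all equal to 0.\<close>

definition singular_value :: "complex mat \<Rightarrow> nat \<Rightarrow> real" where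
  "singular_value X i =
     (if 1 \<le> i \<and> i \<le> min (dim_row X) (dim_col X) then singular_value_list X ! (i - 1) else 0)"

definition schatten_norm :: "real \<Rightarrow> complex mat \<Rightarrow> real" where
  "schatten_norm p X =
     (\<Sum>i = 1..min (dim_row X) (dim_col X). singular_value X i powr p) powr (1 / p)"

definition schatten_inf_norm :: "complex mat \<Rightarrow> real" where
  "schatten_inf_norm X = singular_value X 1"

definition unitary_mat :: "nat \<Rightarrow> complex mat \<Rightarrow> bool" where
  "unitary_mat n U \<longleftrightarrow>
     U \<in> carrier_mat n n \<and> mat_adjoint U * U = 1\<^sub>m n \<and> U * mat_adjoint U = 1\<^sub>m n"

definition full_svd :: "complex mat \<Rightarrow> complex mat \<Rightarrow> complex mat \<Rightarrow> complex mat \<Rightarrow> bool" where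
  "full_svd X U S V \<longleftrightarrow>
     unitary_mat (dim_row X) U \<and> unitary_mat (dim_col X) V \<and>
     S = mat (dim_row X) (dim_col X)
           (\<lambda>(i, j). if i = j then complex_of_real (singular_value X (i + 1)) else 0) \<and>
     X = U * S * mat_adjoint V"

section \<open>Measurement maps and the null space property\<close>

abbreviation linear_measurement :: "nat \<Rightarrow> nat \<Rightarrow> nat \<Rightarrow> (complex mat \<Rightarrow> complex vec) \<Rightarrow> bool" where
  "linear_measurement d1 d2 m \<Phi> \<equiv>
     linear_map class_ring (module_mat TYPE(complex) d1 d2) (module_vec TYPE(complex) m) \<Phi>"

definition strong_schatten_nsp ::
  "nat \<Rightarrow> nat \<Rightarrow> nat \<Rightarrow> (complex mat \<Rightarrow> complex vec) \<Rightarrow> real \<Rightarrow> nat \<Rightarrow> real \<Rightarrow> bool" where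
  "strong_schatten_nsp d1 d2 m \<Phi> p k \<gamma> \<longleftrightarrow>
     0 < \<gamma> \<and> \<gamma> \<le> 1 \<and>
     (\<forall>X \<in> mod_hom.ker (module_mat TYPE(complex) d1 d2) (module_vec TYPE(complex) m) \<Phi> - {0\<^sub>m d1 d2}.
        (\<Sum>i = 1..k. (singular_value X i)\<^sup>2) powr (p / 2)
          < \<gamma> / real k powr (1 - p / 2) * (\<Sum>i = k + 1..min d1 d2. singular_value X i powr p))"

section \<open>Vectorization and Kronecker sums\<close>

definition mat_vec :: "complex mat \<Rightarrow> complex vec" where
  "mat_vec X = vec (dim_row X * dim_col X) (\<lambda>k. X $$ (k mod dim_row X, k div dim_row X))"

text \<open>The product of \<open>B\<close> and \<open>A\<close> is the matrix of \<open>X \<mapsto> A X B\<^sup>*\<close> (lemma below), hence the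
  entries of \<open>B\<close> are conjugated, unlike in the usual Kronecker product.\<close>

definition kron :: "complex mat \<Rightarrow> complex mat \<Rightarrow> complex mat" where
  "kron B A = mat (dim_row B * dim_row A) (dim_col B * dim_col A)
     (\<lambda>(k, l). cnj (B $$ (k div dim_row A, l div dim_col A)) *
                A $$ (k mod dim_row A, l mod dim_col A))"

definition kron_sum :: "complex mat \<Rightarrow> complex mat \<Rightarrow> complex mat" where
  "kron_sum A B = kron (1\<^sub>m (dim_row B)) A + kron B (1\<^sub>m (dim_row A))"

lemma kron_mult_mat_vec:
  assumes A: "A \<in> carrier_mat d1 d1" and B: "B \<in> carrier_mat d2 d2" and X: "X \<in> carrier_mat d1 d2"
  shows "kron B A *\<^sub>v mat_vec X = mat_vec (A * X * mat_adjoint B)"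
proof (rule eq_vecI)
  have adj: "mat_adjoint B \<in> carrier_mat d2 d2"
    using B by (auto simp: mat_adjoint_def)
  fix k assume "k < dim_vec (mat_vec (A * X * mat_adjoint B))"
  then have k: "k < d1 * d2" using A adj by (simp add: mat_vec_def)
  then have d1: "d1 > 0" by (cases d1) auto
  let ?i = "k mod d1" and ?j = "k div d1"
  have ij: "?i < d1" "?j < d2"
    using k d1 by (auto simp: less_mult_imp_div_less mult.commute)
  have bnd: "l + q * d1 < d1 * d2" if "l < d1" "q < d2" for l q
  proof -
    have "l + q * d1 < Suc q * d1" using that by simp
    also have "\<dots> \<le> d2 * d1" using that by (intro mult_le_mono1) simp
    finally show ?thesis by (simp add: mult.commute)
  qed
  have "(kron B A *\<^sub>v mat_vec X) $ k
      = (\<Sum>l < d1 * d2. cnj (B $$ (?j, l div d1)) * A $$ (?i, l mod d1) * X $$ (l mod d1, l div d1))"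
    using A B X k by (auto simp: kron_def mat_vec_def scalar_prod_def lessThan_atLeast0 mult.commute
        intro!: sum.cong)
  also have "\<dots> = (\<Sum>(q, l) \<in> {..<d2} \<times> {..<d1}. cnj (B $$ (?j, q)) * A $$ (?i, l) * X $$ (l, q))"
    by (rule sum.reindex_bij_witness[where i = "\<lambda>(q, l). l + q * d1" and j = "\<lambda>l. (l div d1, l mod d1)"])
      (use d1 bnd in \<open>auto simp: less_mult_imp_div_less mult.commute\<close>)
  also have "\<dots> = (\<Sum>q < d2. (\<Sum>l < d1. A $$ (?i, l) * X $$ (l, q)) * cnj (B $$ (?j, q)))"
    by (simp add: sum.cartesian_product[symmetric] sum_distrib_left sum_distrib_right mult_ac)
  also have "\<dots> = (A * X * mat_adjoint B) $$ (?i, ?j)"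
    using A B X adj ij
    by (simp add: scalar_prod_def mat_adjoint_def lessThan_atLeast0 mat_of_rows_index
        sum_distrib_left sum_distrib_right mult_ac sum.swap[of _ "{0..<d2}" "{0..<d1}"])
  also have "\<dots> = mat_vec (A * X * mat_adjoint B) $ k"
    using k A adj by (simp add: mat_vec_def)
  finally show "(kron B A *\<^sub>v mat_vec X) $ k = mat_vec (A * X * mat_adjoint B) $ k" .
qed (use assms in \<open>simp add: kron_def mat_vec_def mat_adjoint_def\<close>)

section \<open>The algorithm HM-IRLS\<close>

definition weighted_norm :: "complex mat \<Rightarrow> complex vec \<Rightarrow> real" where
  "weighted_norm W x = sqrt (Re (conjugate x \<bullet> (W *\<^sub>v x)))"

text \<open>With \<open>t = dim_row X\<close> or \<open>t = dim_col X\<close>, this is the power \<open>2 - p\<close> of the smoothed diagonal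
  matrix of size \<open>t\<close>; the diagonal entries beyond the number of singular values are 0.\<close>

definition smoothed_diag_power :: "complex mat \<Rightarrow> real \<Rightarrow> real \<Rightarrow> nat \<Rightarrow> complex mat" where
  "smoothed_diag_power X \<epsilon> p t = mat_diag t (\<lambda>i.
     complex_of_real
       ((if i < min (dim_row X) (dim_col X)
         then sqrt ((singular_value X (i + 1))\<^sup>2 + \<epsilon>\<^sup>2) else 0) powr (2 - p)))"

definition hm_weight ::
  "complex mat \<Rightarrow> complex mat \<Rightarrow> complex mat \<Rightarrow> real \<Rightarrow> real \<Rightarrow> complex mat" where
  "hm_weight X U V \<epsilon> p =
     2 \<cdot>\<^sub>m the (mat_inverse (kron_sum
       (U * smoothed_diag_power X \<epsilon> p (dim_row X) * mat_adjoint U)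
       (V * smoothed_diag_power X \<epsilon> p (dim_col X) * mat_adjoint V)))"

text \<open>A run is a relation, not a function: for a rank-deficient, non-square iterate the weight
  depends on which full singular value decomposition is chosen. The entry \<open>X 0\<close> is
  meaningless, since the first iterate is \<open>X 1\<close>, and no weight is formed once \<open>\<epsilon>\<close> is 0.\<close>

definition hm_irls_run ::
  "nat \<Rightarrow> nat \<Rightarrow> (complex mat \<Rightarrow> complex vec) \<Rightarrow> complex vec \<Rightarrow> nat \<Rightarrow> real \<Rightarrow>
   (nat \<Rightarrow> complex mat) \<Rightarrow> (nat \<Rightarrow> real) \<Rightarrow> (nat \<Rightarrow> complex mat) \<Rightarrow> bool" where
  "hm_irls_run d1 d2 \<Phi> Y rank_est p X \<epsilon> W \<longleftrightarrow>
     \<epsilon> 0 = 1 \<and> W 0 = 1\<^sub>m (d1 * d2) \<and>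
     (\<forall>n. if \<epsilon> n = 0 then X (n + 1) = X n \<and> \<epsilon> (n + 1) = 0
       else
         is_arg_min (\<lambda>Z. (weighted_norm (W n) (mat_vec Z))\<^sup>2)
           (\<lambda>Z. Z \<in> carrier_mat d1 d2 \<and> \<Phi> Z = Y) (X (n + 1)) \<and>
         \<epsilon> (n + 1) = min (\<epsilon> n) (singular_value (X (n + 1)) (rank_est + 1)) \<and>
         (\<epsilon> (n + 1) \<noteq> 0 \<longrightarrow>
           (\<exists>U S V. full_svd (X (n + 1)) U S V \<and>
              W (n + 1) = hm_weight (X (n + 1)) U V (\<epsilon> (n + 1)) p)))"

text \<open>Real power with \<open>0\<^sup>0 = 1\<close>, whereas \<open>0 powr 0 = 0\<close>.\<close>

definition real_pow :: "real \<Rightarrow> real \<Rightarrow> real" where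
  "real_pow x a = (if a = 0 then 1 else x powr a)"

end

theory Submission
  imports Defs "HOL-Analysis.L2_Norm"
begin

text \<open>
  Let \<open>X\<close> be an iterate, \<open>H = X - X0\<close> its error and \<open>N = X' - X0\<close> the error of the next iterate
  \<open>X'\<close>. Both errors lie in the null space of \<open>\<Phi>\<close>. In coordinates given by the singular vectors of
  \<open>X\<close> the weight is diagonal (\<open>weighted_norm_kron_sum\<close>): the entry \<open>(i, j)\<close> is weighted by
  \<open>2 / (h i + h j)\<close>, where \<open>h i\<close> is the power \<open>2 - p\<close> of the smoothed singular value. So there are
  two scales (\<open>hm_weight_entry_bounds\<close>). On the corner \<open>i, j \<ge> r\<close> (indices from 0) the weight is
  comparable to \<open>\<epsilon> powr (p - 2)\<close>, which is huge; off the corner it is at most of the order of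
  \<open>\<sigma> powr (p - 2)\<close>, where \<open>\<sigma>\<close> is the smallest nonzero singular value of \<open>X0\<close>.

  Minimality of \<open>X'\<close> makes \<open>X' = X0 + N\<close> orthogonal to \<open>N\<close> in the weighted inner product, so the
  energy of \<open>N\<close> is at most its weighted pairing with \<open>X0\<close> (\<open>weighted_energy_estimate\<close>). On the corner
  this pairing is small because \<open>X0\<close> is: having rank \<open>r\<close> and being close to \<open>X\<close>, it is there of second
  order, \<open>\<parallel>H\<parallel>\<^sup>2 / \<sigma>\<close> (\<open>low_rank_corner\<close>). Off the corner \<open>X0\<close> is of size \<open>\<kappa> \<sigma>\<close>, but the weight is
  moderate, and \<open>N\<close> is dominated there by its own corner: the corner is at least as large as the
  singular values of \<open>N\<close> beyond the first \<open>2 r\<close> (\<open>tail_le_corner\<close>), and the null space property bounds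
  the first \<open>2 r\<close> by those. Comparing with the energy \<open>\<epsilon> powr (p - 2) * y\<^sup>2\<close> of a corner of size \<open>y\<close>,
  one gets, up to constants, \<open>y \<le> \<epsilon> powr (2 - p) * \<kappa> * \<sigma> powr (p - 1) + \<parallel>H\<parallel>\<^sup>2 / \<sigma>\<close>
  (\<open>corner_contraction\<close>). Since \<open>\<epsilon> \<le> \<parallel>H\<parallel> \<le> \<sigma>\<close>, both terms are of order \<open>\<parallel>H\<parallel> powr (2 - p)\<close>, and the
  null space property turns \<open>y\<close> into both norms of \<open>N\<close>.

  The estimate uses \<open>\<epsilon> = \<sigma>\<^bsub>r+1\<^esub>(X)\<close>, which survives to the next iterate exactly if
  \<open>\<sigma>\<^bsub>r+1\<^esub>(X') \<le> \<epsilon>\<close>. As \<open>\<sigma>\<^bsub>r+1\<^esub>(X') \<le> \<parallel>N\<parallel>\<close>, it suffices to bound the estimate for \<open>\<parallel>N\<parallel>\<close> by \<open>\<epsilon>\<close>.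
  Its first term contains \<open>\<epsilon>\<close> already; in the second, one factor \<open>\<parallel>H\<parallel>\<close> is at most a constant times
  \<open>\<epsilon>\<close>, because Weyl's inequality bounds the tail of \<open>H\<close> by \<open>\<epsilon>\<close> (\<open>error_tail_le\<close>) and the null space
  property bounds \<open>H\<close> by its tail. The contraction hypothesis makes the remaining factor less than 1
  (\<open>error_recursion\<close>).

  Singular values enter as roots of a characteristic polynomial. The spectral theorem
  (\<open>hermitian_diagonalisation\<close>) gives the minimax bound \<open>singular_value_minimax\<close>, and every
  perturbation inequality below is an instance of it: a bound for \<open>X x\<close> that holds for all \<open>x\<close>
  satisfying \<open>k\<close> linear equations bounds the singular value with (1-based) index \<open>k + 1\<close>.
\<close>

section \<open>Adjoints, Euclidean norms and unitary matrices\<close>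

lemma mat_adjoint_carrier [simp]:
  "A \<in> carrier_mat n m \<Longrightarrow> mat_adjoint A \<in> carrier_mat m n"
  by (auto simp: mat_adjoint_def)

lemma mat_adjoint_dim [simp]:
  "dim_row (mat_adjoint A) = dim_col A" "dim_col (mat_adjoint A) = dim_row A"
  by (auto simp: mat_adjoint_def)

lemma mat_adjoint_index [simp]:
  fixes A :: "complex mat"
  shows "i < dim_col A \<Longrightarrow> j < dim_row A \<Longrightarrow> mat_adjoint A $$ (i, j) = cnj (A $$ (j, i))"
  by (simp add: mat_adjoint_def mat_of_rows_index)

lemma index_mult_mat_sum:
  fixes A B :: "complex mat"
  assumes "A \<in> carrier_mat n m" "B \<in> carrier_mat m l" "i < n" "j < l"
  shows "(A * B) $$ (i, j) = (\<Sum>k<m. A $$ (i, k) * B $$ (k, j))"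
  using assms by (simp add: scalar_prod_def lessThan_atLeast0)

lemma index_mult_mat_vec_sum:
  fixes A :: "complex mat"
  assumes "A \<in> carrier_mat n m" "x \<in> carrier_vec m" "i < n"
  shows "(A *\<^sub>v x) $ i = (\<Sum>k<m. A $$ (i, k) * x $ k)"
  using assms by (simp add: scalar_prod_def lessThan_atLeast0)

lemma scalar_prod_sum:
  fixes x y :: "complex vec"
  assumes "y \<in> carrier_vec n"
  shows "x \<bullet> y = (\<Sum>k<n. x $ k * y $ k)"
  using assms by (simp add: scalar_prod_def lessThan_atLeast0)

lemma mat_adjoint_adjoint [simp]: "mat_adjoint (mat_adjoint A) = (A :: complex mat)"
  by (rule eq_matI) auto

lemma mat_adjoint_one [simp]: "mat_adjoint (1\<^sub>m n) = (1\<^sub>m n :: complex mat)"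
  by (rule eq_matI) auto

lemma mat_adjoint_mult:
  fixes A B :: "complex mat"
  assumes A: "A \<in> carrier_mat n m" and B: "B \<in> carrier_mat m l"
  shows "mat_adjoint (A * B) = mat_adjoint B * mat_adjoint A"
proof (rule eq_matI)
  fix i j assume "i < dim_row (mat_adjoint B * mat_adjoint A)"
    "j < dim_col (mat_adjoint B * mat_adjoint A)"
  then have ij: "i < l" "j < n" using A B by auto
  then have "mat_adjoint (A * B) $$ (i, j) = cnj ((A * B) $$ (j, i))"
    using A B by (intro mat_adjoint_index) auto
  also have "\<dots> = (\<Sum>k<m. mat_adjoint B $$ (i, k) * mat_adjoint A $$ (k, j))"
    using A B ij by (simp add: index_mult_mat_sum[OF A B] mult.commute del: index_mult_mat)
  also have "\<dots> = (mat_adjoint B * mat_adjoint A) $$ (i, j)"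
    using A B ij by (intro index_mult_mat_sum[symmetric]) auto
  finally show "mat_adjoint (A * B) $$ (i, j) = (mat_adjoint B * mat_adjoint A) $$ (i, j)" .
qed (use A B in auto)

definition vnorm :: "complex vec \<Rightarrow> real" where
  "vnorm x = L2_set (\<lambda>i. cmod (x $ i)) {..<dim_vec x}"

lemma vnorm_nonneg [simp]: "0 \<le> vnorm x"
  by (simp add: vnorm_def)

lemma vnorm_sq: "x \<in> carrier_vec n \<Longrightarrow> (vnorm x)\<^sup>2 = (\<Sum>i<n. (cmod (x $ i))\<^sup>2)"
  by (simp add: vnorm_def L2_set_def sum_nonneg)

lemma vnorm_sq_scalar_prod:
  assumes "x \<in> carrier_vec n"
  shows "complex_of_real ((vnorm x)\<^sup>2) = conjugate x \<bullet> x"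
  using assms
  by (simp add: vnorm_sq scalar_prod_sum[OF assms] complex_norm_square mult.commute
        del: of_real_power)

lemma vnorm_eq_0_iff: "x \<in> carrier_vec n \<Longrightarrow> vnorm x = 0 \<longleftrightarrow> x = 0\<^sub>v n"
  by (auto simp: vnorm_def L2_set_eq_0_iff)

lemma vnorm_triangle:
  assumes "x \<in> carrier_vec n" "y \<in> carrier_vec n"
  shows "vnorm (x + y) \<le> vnorm x + vnorm y"
proof -
  have "vnorm (x + y) \<le> L2_set (\<lambda>i. cmod (x $ i) + cmod (y $ i)) {..<n}"
    using assms by (auto simp: vnorm_def norm_triangle_ineq intro!: L2_set_mono)
  also have "\<dots> \<le> vnorm x + vnorm y"
    using assms L2_set_triangle_ineq[of "\<lambda>i. cmod (x $ i)" "\<lambda>i. cmod (y $ i)" "{..<n}"]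
    by (simp add: vnorm_def)
  finally show ?thesis .
qed

lemma vnorm_smult: "vnorm (c \<cdot>\<^sub>v x) = cmod c * vnorm x"
  by (auto simp: vnorm_def norm_mult L2_set_right_distrib intro!: L2_set_cong)

lemma cmod_scalar_prod_le:
  assumes x: "x \<in> carrier_vec n" and y: "y \<in> carrier_vec n"
  shows "cmod (conjugate x \<bullet> y) \<le> vnorm x * vnorm y"
proof -
  have "cmod (conjugate x \<bullet> y) \<le> (\<Sum>k<n. \<bar>cmod (x $ k)\<bar> * \<bar>cmod (y $ k)\<bar>)"
    using x by (auto simp: scalar_prod_sum[OF y] norm_mult intro!: order.trans[OF norm_sum])
  also have "\<dots> \<le> vnorm x * vnorm y"
    using L2_set_mult_ineq[of "\<lambda>i. cmod (x $ i)" "\<lambda>i. cmod (y $ i)" "{..<n}"] x y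
    by (simp add: vnorm_def)
  finally show ?thesis .
qed

lemma scalar_prod_adjoint:
  fixes A :: "complex mat"
  assumes A: "A \<in> carrier_mat n m" and x: "x \<in> carrier_vec m" and y: "y \<in> carrier_vec n"
  shows "conjugate y \<bullet> (A *\<^sub>v x) = conjugate (mat_adjoint A *\<^sub>v y) \<bullet> x"
proof -
  have A': "mat_adjoint A \<in> carrier_mat m n" using A by simp
  have Ax: "A *\<^sub>v x \<in> carrier_vec n" using A x by simp
  have "conjugate y \<bullet> (A *\<^sub>v x) = (\<Sum>i<n. \<Sum>k<m. cnj (y $ i) * A $$ (i, k) * x $ k)"
    using A x y
    by (simp add: scalar_prod_sum[OF Ax] index_mult_mat_vec_sum[OF A x] sum_distrib_left mult.assoc
        del: index_mult_mat_vec)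
  also have "\<dots> = (\<Sum>k<m. \<Sum>i<n. cnj (y $ i) * A $$ (i, k) * x $ k)"
    by (rule sum.swap)
  also have "\<dots> = conjugate (mat_adjoint A *\<^sub>v y) \<bullet> x"
    using A x y
    by (simp add: scalar_prod_sum[OF x] index_mult_mat_vec_sum[OF A' y] sum_distrib_left
        sum_distrib_right mult_ac del: index_mult_mat_vec)
  finally show ?thesis .
qed

lemma vnorm_mult_sq:
  fixes A :: "complex mat"
  assumes A: "A \<in> carrier_mat n m" and x: "x \<in> carrier_vec m"
  shows "complex_of_real ((vnorm (A *\<^sub>v x))\<^sup>2) = conjugate x \<bullet> ((mat_adjoint A * A) *\<^sub>v x)"
proof -
  have Ax: "A *\<^sub>v x \<in> carrier_vec n" using A x by simp
  have A': "mat_adjoint A \<in> carrier_mat m n" using A by simp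
  have "complex_of_real ((vnorm (A *\<^sub>v x))\<^sup>2) = conjugate (A *\<^sub>v x) \<bullet> (A *\<^sub>v x)"
    by (rule vnorm_sq_scalar_prod[OF Ax])
  also have "\<dots> = conjugate x \<bullet> (mat_adjoint A *\<^sub>v (A *\<^sub>v x))"
    using scalar_prod_adjoint[OF A' Ax x] by simp
  also have "mat_adjoint A *\<^sub>v (A *\<^sub>v x) = (mat_adjoint A * A) *\<^sub>v x"
    using assoc_mult_mat_vec[OF A' A x] by simp
  finally show ?thesis .
qed

lemma unitary_matD:
  assumes "unitary_mat n U"
  shows "U \<in> carrier_mat n n" "mat_adjoint U \<in> carrier_mat n n"
    "mat_adjoint U * U = 1\<^sub>m n" "U * mat_adjoint U = 1\<^sub>m n"
  using assms by (auto simp: unitary_mat_def)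

lemma unitary_mat_adjoint: "unitary_mat n U \<Longrightarrow> unitary_mat n (mat_adjoint U)"
  by (auto simp: unitary_mat_def)

lemma unitary_matI:
  assumes "U \<in> carrier_mat n n" "mat_adjoint U * U = 1\<^sub>m n"
  shows "unitary_mat n U"
  using assms mat_mult_left_right_inverse[of "mat_adjoint U" n U] by (simp add: unitary_mat_def)

lemma unitary_mat_mult:
  assumes U: "unitary_mat n U" and V: "unitary_mat n V"
  shows "unitary_mat n (U * V)"
proof (rule unitary_matI)
  note u = unitary_matD[OF U] and v = unitary_matD[OF V]
  have "mat_adjoint (U * V) * (U * V) = mat_adjoint V * ((mat_adjoint U * U) * V)"
    using u(1,2) v(1,2)
    by (simp add: mat_adjoint_mult[OF u(1) v(1)] assoc_mult_mat[of _ n n _ n _ n])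
  also have "\<dots> = 1\<^sub>m n" unfolding u(3) using v by simp
  finally show "mat_adjoint (U * V) * (U * V) = 1\<^sub>m n" .
qed (use assms in \<open>auto simp: unitary_mat_def\<close>)

lemma vnorm_unitary:
  assumes U: "unitary_mat n U" and x: "x \<in> carrier_vec n"
  shows "vnorm (U *\<^sub>v x) = vnorm x"
proof -
  note u = unitary_matD[OF U]
  have "complex_of_real ((vnorm (U *\<^sub>v x))\<^sup>2) = complex_of_real ((vnorm x)\<^sup>2)"
    using vnorm_mult_sq[OF u(1) x] vnorm_sq_scalar_prod[OF x] u x by simp
  then have "(vnorm (U *\<^sub>v x))\<^sup>2 = (vnorm x)\<^sup>2" using of_real_eq_iff by blast
  then show ?thesis by (simp add: power2_eq_iff_nonneg)
qed

text \<open>Orthonormal extension, minimax and rank arguments below all reduce to this count of equations.\<close>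

lemma homogeneous_system_nontrivial:
  fixes C :: "nat \<Rightarrow> complex vec"
  assumes kn: "k < n" and C: "\<And>i. i < k \<Longrightarrow> C i \<in> carrier_vec n"
  shows "\<exists>x \<in> carrier_vec n. x \<noteq> 0\<^sub>v n \<and> (\<forall>i<k. C i \<bullet> x = 0)"
proof -
  define c where "c i = (if i < k then C i else 0\<^sub>v n)" for i
  define M where "M = mat\<^sub>r n n (\<lambda>i. if i = k then 0\<^sub>v n else c i)"
  have M: "M \<in> carrier_mat n n" by (simp add: M_def)
  have "det M = 0" unfolding M_def by (rule det_row_0[OF kn]) (auto simp: c_def C)
  then obtain x where x: "x \<in> carrier_vec n" "x \<noteq> 0\<^sub>v n" "M *\<^sub>v x = 0\<^sub>v n"
    using det_0_iff_vec_prod_zero_field[OF M] by blast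
  have "C i \<bullet> x = 0" if i: "i < k" for i
  proof -
    have "C i \<bullet> x = row M i \<bullet> x" using i kn C[OF i] by (simp add: M_def c_def)
    also have "\<dots> = (M *\<^sub>v x) $ i" using i kn M by simp
    finally show ?thesis using x(3) i kn by simp
  qed
  then show ?thesis using x by blast
qed

text \<open>Gram--Schmidt by counting: as long as there are fewer than \<open>n\<close> vectors, some nonzero vector is
  orthogonal to all of them.\<close>

lemma orthonormal_extend:
  assumes v: "v \<in> carrier_vec n" "vnorm v = 1" and k: "1 \<le> k" "k \<le> n"
  shows "\<exists>q. q 0 = v \<and> (\<forall>i<k. q i \<in> carrier_vec n) \<and>
           (\<forall>i<k. \<forall>j<k. conjugate (q i) \<bullet> q j = (if i = j then 1 else 0 :: complex))"
  using k
proof (induction k rule: nat_induct_at_least)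
  case base
  have "conjugate v \<bullet> v = 1" using vnorm_sq_scalar_prod[OF v(1)] v(2) by simp
  then show ?case using v by (intro exI[of _ "\<lambda>_. v"]) auto
next
  case (Suc k)
  then obtain q where q: "q 0 = v" "\<And>i. i < k \<Longrightarrow> q i \<in> carrier_vec n"
    "\<And>i j. i < k \<Longrightarrow> j < k \<Longrightarrow> conjugate (q i) \<bullet> q j = (if i = j then 1 else 0)"
    by auto
  obtain x where x: "x \<in> carrier_vec n" "x \<noteq> 0\<^sub>v n" "\<And>i. i < k \<Longrightarrow> conjugate (q i) \<bullet> x = 0"
    using homogeneous_system_nontrivial[of k n "\<lambda>i. conjugate (q i)"] q(2) Suc.prems by auto
  define y where "y = complex_of_real (1 / vnorm x) \<cdot>\<^sub>v x"
  have nz: "vnorm x \<noteq> 0" using x vnorm_eq_0_iff by blast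
  have y: "y \<in> carrier_vec n" "vnorm y = 1"
    using x nz unfolding y_def by (simp_all add: vnorm_smult norm_divide)
  have yy: "conjugate y \<bullet> y = 1" using vnorm_sq_scalar_prod[OF y(1)] y(2) by simp
  have qy: "conjugate (q i) \<bullet> y = 0" if "i < k" for i
    using x(1) x(3)[OF that] q(2)[OF that] by (simp add: y_def)
  have yq: "conjugate y \<bullet> q i = 0" if "i < k" for i
    using qy[OF that] y(1) q(2)[OF that]
    by (metis conjugate_conjugate_sprod conjugate_zero carrier_vec_conjugate
        comm_scalar_prod)
  define q' where "q' i = (if i < k then q i else y)" for i
  show ?case
    using q y yy qy yq Suc.hyps
    by (intro exI[of _ q']) (auto simp: q'_def less_Suc_eq)
qed

lemma unit_vector_to_unitary:
  assumes v: "v \<in> carrier_vec n" "vnorm v = 1" and n: "1 \<le> n"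
  shows "\<exists>W. unitary_mat n W \<and> col W 0 = v"
proof -
  obtain q where q: "q 0 = v" "\<And>i. i < n \<Longrightarrow> q i \<in> carrier_vec n"
    "\<And>i j. i < n \<Longrightarrow> j < n \<Longrightarrow> conjugate (q i) \<bullet> q j = (if i = j then 1 else 0)"
    using orthonormal_extend[OF v n] by auto
  define W where "W = mat n n (\<lambda>(i, j). q j $ i)"
  have W: "W \<in> carrier_mat n n" by (simp add: W_def)
  have "mat_adjoint W * W = 1\<^sub>m n"
  proof (rule eq_matI)
    fix i j assume "i < dim_row (1\<^sub>m n :: complex mat)" "j < dim_col (1\<^sub>m n :: complex mat)"
    then have ij: "i < n" "j < n" by auto
    have "(mat_adjoint W * W) $$ (i, j) = (\<Sum>k<n. cnj (q i $ k) * q j $ k)"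
      using ij W by (simp add: index_mult_mat_sum[of _ n n _ n] W_def del: index_mult_mat)
    also have "\<dots> = conjugate (q i) \<bullet> q j"
      using q(2)[OF ij(1)] by (simp add: scalar_prod_sum[OF q(2)[OF ij(2)]])
    finally show "(mat_adjoint W * W) $$ (i, j) = 1\<^sub>m n $$ (i, j)" using q(3)[OF ij] ij by simp
  qed (use W in auto)
  then have "unitary_mat n W" using W by (rule unitary_matI[rotated])
  moreover have "col W 0 = v"
    using n q(1) v by (intro eq_vecI) (auto simp: W_def)
  ultimately show ?thesis by blast
qed

section \<open>The spectral theorem and singular values\<close>

lemma mat_adjoint_four_block:
  fixes A B C D :: "complex mat"
  assumes "A \<in> carrier_mat n1 m1" "B \<in> carrier_mat n1 m2" "C \<in> carrier_mat n2 m1" "D \<in> carrier_mat n2 m2"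
  shows "mat_adjoint (four_block_mat A B C D)
     = four_block_mat (mat_adjoint A) (mat_adjoint C) (mat_adjoint B) (mat_adjoint D)"
  using assms by (intro eq_matI) auto

lemma block_diag_mult:
  fixes A B P Q :: "complex mat"
  assumes A: "A \<in> carrier_mat 1 1" and B: "B \<in> carrier_mat 1 1"
    and P: "P \<in> carrier_mat m m" and Q: "Q \<in> carrier_mat m m"
  shows "four_block_mat A (0\<^sub>m 1 m) (0\<^sub>m m 1) P * four_block_mat B (0\<^sub>m 1 m) (0\<^sub>m m 1) Q
    = four_block_mat (A * B) (0\<^sub>m 1 m) (0\<^sub>m m 1) (P * Q)"
proof -
  have AB: "A * B \<in> carrier_mat 1 1" and PQ: "P * Q \<in> carrier_mat m m"
    using mult_carrier_mat[OF A B] mult_carrier_mat[OF P Q] by auto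
  show ?thesis
    unfolding mult_four_block_mat[OF A zero_carrier_mat zero_carrier_mat P B zero_carrier_mat
        zero_carrier_mat Q]
    using A B P Q AB PQ by simp
qed

lemma conj_mult_assoc:
  fixes A W F :: "complex mat"
  assumes W: "W \<in> carrier_mat n n" and F: "F \<in> carrier_mat n n" and A: "A \<in> carrier_mat n n"
  shows "mat_adjoint (W * F) * A * (W * F) = mat_adjoint F * (mat_adjoint W * A * W) * F"
proof -
  note aW = mat_adjoint_carrier[OF W] and aF = mat_adjoint_carrier[OF F]
  note c = mult_carrier_mat[of _ n n _ n]
  have "mat_adjoint (W * F) * A * (W * F) = mat_adjoint F * mat_adjoint W * A * (W * F)"
    by (simp only: mat_adjoint_mult[OF W F])
  also have "\<dots> = mat_adjoint F * mat_adjoint W * A * W * F"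
    using assoc_mult_mat[OF c[OF c[OF aF aW] A] W F] by simp
  also have "mat_adjoint F * mat_adjoint W * A = mat_adjoint F * (mat_adjoint W * A)"
    by (rule assoc_mult_mat[OF aF aW A])
  also have "\<dots> * W = mat_adjoint F * (mat_adjoint W * A * W)"
    by (rule assoc_mult_mat[OF aF c[OF aW A] W])
  finally show ?thesis .
qed

text \<open>Induction on the list of eigenvalues: a unit eigenvector for the first one is completed to a
  unitary matrix, and conjugating by it splits off a block of size 1, since a Hermitian matrix whose
  first column is a multiple of the first unit vector has the same first row. Prescribing the
  order of the eigenvalues allows the diagonal to be sorted later without a permutation argument.\<close>

lemma hermitian_diagonalisation:
  fixes A :: "complex mat"
  assumes "A \<in> carrier_mat n n" "mat_adjoint A = A"
    "char_poly A = (\<Prod>e\<leftarrow>es. [:- e, 1:])" "length es = n"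
  shows "\<exists>V. unitary_mat n V \<and> mat_adjoint V * A * V = mat_diag n (\<lambda>i. es ! i)"
  using assms
proof (induction es arbitrary: A n)
  case Nil
  then show ?case by (intro exI[of _ "1\<^sub>m 0"]) (auto simp: unitary_mat_def mat_diag_def intro!: eq_matI)
next
  case (Cons e es)
  define m where "m = length es"
  have n: "n = Suc m" using Cons.prems(4) by (simp add: m_def)
  note A = Cons.prems(1) and herm = Cons.prems(2)
  have "poly (char_poly A) e = 0" by (simp add: Cons.prems(3))
  then have "eigenvalue A e" using eigenvalue_root_char_poly[OF A] by blast
  then obtain v where v: "v \<in> carrier_vec n" "v \<noteq> 0\<^sub>v n" "A *\<^sub>v v = e \<cdot>\<^sub>v v"
    using A by (auto simp: eigenvalue_def eigenvector_def)
  define y where "y = complex_of_real (1 / vnorm v) \<cdot>\<^sub>v v"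
  have nz: "vnorm v \<noteq> 0" using v vnorm_eq_0_iff by blast
  have y: "y \<in> carrier_vec n" "vnorm y = 1"
    using v nz unfolding y_def by (simp_all add: vnorm_smult norm_divide)
  have Ay: "A *\<^sub>v y = e \<cdot>\<^sub>v y"
    using v A by (simp add: y_def mult_mat_vec smult_smult_assoc mult.commute)
  obtain W where W: "unitary_mat n W" "col W 0 = y"
    using unit_vector_to_unitary[OF y] n by auto
  note w = unitary_matD[OF W(1)]
  define B where "B = mat_adjoint W * A * W"
  have B: "B \<in> carrier_mat n n" using w(1,2) A unfolding B_def by (intro mult_carrier_mat[of _ n n]) auto
  have hermB: "mat_adjoint B = B"
    using w(1,2) A herm
    by (simp add: B_def mat_adjoint_mult[of _ n n _ n] assoc_mult_mat[of _ n n _ n _ n])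
  have "col B 0 = mat_adjoint W * A *\<^sub>v y"
    using col_mult2[OF mult_carrier_mat[OF w(2) A] w(1), of 0] n W(2) by (simp only: B_def)
  also have "\<dots> = mat_adjoint W *\<^sub>v (e \<cdot>\<^sub>v y)"
    using w(1,2) A y Ay by (simp add: assoc_mult_mat_vec[of _ n n _ n])
  also have "\<dots> = e \<cdot>\<^sub>v (mat_adjoint W *\<^sub>v col W 0)"
    using w(1,2) y W(2) by (simp add: mult_mat_vec[of _ n n])
  also have "mat_adjoint W *\<^sub>v col W 0 = col (mat_adjoint W * W) 0"
    using w(1,2) n by (simp add: col_mult2[of _ n n _ n])
  also have "\<dots> = unit_vec n 0" using w(3) n by simp
  finally have colB: "col B 0 = e \<cdot>\<^sub>v unit_vec n 0" .
  have B0: "B $$ (i, 0) = (if i = 0 then e else 0)" if "i < n" for i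
    using arg_cong[OF colB, of "\<lambda>x. x $ i"] that B n by (simp add: unit_vec_def)
  have BH: "B $$ (i, j) = cnj (B $$ (j, i))" if "i < n" "j < n" for i j
    using arg_cong[OF hermB, of "\<lambda>X. X $$ (i, j)"] that B by simp
  define A' where "A' = mat m m (\<lambda>(i, j). B $$ (Suc i, Suc j))"
  have A': "A' \<in> carrier_mat m m" by (simp add: A'_def)
  define E where "E = mat 1 1 (\<lambda>_. e)"
  have E: "E \<in> carrier_mat 1 1" by (simp add: E_def)
  have Bblock: "B = four_block_mat E (0\<^sub>m 1 m) (0\<^sub>m m 1) A'"
  proof (rule eq_matI)
    fix i j assume "i < dim_row (four_block_mat E (0\<^sub>m 1 m) (0\<^sub>m m 1) A')"
      "j < dim_col (four_block_mat E (0\<^sub>m 1 m) (0\<^sub>m m 1) A')"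
    then have ij: "i < n" "j < n" using n E A' by auto
    show "B $$ (i, j) = four_block_mat E (0\<^sub>m 1 m) (0\<^sub>m m 1) A' $$ (i, j)"
    proof (cases "j = 0")
      case True
      then show ?thesis using ij E A' B0[OF ij(1)] n by (auto simp: E_def)
    next
      case False
      then show ?thesis using ij E A' B0[OF ij(2)] BH[OF ij] n
        by (cases "i = 0") (auto simp: A'_def)
    qed
  qed (use B n E A' in auto)
  have "similar_mat_wit B A (mat_adjoint W) W"
    using A B w by (auto simp: similar_mat_wit_def Let_def B_def)
  then have "char_poly B = char_poly A"
    by (intro char_poly_similar) (auto simp: similar_mat_def)
  moreover have "char_poly B = char_poly E * char_poly A'"
    unfolding Bblock by (rule char_poly_four_block_zeros_col[OF E _ A']) simp
  moreover have "char_poly E = [:- e, 1:]"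
    by (subst char_poly_upper_triangular[OF E]) (auto simp: E_def diag_mat_def)
  ultimately have "[:- e, 1:] * char_poly A' = [:- e, 1:] * (\<Prod>e\<leftarrow>es. [:- e, 1:])"
    using Cons.prems(3) by simp
  then have cp: "char_poly A' = (\<Prod>e\<leftarrow>es. [:- e, 1:])"
    by (subst (asm) mult_left_cancel) auto
  have hermA': "mat_adjoint A' = A'"
  proof (rule eq_matI)
    fix i j assume "i < dim_row A'" "j < dim_col A'"
    then have ij: "i < m" "j < m" using A' by auto
    then show "mat_adjoint A' $$ (i, j) = A' $$ (i, j)"
      using BH[of "Suc i" "Suc j"] by (simp add: A'_def n)
  qed (use A' in auto)
  obtain V' where V': "unitary_mat m V'" "mat_adjoint V' * A' * V' = mat_diag m (\<lambda>i. es ! i)"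
    using Cons.IH[OF A' hermA' cp m_def[symmetric]] by blast
  note v' = unitary_matD[OF V'(1)]
  define F where "F = four_block_mat (1\<^sub>m 1) (0\<^sub>m 1 m) (0\<^sub>m m 1) V'"
  have F: "F \<in> carrier_mat n n" using four_block_carrier_mat[OF one_carrier_mat[of 1] v'(1)] by (simp add: F_def n)
  have zero_adj: "mat_adjoint (0\<^sub>m a b) = (0\<^sub>m b a :: complex mat)" for a b
    by (rule eq_matI) auto
  have adjF: "mat_adjoint F = four_block_mat (1\<^sub>m 1) (0\<^sub>m 1 m) (0\<^sub>m m 1) (mat_adjoint V')"
    unfolding F_def mat_adjoint_four_block[OF one_carrier_mat zero_carrier_mat zero_carrier_mat v'(1)]
    by (simp only: zero_adj mat_adjoint_one)
  have "mat_adjoint F * F = four_block_mat (1\<^sub>m 1) (0\<^sub>m 1 m) (0\<^sub>m m 1) (1\<^sub>m m)"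
    unfolding adjF unfolding F_def block_diag_mult[OF one_carrier_mat one_carrier_mat v'(2,1)] v'(3)
    by simp
  also have "\<dots> = 1\<^sub>m n" by (simp add: n)
  finally have uF: "unitary_mat n F" using F by (rule unitary_matI[rotated])
  have "mat_adjoint (W * F) * A * (W * F) = mat_adjoint F * B * F"
    unfolding B_def by (rule conj_mult_assoc[OF w(1) F A])
  also have "\<dots> = four_block_mat (1\<^sub>m 1 * E * 1\<^sub>m 1) (0\<^sub>m 1 m) (0\<^sub>m m 1) (mat_adjoint V' * A' * V')"
    unfolding adjF unfolding F_def Bblock block_diag_mult[OF one_carrier_mat E v'(2) A']
    by (rule block_diag_mult[OF mult_carrier_mat[OF one_carrier_mat E] one_carrier_mat
          mult_carrier_mat[OF v'(2) A'] v'(1)])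
  also have "\<dots> = mat_diag n (\<lambda>i. (e # es) ! i)"
    unfolding V'(2) by (rule eq_matI) (use E in \<open>auto simp: n E_def mat_diag_def nth_Cons'\<close>)
  finally show ?case using unitary_mat_mult[OF W(1) uF] by blast
qed

lemma char_poly_eq_prod_proots:
  fixes A :: "complex mat"
  assumes A: "A \<in> carrier_mat n n" and es: "mset es = proots (char_poly A)"
  shows "char_poly A = (\<Prod>e\<leftarrow>es. [:- e, 1:])" "length es = n"
proof -
  have mon: "lead_coeff (char_poly A) = 1" "degree (char_poly A) = n"
    using degree_monic_char_poly[OF A] by auto
  have "char_poly A = (\<Prod>x\<in>#proots (char_poly A). [:- x, 1:])"
    using complex_poly_decompose_multiset[of "char_poly A"] mon by simp
  then show "char_poly A = (\<Prod>e\<leftarrow>es. [:- e, 1:])"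
    by (metis es mset_map prod_mset_prod_list)
  then show "length es = n" using mon degree_linear_factors[of uminus es] by simp
qed

text \<open>Sorting the eigenvalues by the square root of their real part lifts the sorted list of singular
  values to a list of eigenvalues. That these are real and nonnegative is not yet known.\<close>

lemma singular_value_list_lift:
  "\<exists>es. mset es = proots (char_poly (mat_adjoint X * X)) \<and>
        singular_value_list X = map (\<lambda>z. sqrt (Re z)) es"
proof -
  let ?f = "\<lambda>z. sqrt (Re z)"
  obtain xs where xs: "mset xs = proots (char_poly (mat_adjoint X * X))" using ex_mset by blast
  have "sort (map ?f xs) = map ?f (sort_key ?f xs)"
    by (rule properties_for_sort) auto
  moreover have "image_mset ?f (proots (char_poly (mat_adjoint X * X))) = mset (map ?f xs)"
    by (simp add: xs[symmetric])
  then have "sorted_list_of_multiset (image_mset ?f (proots (char_poly (mat_adjoint X * X))))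
      = sort (map ?f xs)"
    by (simp only: sorted_list_of_multiset_mset)
  ultimately have "singular_value_list X = map ?f (rev (sort_key ?f xs))"
    by (simp only: singular_value_list_def rev_map)
  then show ?thesis using xs by (intro exI[of _ "rev (sort_key ?f xs)"]) simp
qed

lemma singular_value_list_antimono:
  assumes "i \<le> j" "j < length (singular_value_list X)"
  shows "singular_value_list X ! j \<le> singular_value_list X ! i"
  using assms by (simp add: singular_value_list_def sorted_rev_nth_mono)

abbreviation sq_diag :: "nat \<Rightarrow> (nat \<Rightarrow> real) \<Rightarrow> complex mat" where
  "sq_diag n s \<equiv> mat_diag n (\<lambda>i. complex_of_real ((s i)\<^sup>2))"

lemma gram_mult:
  fixes X V :: "complex mat"
  assumes X: "X \<in> carrier_mat d1 d2" and V: "V \<in> carrier_mat d2 e"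
  shows "mat_adjoint (X * V) * (X * V) = mat_adjoint V * (mat_adjoint X * X) * V"
proof -
  note aX = mat_adjoint_carrier[OF X] and aV = mat_adjoint_carrier[OF V]
  have "mat_adjoint (X * V) * (X * V) = (mat_adjoint V * mat_adjoint X) * (X * V)"
    by (simp only: mat_adjoint_mult[OF X V])
  also have "\<dots> = (mat_adjoint V * mat_adjoint X) * X * V"
    using assoc_mult_mat[OF mult_carrier_mat[OF aV aX] X V] by simp
  also have "\<dots> = mat_adjoint V * (mat_adjoint X * X) * V"
    using assoc_mult_mat[OF aV aX X] by simp
  finally show ?thesis .
qed

lemma mat_diag_mult_vec_index:
  fixes c :: "complex vec"
  assumes "c \<in> carrier_vec n" "l < n"
  shows "(mat_diag n f *\<^sub>v c) $ l = f l * c $ l"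
proof -
  have "(mat_diag n f *\<^sub>v c) $ l = (\<Sum>k<n. mat_diag n f $$ (l, k) * c $ k)"
    by (rule index_mult_mat_vec_sum[OF mat_diag_dim assms])
  also have "\<dots> = (\<Sum>k<n. (if k = l then f l * c $ l else 0))"
    by (rule sum.cong) (use assms in \<open>auto simp: mat_diag_def\<close>)
  also have "\<dots> = f l * c $ l" using assms(2) by simp
  finally show ?thesis .
qed

text \<open>The diagonal entries of the diagonalised Gram matrix are squared column norms of \<open>X V\<close>. So the
  eigenvalues are real and nonnegative, and squaring the listed singular values recovers them.\<close>

lemma right_singular_basis_list:
  assumes X: "X \<in> carrier_mat d1 d2"
  shows "length (singular_value_list X) = d2"
    and "\<exists>V. unitary_mat d2 V \<and>
      mat_adjoint (X * V) * (X * V) = sq_diag d2 (\<lambda>i. singular_value_list X ! i)"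
    and "i < d2 \<Longrightarrow> 0 \<le> singular_value_list X ! i"
proof -
  define A where "A = mat_adjoint X * X"
  have A: "A \<in> carrier_mat d2 d2" using X unfolding A_def by (intro mult_carrier_mat[of _ d2 d1]) auto
  obtain es where es: "mset es = proots (char_poly A)"
      "singular_value_list X = map (\<lambda>z. sqrt (Re z)) es"
    using singular_value_list_lift[of X] unfolding A_def by blast
  note cp = char_poly_eq_prod_proots[OF A es(1)]
  show len: "length (singular_value_list X) = d2" using es cp by simp
  have herm: "mat_adjoint A = A"
    using X by (simp add: A_def mat_adjoint_mult[of _ d2 d1 _ d2])
  obtain V where V: "unitary_mat d2 V" "mat_adjoint V * A * V = mat_diag d2 (\<lambda>i. es ! i)"
    using hermitian_diagonalisation[OF A herm cp] by blast
  note v = unitary_matD[OF V(1)]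
  have XV: "X * V \<in> carrier_mat d1 d2" using X v by simp
  have "mat_adjoint (X * V) * (X * V) = mat_adjoint V * A * V"
    unfolding A_def by (rule gram_mult[OF X v(1)])
  then have D: "mat_adjoint (X * V) * (X * V) = mat_diag d2 (\<lambda>i. es ! i)" using V by simp
  have nn: "es ! i = complex_of_real (Re (es ! i))" "0 \<le> Re (es ! i)" if i: "i < d2" for i
  proof -
    have "es ! i = (mat_adjoint (X * V) * (X * V)) $$ (i, i)"
      unfolding D using i by (simp add: mat_diag_def)
    also have "\<dots> = (\<Sum>k<d1. cnj ((X * V) $$ (k, i)) * (X * V) $$ (k, i))"
      using XV i by (subst index_mult_mat_sum[of _ d2 d1 _ d2]) (auto simp del: index_mult_mat)
    also have "\<dots> = complex_of_real (\<Sum>k<d1. (cmod ((X * V) $$ (k, i)))\<^sup>2)"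
      by (simp add: complex_norm_square mult.commute del: index_mult_mat of_real_power)
    finally show "es ! i = complex_of_real (Re (es ! i))" "0 \<le> Re (es ! i)"
      by (simp_all add: sum_nonneg del: index_mult_mat)
  qed
  have "(\<lambda>i. complex_of_real ((singular_value_list X ! i)\<^sup>2)) i = es ! i" if "i < d2" for i
    using nn[OF that] that es(2) cp(2) by (simp del: of_real_power)
  then have "sq_diag d2 (\<lambda>i. singular_value_list X ! i) = mat_diag d2 (\<lambda>i. es ! i)"
    by (intro eq_matI) (auto simp: mat_diag_def)
  then show "\<exists>V. unitary_mat d2 V \<and>
      mat_adjoint (X * V) * (X * V) = sq_diag d2 (\<lambda>i. singular_value_list X ! i)"
    using D V(1) by auto
  show "0 \<le> singular_value_list X ! i" if "i < d2"
    using nn[OF that] that es(2) cp(2) by simp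
qed

lemma vnorm_mult_right_basis:
  assumes X: "X \<in> carrier_mat d1 d2" and V: "unitary_mat d2 V"
    and D: "mat_adjoint (X * V) * (X * V) = sq_diag d2 s"
    and x: "x \<in> carrier_vec d2"
  shows "(vnorm (X *\<^sub>v x))\<^sup>2 = (\<Sum>l<d2. (s l)\<^sup>2 * (cmod ((mat_adjoint V *\<^sub>v x) $ l))\<^sup>2)"
proof -
  note v = unitary_matD[OF V]
  define c where "c = mat_adjoint V *\<^sub>v x"
  have c: "c \<in> carrier_vec d2" using v(2) x unfolding c_def by (intro mult_mat_vec_carrier[of _ d2 d2]) auto
  have "V *\<^sub>v c = x"
    unfolding c_def using assoc_mult_mat_vec[OF v(1,2) x] v(4) x by simp
  then have Xx: "X *\<^sub>v x = (X * V) *\<^sub>v c"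
    using assoc_mult_mat_vec[OF X v(1) c] by simp
  have Dc: "sq_diag d2 s *\<^sub>v c \<in> carrier_vec d2"
    using c by (intro mult_mat_vec_carrier[of _ d2 d2]) auto
  have "complex_of_real ((vnorm (X *\<^sub>v x))\<^sup>2)
      = conjugate c \<bullet> (sq_diag d2 s *\<^sub>v c)"
    unfolding Xx D[symmetric] by (rule vnorm_mult_sq[OF mult_carrier_mat[OF X v(1)] c])
  also have "\<dots> = (\<Sum>l<d2. cnj (c $ l) * (complex_of_real ((s l)\<^sup>2) * c $ l))"
    unfolding scalar_prod_sum[OF Dc]
    by (rule sum.cong) (use c in \<open>auto simp: mat_diag_mult_vec_index simp del: index_mult_mat_vec\<close>)
  also have "\<dots> = (\<Sum>l<d2. complex_of_real ((s l)\<^sup>2 * (cmod (c $ l))\<^sup>2))"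
  proof (rule sum.cong)
    fix l
    have "cnj (c $ l) * (complex_of_real ((s l)\<^sup>2) * c $ l)
        = complex_of_real ((s l)\<^sup>2) * (c $ l * cnj (c $ l))" by (simp only: mult_ac)
    also have "\<dots> = complex_of_real ((s l)\<^sup>2 * (cmod (c $ l))\<^sup>2)"
      by (simp only: of_real_mult complex_norm_square)
    finally show "cnj (c $ l) * (complex_of_real ((s l)\<^sup>2) * c $ l)
        = complex_of_real ((s l)\<^sup>2 * (cmod (c $ l))\<^sup>2)" .
  qed simp
  also have "\<dots> = complex_of_real (\<Sum>l<d2. (s l)\<^sup>2 * (cmod (c $ l))\<^sup>2)"
    by (simp only: of_real_sum)
  finally show ?thesis unfolding c_def by (simp only: of_real_eq_iff)
qed

text \<open>The \<open>k\<close> constraints leave a nonzero vector in the \<open>k + 1\<close>-dimensional span of the leading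
  singular vectors, and there \<open>X\<close> stretches by at least the entry number \<open>k\<close> of the list.\<close>

lemma singular_value_list_minimax:
  assumes X: "X \<in> carrier_mat d1 d2" and k: "k < d2"
    and C: "\<And>i. i < k \<Longrightarrow> C i \<in> carrier_vec d2"
    and bound: "\<And>x. x \<in> carrier_vec d2 \<Longrightarrow> (\<And>i. i < k \<Longrightarrow> C i \<bullet> x = 0) \<Longrightarrow>
        vnorm (X *\<^sub>v x) \<le> c * vnorm x"
  shows "singular_value_list X ! k \<le> c"
proof -
  let ?s = "\<lambda>i. singular_value_list X ! i"
  note len = right_singular_basis_list(1)[OF X]
  obtain V where V: "unitary_mat d2 V"
    "mat_adjoint (X * V) * (X * V) = sq_diag d2 ?s"
    using right_singular_basis_list(2)[OF X] by blast
  note v = unitary_matD[OF V(1)]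
  \<comment> \<open>Besides the constraints, \<open>x\<close> is asked to lie in the span of the first \<open>k + 1\<close> basis
    vectors; that is one equation fewer than there are unknowns.\<close>
  define K where "K i = (if i < k then C i else row (mat_adjoint V) (Suc i))" for i
  have K: "K i \<in> carrier_vec d2" for i
  proof (cases "i < k")
    case False
    have "dim_vec (row (mat_adjoint V) (Suc i)) = d2" using v(1) by simp
    then show ?thesis using False unfolding K_def by (auto intro: carrier_vecI)
  qed (simp add: K_def C)
  have "d2 - 1 < d2" using k by simp
  then obtain x where x: "x \<in> carrier_vec d2" "x \<noteq> 0\<^sub>v d2" "\<And>i. i < d2 - 1 \<Longrightarrow> K i \<bullet> x = 0"
    using homogeneous_system_nontrivial[of "d2 - 1" d2 K, OF _ K] by auto
  have Cx: "C i \<bullet> x = 0" if "i < k" for i using x(3)[of i] that k by (simp add: K_def)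
  have Vx: "(mat_adjoint V *\<^sub>v x) $ l = 0" if l: "k < l" "l < d2" for l
  proof -
    have "(mat_adjoint V *\<^sub>v x) $ l = row (mat_adjoint V) l \<bullet> x" using l v(1) by simp
    also have "\<dots> = K (l - 1) \<bullet> x" using l by (auto simp: K_def not_less)
    also have "\<dots> = 0" using l by (intro x(3)) simp
    finally show ?thesis .
  qed
  have "(?s k)\<^sup>2 * (vnorm x)\<^sup>2 = (?s k)\<^sup>2 * (vnorm (mat_adjoint V *\<^sub>v x))\<^sup>2"
    by (simp only: vnorm_unitary[OF unitary_mat_adjoint[OF V(1)] x(1)])
  also have "\<dots> = (\<Sum>l<d2. (?s k)\<^sup>2 * (cmod ((mat_adjoint V *\<^sub>v x) $ l))\<^sup>2)"
    by (simp only: vnorm_sq[OF mult_mat_vec_carrier[OF v(2) x(1)]] sum_distrib_left)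
  also have "\<dots> \<le> (\<Sum>l<d2. (?s l)\<^sup>2 * (cmod ((mat_adjoint V *\<^sub>v x) $ l))\<^sup>2)"
  proof (rule sum_mono)
    fix l assume l: "l \<in> {..<d2}"
    show "(?s k)\<^sup>2 * (cmod ((mat_adjoint V *\<^sub>v x) $ l))\<^sup>2
        \<le> (?s l)\<^sup>2 * (cmod ((mat_adjoint V *\<^sub>v x) $ l))\<^sup>2"
    proof (cases "l \<le> k")
      case True
      then have "?s k \<le> ?s l" using k len by (intro singular_value_list_antimono) auto
      then show ?thesis using right_singular_basis_list(3)[OF X k]
        by (intro mult_right_mono power_mono) auto
    qed (use l Vx in auto)
  qed
  also have "\<dots> = (vnorm (X *\<^sub>v x))\<^sup>2" using vnorm_mult_right_basis[OF X V x(1)] by simp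
  finally have "(?s k * vnorm x)\<^sup>2 \<le> (vnorm (X *\<^sub>v x))\<^sup>2" by (simp only: power_mult_distrib)
  then have "?s k * vnorm x \<le> vnorm (X *\<^sub>v x)" by (rule power2_le_imp_le) simp
  also have "\<dots> \<le> c * vnorm x" using bound[OF x(1) Cx] .
  finally show ?thesis
    using x vnorm_eq_0_iff[OF x(1)] vnorm_nonneg[of x] by (simp add: less_le)
qed

text \<open>The definition of singular values stops at the smaller dimension, the list at the number of
  columns. The entries in between vanish.\<close>

lemma singular_value_eq_list:
  assumes X: "X \<in> carrier_mat d1 d2" and i: "i < d2"
  shows "singular_value X (Suc i) = singular_value_list X ! i"
proof (cases "i < d1")
  case True
  then show ?thesis using X i by (auto simp: singular_value_def)
next
  case False
  note len = right_singular_basis_list(1)[OF X]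
  \<comment> \<open>A vector orthogonal to the \<open>d1\<close> rows is in the kernel.\<close>
  have "singular_value_list X ! d1 \<le> 0"
  proof (rule singular_value_list_minimax[OF X, where C = "\<lambda>i. row X i"])
    fix x assume x: "x \<in> carrier_vec d2" and 0: "\<And>i. i < d1 \<Longrightarrow> row X i \<bullet> x = 0"
    have "X *\<^sub>v x = 0\<^sub>v d1" using X 0 by (intro eq_vecI) auto
    then show "vnorm (X *\<^sub>v x) \<le> 0 * vnorm x" using vnorm_eq_0_iff[of "0\<^sub>v d1" d1] by simp
  qed (use X False i in auto)
  moreover have "singular_value_list X ! i \<le> singular_value_list X ! d1"
    using False i len by (intro singular_value_list_antimono) auto
  ultimately have "singular_value_list X ! i = 0" using right_singular_basis_list(3)[OF X i] by simp
  then show ?thesis using False X by (simp add: singular_value_def)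
qed

lemma singular_value_beyond: "min (dim_row X) (dim_col X) < i \<Longrightarrow> singular_value X i = 0"
  by (auto simp: singular_value_def)

lemma singular_value_nonneg [simp]: "0 \<le> singular_value X i"
proof (cases "1 \<le> i \<and> i \<le> min (dim_row X) (dim_col X)")
  case True
  then show ?thesis
    using right_singular_basis_list(3)[of X "dim_row X" "dim_col X" "i - 1"]
    by (auto simp: singular_value_def)
qed (auto simp: singular_value_def)

lemma singular_value_antimono:
  assumes "i \<le> j"
  shows "singular_value X (Suc j) \<le> singular_value X (Suc i)"
proof (cases "j < min (dim_row X) (dim_col X)")
  case True
  then show ?thesis
    using assms right_singular_basis_list(1)[of X "dim_row X" "dim_col X"]
      singular_value_list_antimono[of i j X]
    by (auto simp: singular_value_def)
qed (auto simp: singular_value_beyond)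

lemma right_singular_basis:
  assumes X: "X \<in> carrier_mat d1 d2"
  shows "\<exists>V. unitary_mat d2 V \<and>
      mat_adjoint (X * V) * (X * V) = sq_diag d2 (\<lambda>i. singular_value X (Suc i))"
proof -
  have "sq_diag d2 (\<lambda>i. singular_value X (Suc i))
     = sq_diag d2 (\<lambda>i. singular_value_list X ! i)"
    by (rule eq_matI) (auto simp: mat_diag_def singular_value_eq_list[OF X])
  then show ?thesis using right_singular_basis_list(2)[OF X] by simp
qed

lemma singular_value_minimax:
  assumes X: "X \<in> carrier_mat d1 d2" and c: "0 \<le> c"
    and C: "\<And>i. i < k \<Longrightarrow> C i \<in> carrier_vec d2"
    and bound: "\<And>x. x \<in> carrier_vec d2 \<Longrightarrow> (\<And>i. i < k \<Longrightarrow> C i \<bullet> x = 0) \<Longrightarrow>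
        vnorm (X *\<^sub>v x) \<le> c * vnorm x"
  shows "singular_value X (Suc k) \<le> c"
proof (cases "k < d2")
  case True
  then show ?thesis
    using singular_value_list_minimax[OF X True C bound] singular_value_eq_list[OF X True] by simp
next
  case False
  then show ?thesis using X c by (simp add: singular_value_beyond)
qed

text \<open>The converse of the minimax bound: orthogonality to the leading singular vectors attains it.\<close>

lemma vnorm_mult_le_singular_value:
  assumes X: "X \<in> carrier_mat d1 d2" and x: "x \<in> carrier_vec d2"
    and V: "unitary_mat d2 V"
    and D: "mat_adjoint (X * V) * (X * V) = sq_diag d2 (\<lambda>i. singular_value X (Suc i))"
    and 0: "\<And>l. l < j \<Longrightarrow> l < d2 \<Longrightarrow> (mat_adjoint V *\<^sub>v x) $ l = 0"
  shows "vnorm (X *\<^sub>v x) \<le> singular_value X (Suc j) * vnorm x"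
proof -
  have a: "mat_adjoint V *\<^sub>v x \<in> carrier_vec d2" using unitary_matD(2)[OF V] x by (intro mult_mat_vec_carrier[of _ d2 d2]) auto
  have "(vnorm (X *\<^sub>v x))\<^sup>2
      = (\<Sum>l<d2. (singular_value X (Suc l))\<^sup>2 * (cmod ((mat_adjoint V *\<^sub>v x) $ l))\<^sup>2)"
    by (rule vnorm_mult_right_basis[OF X V D x])
  also have "\<dots> \<le> (\<Sum>l<d2. (singular_value X (Suc j))\<^sup>2 * (cmod ((mat_adjoint V *\<^sub>v x) $ l))\<^sup>2)"
  proof (rule sum_mono)
    fix l assume l: "l \<in> {..<d2}"
    show "(singular_value X (Suc l))\<^sup>2 * (cmod ((mat_adjoint V *\<^sub>v x) $ l))\<^sup>2
        \<le> (singular_value X (Suc j))\<^sup>2 * (cmod ((mat_adjoint V *\<^sub>v x) $ l))\<^sup>2"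
      using l 0[of l] singular_value_antimono[of j l X]
      by (cases "l < j") (auto intro!: mult_right_mono power_mono)
  qed
  also have "\<dots> = (singular_value X (Suc j) * vnorm x)\<^sup>2"
    by (simp only: vnorm_unitary[OF unitary_mat_adjoint[OF V] x, symmetric] vnorm_sq[OF a]
        sum_distrib_left power_mult_distrib)
  finally show ?thesis by (rule power2_le_imp_le) simp_all
qed

lemma vnorm_mult_le:
  assumes X: "X \<in> carrier_mat d1 d2" and x: "x \<in> carrier_vec d2"
  shows "vnorm (X *\<^sub>v x) \<le> singular_value X 1 * vnorm x"
proof -
  obtain V where "unitary_mat d2 V"
    "mat_adjoint (X * V) * (X * V) = sq_diag d2 (\<lambda>i. singular_value X (Suc i))"
    using right_singular_basis[OF X] by blast
  then show ?thesis using vnorm_mult_le_singular_value[OF X x, of V 0] by simp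
qed

text \<open>Weyl's inequality with side conditions: the constraints \<open>C\<close> are combined with orthogonality
  to the first \<open>j\<close> singular vectors of \<open>B\<close>.\<close>

lemma singular_value_weyl:
  assumes A: "A \<in> carrier_mat d1 d2" and B: "B \<in> carrier_mat e1 d2" and c: "0 \<le> c"
    and C: "\<And>i. i < k \<Longrightarrow> C i \<in> carrier_vec d2"
    and bound: "\<And>x. x \<in> carrier_vec d2 \<Longrightarrow> (\<And>i. i < k \<Longrightarrow> C i \<bullet> x = 0) \<Longrightarrow>
        vnorm (A *\<^sub>v x) \<le> vnorm (B *\<^sub>v x) + c * vnorm x"
    and j: "k + j < d2"
  shows "singular_value A (Suc (k + j)) \<le> singular_value B (Suc j) + c"
proof -
  obtain V where V: "unitary_mat d2 V"
    "mat_adjoint (B * V) * (B * V) = sq_diag d2 (\<lambda>i. singular_value B (Suc i))"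
    using right_singular_basis[OF B] by blast
  note v = unitary_matD[OF V(1)]
  show ?thesis
  proof (rule singular_value_minimax[OF A, where
        C = "\<lambda>i. if i < k then C i else row (mat_adjoint V) (i - k)"])
    fix x assume x: "x \<in> carrier_vec d2"
      and 0: "\<And>i. i < k + j \<Longrightarrow> (if i < k then C i else row (mat_adjoint V) (i - k)) \<bullet> x = 0"
    have Cx: "C i \<bullet> x = 0" if "i < k" for i using 0[of i] that by simp
    have Vx: "(mat_adjoint V *\<^sub>v x) $ l = 0" if "l < j" "l < d2" for l
      using 0[of "k + l"] that v(1) by simp
    have "vnorm (A *\<^sub>v x) \<le> vnorm (B *\<^sub>v x) + c * vnorm x" by (rule bound[OF x Cx])
    also have "\<dots> \<le> (singular_value B (Suc j) + c) * vnorm x"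
      using vnorm_mult_le_singular_value[OF B x V, of j] Vx by (simp add: distrib_right)
    finally show "vnorm (A *\<^sub>v x) \<le> (singular_value B (Suc j) + c) * vnorm x" .
  next
    fix i
    have "row (mat_adjoint V) (i - k) \<in> carrier_vec d2" using v(1) by (intro carrier_vecI) simp
    then show "(if i < k then C i else row (mat_adjoint V) (i - k)) \<in> carrier_vec d2"
      using C by simp
  qed (use c in auto)
qed

section \<open>Frobenius norms, rank and corners of low-rank matrices\<close>

definition frob_sq :: "complex mat \<Rightarrow> real" where
  "frob_sq X = (\<Sum>i<dim_row X. \<Sum>j<dim_col X. (cmod (X $$ (i, j)))\<^sup>2)"

text \<open>Row \<open>i\<close> of \<open>X V\<close> is the conjugate of \<open>V\<^sup>*\<close> applied to the conjugate of row \<open>i\<close> of \<open>X\<close>.\<close>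

lemma frob_sq_mult_unitary:
  assumes X: "X \<in> carrier_mat d1 d2" and V: "unitary_mat d2 V"
  shows "frob_sq (X * V) = frob_sq X"
proof -
  note v = unitary_matD[OF V]
  have "(\<Sum>j<d2. (cmod ((X * V) $$ (i, j)))\<^sup>2) = (\<Sum>j<d2. (cmod (X $$ (i, j)))\<^sup>2)" if i: "i < d1" for i
  proof -
    define y where "y = conjugate (row X i)"
    have y: "y \<in> carrier_vec d2" using X by (auto simp: y_def intro: carrier_vecI)
    have yi: "y $ j = cnj (X $$ (i, j))" if "j < d2" for j
      using that X i by (simp add: y_def)
    have Vy: "mat_adjoint V *\<^sub>v y \<in> carrier_vec d2" by (rule mult_mat_vec_carrier[OF v(2) y])
    have "(mat_adjoint V *\<^sub>v y) $ j = cnj ((X * V) $$ (i, j))" if j: "j < d2" for j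
    proof -
      have "(mat_adjoint V *\<^sub>v y) $ j = (\<Sum>k<d2. mat_adjoint V $$ (j, k) * y $ k)"
        by (rule index_mult_mat_vec_sum[OF v(2) y j])
      also have "\<dots> = cnj (\<Sum>k<d2. X $$ (i, k) * V $$ (k, j))"
        using v(1) j yi by (simp add: mult.commute)
      also have "(\<Sum>k<d2. X $$ (i, k) * V $$ (k, j)) = (X * V) $$ (i, j)"
        by (rule index_mult_mat_sum[OF X v(1) i j, symmetric])
      finally show ?thesis .
    qed
    then have "(\<Sum>j<d2. (cmod ((X * V) $$ (i, j)))\<^sup>2) = (vnorm (mat_adjoint V *\<^sub>v y))\<^sup>2"
      unfolding vnorm_sq[OF Vy] by (intro sum.cong) (simp_all del: index_mult_mat index_mult_mat_vec)
    also have "\<dots> = (vnorm y)\<^sup>2" by (simp only: vnorm_unitary[OF unitary_mat_adjoint[OF V] y])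
    also have "\<dots> = (\<Sum>j<d2. (cmod (X $$ (i, j)))\<^sup>2)"
      unfolding vnorm_sq[OF y] by (intro sum.cong) (simp_all add: yi)
    finally show ?thesis .
  qed
  then show ?thesis
    using X v(1) by (simp add: frob_sq_def del: index_mult_mat(1))
qed

lemma frob_sq_eq_sum_singular_values:
  assumes X: "X \<in> carrier_mat d1 d2"
  shows "frob_sq X = (\<Sum>j<d2. (singular_value X (Suc j))\<^sup>2)"
proof -
  obtain V where V: "unitary_mat d2 V"
    "mat_adjoint (X * V) * (X * V) = sq_diag d2 (\<lambda>i. singular_value X (Suc i))"
    using right_singular_basis[OF X] by blast
  note v = unitary_matD[OF V(1)]
  define Z where "Z = X * V"
  have Z: "Z \<in> carrier_mat d1 d2" unfolding Z_def by (rule mult_carrier_mat[OF X v(1)])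
  have col: "(\<Sum>i<d1. (cmod (Z $$ (i, j)))\<^sup>2) = (singular_value X (Suc j))\<^sup>2" if j: "j < d2" for j
  proof -
    have "complex_of_real (\<Sum>i<d1. (cmod (Z $$ (i, j)))\<^sup>2)
        = (\<Sum>i<d1. mat_adjoint Z $$ (j, i) * Z $$ (i, j))"
      unfolding of_real_sum
    proof (rule sum.cong)
      fix i assume "i \<in> {..<d1}"
      then have "mat_adjoint Z $$ (j, i) = cnj (Z $$ (i, j))" using Z j by simp
      then show "complex_of_real ((cmod (Z $$ (i, j)))\<^sup>2) = mat_adjoint Z $$ (j, i) * Z $$ (i, j)"
        by (simp only: complex_norm_square mult.commute)
    qed simp
    also have "\<dots> = (mat_adjoint Z * Z) $$ (j, j)"
      by (rule index_mult_mat_sum[OF mat_adjoint_carrier[OF Z] Z j j, symmetric])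
    also have "\<dots> = complex_of_real ((singular_value X (Suc j))\<^sup>2)"
      unfolding Z_def V(2) using j by (simp add: mat_diag_def)
    finally show ?thesis by (simp only: of_real_eq_iff)
  qed
  have "frob_sq X = frob_sq Z" unfolding Z_def by (rule frob_sq_mult_unitary[OF X V(1), symmetric])
  also have "\<dots> = (\<Sum>j<d2. \<Sum>i<d1. (cmod (Z $$ (i, j)))\<^sup>2)"
    unfolding frob_sq_def using Z by (subst sum.swap) simp
  also have "\<dots> = (\<Sum>j<d2. (singular_value X (Suc j))\<^sup>2)" by (intro sum.cong) (simp_all add: col)
  finally show ?thesis .
qed

text \<open>From \<open>\<parallel>X\<^sup>* y\<parallel>\<^sup>2 = \<langle>X X\<^sup>* y, y\<rangle>\<close> and Cauchy--Schwarz.\<close>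

lemma vnorm_adjoint_mult_le:
  assumes X: "X \<in> carrier_mat d1 d2" and y: "y \<in> carrier_vec d1"
  shows "vnorm (mat_adjoint X *\<^sub>v y) \<le> singular_value X 1 * vnorm y"
proof -
  define z where "z = mat_adjoint X *\<^sub>v y"
  note aX = mat_adjoint_carrier[OF X]
  have z: "z \<in> carrier_vec d2" unfolding z_def by (rule mult_mat_vec_carrier[OF aX y])
  have Xz: "X *\<^sub>v z \<in> carrier_vec d1" by (rule mult_mat_vec_carrier[OF X z])
  have "complex_of_real ((vnorm z)\<^sup>2) = conjugate z \<bullet> z" by (rule vnorm_sq_scalar_prod[OF z])
  also have "\<dots> = conjugate (X *\<^sub>v z) \<bullet> y"
    using scalar_prod_adjoint[OF aX y z] by (simp add: z_def)
  finally have "(vnorm z)\<^sup>2 = cmod (conjugate (X *\<^sub>v z) \<bullet> y)"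
    by (metis abs_of_nonneg norm_of_real zero_le_power2)
  also have "\<dots> \<le> vnorm (X *\<^sub>v z) * vnorm y" by (rule cmod_scalar_prod_le[OF Xz y])
  also have "\<dots> \<le> (singular_value X 1 * vnorm z) * vnorm y"
    by (intro mult_right_mono vnorm_mult_le[OF X z]) simp
  finally have le: "vnorm z * vnorm z \<le> vnorm z * (singular_value X 1 * vnorm y)"
    by (simp add: power2_eq_square mult_ac)
  show ?thesis
  proof (cases "vnorm z = 0")
    case True
    then show ?thesis by (simp add: z_def)
  next
    case False
    then have "0 < vnorm z" using vnorm_nonneg[of z] by linarith
    then show ?thesis using le by (simp add: z_def)
  qed
qed

lemma singular_value_unitary_conj:
  assumes X: "X \<in> carrier_mat d1 d2" and U: "unitary_mat d1 U" and V: "unitary_mat d2 V"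
  shows "singular_value (mat_adjoint U * X * V) i = singular_value X i"
proof -
  note u = unitary_matD[OF U] and v = unitary_matD[OF V]
  note aX = mat_adjoint_carrier[OF X]
  define Y where "Y = mat_adjoint U * X"
  have Y: "Y \<in> carrier_mat d1 d2" unfolding Y_def by (rule mult_carrier_mat[OF u(2) X])
  have "mat_adjoint Y * Y = mat_adjoint X * (U * mat_adjoint U) * X"
    unfolding Y_def using gram_mult[OF u(2) X] by simp
  also have "\<dots> = mat_adjoint X * X" unfolding u(4) using aX X by simp
  finally have YY: "mat_adjoint Y * Y = mat_adjoint X * X" .
  have "mat_adjoint (Y * V) * (Y * V) = mat_adjoint V * (mat_adjoint X * X) * V"
    unfolding gram_mult[OF Y v(1)] YY ..
  moreover have "similar_mat_wit (mat_adjoint V * (mat_adjoint X * X) * V) (mat_adjoint X * X)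
      (mat_adjoint V) V"
    by (rule similar_mat_witI[OF v(3,4) refl
          mult_carrier_mat[OF mult_carrier_mat[OF v(2) mult_carrier_mat[OF aX X]] v(1)]
          mult_carrier_mat[OF aX X] v(2,1)])
  then have "similar_mat (mat_adjoint V * (mat_adjoint X * X) * V) (mat_adjoint X * X)"
    unfolding similar_mat_def by blast
  ultimately have "char_poly (mat_adjoint (Y * V) * (Y * V)) = char_poly (mat_adjoint X * X)"
    using char_poly_similar by metis
  then have "singular_value_list (Y * V) = singular_value_list X"
    by (simp add: singular_value_list_def)
  moreover have "dim_row (Y * V) = dim_row X" "dim_col (Y * V) = dim_col X"
    using X Y v(1) by auto
  ultimately show ?thesis unfolding Y_def[symmetric] singular_value_def by presburger
qed

text \<open>If \<open>S\<close> is a basis of the column space of \<open>X\<close>, then a vector \<open>x\<close> with \<open>X x\<close> orthogonal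
  to \<open>S\<close> satisfies \<open>X\<^sup>* X x = 0\<close>, hence \<open>X x = 0\<close>.\<close>

lemma kernel_of_rank:
  fixes X :: "complex mat"
  assumes X: "X \<in> carrier_mat d1 d2" and r: "vec_space.rank d1 X = r"
  shows "\<exists>w. (\<forall>i<r. w i \<in> carrier_vec d2) \<and>
    (\<forall>x\<in>carrier_vec d2. (\<forall>i<r. w i \<bullet> x = 0) \<longrightarrow> X *\<^sub>v x = 0\<^sub>v d1)"
proof -
  interpret vec_space "TYPE(complex)" d1 .
  let ?P = "\<lambda>T. T \<subseteq> set (cols X) \<and> lin_indpt T"
  have cols: "set (cols X) \<subseteq> carrier_vec d1" using X cols_dim by blast
  obtain S where S: "finite S" "maximal S ?P"
    using maximal_exists_superset[of "set (cols X)" ?P "{}"] by (auto simp: lin_dep_def)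
  have card: "card S = r" using rank_card_indpt[OF X S(2)] r by simp
  have Ssub: "S \<subseteq> set (cols X)" and li: "lin_indpt S" using S(2) unfolding maximal_def by auto
  have Sc: "S \<subseteq> carrier_vec d1" using Ssub cols by blast
  have in_span: "c \<in> span S" if c: "c \<in> set (cols X)" for c
  proof (rule ccontr)
    assume n: "c \<notin> span S"
    then have "c \<notin> S" using in_own_span[of S] Sc by auto
    moreover have "lin_indpt (S \<union> {c})"
      using lin_dep_iff_in_span[of S c] Sc li c cols n \<open>c \<notin> S\<close> by auto
    ultimately show False using S(2) Ssub c unfolding maximal_def by blast
  qed
  obtain f where f: "bij_betw f {..<r} S" using ex_bij_betw_nat_finite[OF S(1)] card
    by (auto simp: lessThan_atLeast0)
  have fS: "f i \<in> carrier_vec d1" if "i < r" for i using f that Sc by (auto simp: bij_betw_def)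
  define w where "w i = conjugate (mat_adjoint X *\<^sub>v f i)" for i
  have w: "w i \<in> carrier_vec d2" if "i < r" for i
    using mult_mat_vec_carrier[OF mat_adjoint_carrier[OF X] fS[OF that]] by (simp add: w_def)
  have "X *\<^sub>v x = 0\<^sub>v d1" if x: "x \<in> carrier_vec d2" and wx: "\<forall>i<r. w i \<bullet> x = 0" for x
  proof -
    define y where "y = X *\<^sub>v x"
    have y: "y \<in> carrier_vec d1" unfolding y_def by (rule mult_mat_vec_carrier[OF X x])
    have "conjugate (f i) \<bullet> y = 0" if "i < r" for i
      using scalar_prod_adjoint[OF X x fS[OF that]] wx that by (simp add: w_def y_def)
    then have ortho: "conjugate y \<bullet> s = 0" if "s \<in> S" for s
    proof -
      obtain i where i: "i < r" "s = f i" using f \<open>s \<in> S\<close> by (auto simp: bij_betw_def)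
      have "conjugate (conjugate s \<bullet> y) = 0" using \<open>\<And>i. i < r \<Longrightarrow> conjugate (f i) \<bullet> y = 0\<close> i by simp
      then have "s \<bullet> conjugate y = 0" using fS[OF i(1)] y i(2)
        by (metis conjugate_conjugate_sprod conjugate_id carrier_vec_conjugate conjugate_sprod_vec)
      then show ?thesis using fS[OF i(1)] y i(2) comm_scalar_prod[of s d1 "conjugate y"] by simp
    qed
    let ?N = "{u \<in> carrier_vec d1. conjugate y \<bullet> u = 0}"
    have "submodule class_ring ?N V"
      unfolding submodule_def
      using module_axioms y by (auto simp: module_vec_simps scalar_prod_add_distrib[of _ d1])
    then have "span S \<subseteq> ?N" using Sc ortho by (intro span_is_subset) auto
    then have colz: "conjugate y \<bullet> col X j = 0" if "j < d2" for j
      using in_span[of "col X j"] that X by (auto simp: cols_def)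
    have "complex_of_real ((vnorm y)\<^sup>2) = conjugate (mat_adjoint X *\<^sub>v y) \<bullet> x"
      using vnorm_sq_scalar_prod[OF y] scalar_prod_adjoint[OF X x y] by (simp add: y_def)
    also have "\<dots> = 0"
    proof -
      have "conjugate (mat_adjoint X *\<^sub>v y) = 0\<^sub>v d2"
      proof (rule eq_vecI)
        fix j assume "j < dim_vec (0\<^sub>v d2 :: complex vec)"
        then have j: "j < d2" by simp
        have "conjugate (mat_adjoint X *\<^sub>v y) $ j = cnj (\<Sum>k<d1. mat_adjoint X $$ (j, k) * y $ k)"
          using index_mult_mat_vec_sum[OF mat_adjoint_carrier[OF X] y j] X j
          by (simp del: index_mult_mat_vec)
        also have "\<dots> = (\<Sum>k<d1. conjugate y $ k * col X j $ k)"
          using X y j by (simp add: mult.commute)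
        also have "\<dots> = conjugate y \<bullet> col X j"
          using X j by (subst scalar_prod_sum[of _ d1]) auto
        finally show "conjugate (mat_adjoint X *\<^sub>v y) $ j = 0\<^sub>v d2 $ j" using colz[OF j] j by simp
      qed (use X in auto)
      then show ?thesis using x by simp
    qed
    finally have "vnorm y = 0" by simp
    then show ?thesis using vnorm_eq_0_iff[OF y] by (simp add: y_def)
  qed
  then show ?thesis using w by blast
qed


text \<open>The corner alone, as a matrix \<open>R\<close>, agrees with \<open>N\<close> on all vectors whose first \<open>r\<close> coordinates
  vanish and which are orthogonal to the first \<open>r\<close> rows of \<open>N\<close>. These are \<open>2 r\<close> equations, so Weyl's
  inequality shifts singular values by \<open>2 r\<close>. It is the lower bound of the Eckart--Young
  theorem for the approximation of \<open>N\<close> by \<open>N - R\<close>, a matrix of rank at most \<open>2 r\<close>.\<close>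

lemma tail_le_corner:
  assumes N: "N \<in> carrier_mat d1 d2" and r: "r \<le> d1" "2 * r \<le> d2"
  shows "(\<Sum>j\<in>{2 * r..<d2}. (singular_value N (Suc j))\<^sup>2)
    \<le> (\<Sum>i\<in>{r..<d1}. \<Sum>j\<in>{r..<d2}. (cmod (N $$ (i, j)))\<^sup>2)"
proof -
  define R where "R = mat d1 d2 (\<lambda>(i, j). if r \<le> i \<and> r \<le> j then N $$ (i, j) else 0)"
  have R: "R \<in> carrier_mat d1 d2" by (simp add: R_def)
  define C where "C i = (if i < r then unit_vec d2 i else row N (i - r))" for i
  have C: "C i \<in> carrier_vec d2" for i
  proof (cases "i < r")
    case False
    have "row N (i - r) \<in> carrier_vec d2" using N by (intro carrier_vecI) simp
    then show ?thesis using False by (simp add: C_def)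
  qed (simp add: C_def)
  have NR: "N *\<^sub>v x = R *\<^sub>v x" if x: "x \<in> carrier_vec d2" and 0: "\<And>i. i < 2 * r \<Longrightarrow> C i \<bullet> x = 0" for x
  proof (rule eq_vecI)
    have xz: "x $ j = 0" if "j < r" for j using 0[of j] that r x by (simp add: C_def)
    fix i assume "i < dim_vec (R *\<^sub>v x)"
    then have i: "i < d1" using R by simp
    have "(N *\<^sub>v x) $ i = (\<Sum>k<d2. R $$ (i, k) * x $ k)"
    proof (cases "i < r")
      case True
      then have "(N *\<^sub>v x) $ i = 0" using 0[of "r + i"] i N by (simp add: C_def)
      moreover have "R $$ (i, k) = 0" if "k < d2" for k using True i that by (simp add: R_def)
      ultimately show ?thesis by simp
    next
      case False
      have "(N *\<^sub>v x) $ i = (\<Sum>k<d2. N $$ (i, k) * x $ k)"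
        by (rule index_mult_mat_vec_sum[OF N x i])
      also have "\<dots> = (\<Sum>k<d2. R $$ (i, k) * x $ k)"
        by (rule sum.cong) (use False i xz in \<open>auto simp: R_def not_le\<close>)
      finally show ?thesis .
    qed
    then show "(N *\<^sub>v x) $ i = (R *\<^sub>v x) $ i" using index_mult_mat_vec_sum[OF R x i] by simp
  qed (use N R in simp)
  have le: "singular_value N (Suc (2 * r + j)) \<le> singular_value R (Suc j)" if "2 * r + j < d2" for j
    using singular_value_weyl[where C = C and k = "2 * r" and c = 0, OF N R order.refl C _ that] NR
    by simp
  have "(\<Sum>j\<in>{2 * r..<d2}. (singular_value N (Suc j))\<^sup>2)
      = (\<Sum>j<d2 - 2 * r. (singular_value N (Suc (2 * r + j)))\<^sup>2)"
    by (rule sum.reindex_bij_witness[of _ "\<lambda>j. 2 * r + j" "\<lambda>j. j - 2 * r"]) auto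
  also have "\<dots> \<le> (\<Sum>j<d2 - 2 * r. (singular_value R (Suc j))\<^sup>2)"
    using le by (intro sum_mono power_mono) auto
  also have "\<dots> \<le> (\<Sum>j<d2. (singular_value R (Suc j))\<^sup>2)" by (rule sum_mono2) auto
  also have "\<dots> = frob_sq R" by (rule frob_sq_eq_sum_singular_values[OF R, symmetric])
  also have "\<dots> = (\<Sum>i<d1. \<Sum>j<d2. if r \<le> i \<and> r \<le> j then (cmod (N $$ (i, j)))\<^sup>2 else 0)"
    unfolding frob_sq_def by (auto simp: R_def intro!: sum.cong)
  also have "\<dots> = (\<Sum>i<d1. if r \<le> i then (\<Sum>j\<in>{r..<d2}. (cmod (N $$ (i, j)))\<^sup>2) else 0)"
    by (intro sum.cong refl) (auto simp: sum.If_cases intro!: sum.cong)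
  also have "\<dots> = (\<Sum>i\<in>{r..<d1}. \<Sum>j\<in>{r..<d2}. (cmod (N $$ (i, j)))\<^sup>2)"
    by (auto simp: sum.If_cases intro!: sum.cong)
  finally show ?thesis .
qed

text \<open>Write \<open>M = \<Sum>k<r. z\<^sub>k v\<^sub>k\<^sup>*\<close> with orthonormal \<open>v\<^sub>k\<close> and orthogonal \<open>z\<^sub>k\<close> of norm \<open>s k\<close>. The bound
  \<open>cols\<close> applied to \<open>z\<^sub>k\<close> shows that the trailing coordinates of \<open>v\<^sub>k\<close> are at most \<open>b / s k\<close>, since
  \<open>M\<^sup>* z\<^sub>k = (s k)\<^sup>2 v\<^sub>k\<close>. A trailing column of \<open>M\<close> is \<open>M\<close> applied to a combination of the \<open>v\<^sub>k\<close> with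
  just these small coefficients, and \<open>rows\<close> gives the second factor \<open>b\<close>.\<close>

lemma low_rank_corner:
  assumes M: "M \<in> carrier_mat d1 d2" and r: "1 \<le> r" "r \<le> d2"
    and rank: "\<And>k. r \<le> k \<Longrightarrow> singular_value M (Suc k) = 0"
    and \<sigma>: "\<sigma> = singular_value M r" "0 < \<sigma>"
    and rows: "\<And>x. x \<in> carrier_vec d2 \<Longrightarrow> (\<Sum>i\<in>{r..<d1}. (cmod ((M *\<^sub>v x) $ i))\<^sup>2) \<le> b\<^sup>2 * (vnorm x)\<^sup>2"
    and cols: "\<And>y. y \<in> carrier_vec d1 \<Longrightarrow>
      (\<Sum>j\<in>{r..<d2}. (cmod ((mat_adjoint M *\<^sub>v y) $ j))\<^sup>2) \<le> b\<^sup>2 * (vnorm y)\<^sup>2"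
  shows "(\<Sum>i\<in>{r..<d1}. \<Sum>j\<in>{r..<d2}. (cmod (M $$ (i, j)))\<^sup>2) \<le> real r * (b\<^sup>2 / \<sigma>)\<^sup>2"
proof -
  define s where "s k = singular_value M (Suc k)" for k
  obtain V where V: "unitary_mat d2 V"
    "mat_adjoint (M * V) * (M * V) = sq_diag d2 s"
    using right_singular_basis[OF M] unfolding s_def by blast
  note v = unitary_matD[OF V(1)]
  note aM = mat_adjoint_carrier[OF M]
  define Z where "Z = M * V"
  have Z: "Z \<in> carrier_mat d1 d2" unfolding Z_def by (rule mult_carrier_mat[OF M v(1)])
  note aZ = mat_adjoint_carrier[OF Z]
  have colc: "col Z k \<in> carrier_vec d1" for k using Z by (intro carrier_vecI) simp
  have znorm: "(vnorm (col Z k))\<^sup>2 = (s k)\<^sup>2" if k: "k < d2" for k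
  proof -
    have "complex_of_real ((vnorm (col Z k))\<^sup>2) = conjugate (col Z k) \<bullet> col Z k"
      by (rule vnorm_sq_scalar_prod[OF colc])
    also have "\<dots> = (\<Sum>i<d1. mat_adjoint Z $$ (k, i) * Z $$ (i, k))"
      unfolding scalar_prod_sum[OF colc] using Z k by (intro sum.cong) auto
    also have "\<dots> = (mat_adjoint Z * Z) $$ (k, k)"
      by (rule index_mult_mat_sum[OF aZ Z k k, symmetric])
    also have "\<dots> = complex_of_real ((s k)\<^sup>2)" unfolding Z_def V(2) using k by (simp add: mat_diag_def)
    finally show ?thesis by (simp only: of_real_eq_iff)
  qed
  have zcol0: "Z $$ (i, k) = 0" if "i < d1" "r \<le> k" "k < d2" for i k
  proof -
    have "vnorm (col Z k) = 0" using znorm[of k] that rank[of k] by (simp add: s_def)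
    then have "col Z k = 0\<^sub>v d1" using vnorm_eq_0_iff[OF colc] by blast
    then have "col Z k $ i = 0" using that by simp
    then show ?thesis using that Z by simp
  qed
  have "mat_adjoint M * Z = V * (mat_adjoint Z * Z)"
  proof -
    have "mat_adjoint Z = mat_adjoint V * mat_adjoint M"
      unfolding Z_def by (rule mat_adjoint_mult[OF M v(1)])
    then have "V * mat_adjoint Z = (V * mat_adjoint V) * mat_adjoint M"
      using assoc_mult_mat[OF v(1,2) aM] by simp
    then have "V * mat_adjoint Z = mat_adjoint M"
      unfolding v(4) by (simp only: left_mult_one_mat[OF aM])
    then show ?thesis using assoc_mult_mat[OF v(1) aZ Z] by simp
  qed
  then have aMZ: "mat_adjoint M * Z = V * sq_diag d2 s"
    using V(2) by (simp add: Z_def)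
  have aMz: "(mat_adjoint M *\<^sub>v col Z k) $ j = V $$ (j, k) * complex_of_real ((s k)\<^sup>2)"
    if "j < d2" "k < d2" for j k
  proof -
    have "(mat_adjoint M *\<^sub>v col Z k) $ j = col (mat_adjoint M * Z) k $ j"
      by (simp only: col_mult2[OF aM Z that(2)])
    also have "\<dots> = (mat_adjoint M * Z) $$ (j, k)"
      by (rule index_col) (use that M Z in simp_all)
    also have "\<dots> = (\<Sum>l<d2. V $$ (j, l) * sq_diag d2 s $$ (l, k))"
      unfolding aMZ by (rule index_mult_mat_sum[OF v(1) mat_diag_dim that])
    also have "\<dots> = (\<Sum>l<d2. if l = k then V $$ (j, k) * complex_of_real ((s k)\<^sup>2) else 0)"
      by (rule sum.cong) (use that in \<open>auto simp: mat_diag_def\<close>)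
    also have "\<dots> = V $$ (j, k) * complex_of_real ((s k)\<^sup>2)" using that by simp
    finally show ?thesis .
  qed
  have Vsmall: "(\<Sum>j\<in>{r..<d2}. (cmod (V $$ (j, k)))\<^sup>2) \<le> (b / \<sigma>)\<^sup>2" if k: "k < r" for k
  proof -
    have kd: "k < d2" using k r by simp
    have "\<sigma> \<le> s k" using singular_value_antimono[of k "r - 1" M] k r \<sigma> by (simp add: s_def)
    then have sk: "0 < s k" "\<sigma>\<^sup>2 \<le> (s k)\<^sup>2" using \<sigma>(2) by (auto intro: power_mono)
    let ?S = "\<Sum>j\<in>{r..<d2}. (cmod (V $$ (j, k)))\<^sup>2"
    have "(s k)\<^sup>2 * (s k)\<^sup>2 * ?S = (\<Sum>j\<in>{r..<d2}. (cmod ((mat_adjoint M *\<^sub>v col Z k) $ j))\<^sup>2)"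
      unfolding sum_distrib_left
    proof (rule sum.cong)
      fix j assume "j \<in> {r..<d2}"
      then have j: "j < d2" by simp
      show "(s k)\<^sup>2 * (s k)\<^sup>2 * (cmod (V $$ (j, k)))\<^sup>2 = (cmod ((mat_adjoint M *\<^sub>v col Z k) $ j))\<^sup>2"
        unfolding aMz[OF j kd] norm_mult norm_of_real by (simp add: power2_eq_square mult_ac)
    qed simp
    also have "\<dots> \<le> b\<^sup>2 * (vnorm (col Z k))\<^sup>2" by (rule cols[OF colc])
    also have "\<dots> = (s k)\<^sup>2 * b\<^sup>2" using znorm[OF kd] by simp
    finally have "(s k)\<^sup>2 * ((s k)\<^sup>2 * ?S) \<le> (s k)\<^sup>2 * b\<^sup>2" by (simp add: mult.assoc)
    then have "(s k)\<^sup>2 * ?S \<le> b\<^sup>2" by (rule mult_left_le_imp_le) (use sk in simp)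
    moreover have "\<sigma>\<^sup>2 * ?S \<le> (s k)\<^sup>2 * ?S" using sk(2) by (intro mult_right_mono sum_nonneg) auto
    ultimately have "\<sigma>\<^sup>2 * ?S \<le> b\<^sup>2" by linarith
    then show ?thesis using \<sigma>(2) by (simp add: power_divide field_simps)
  qed
  \<comment> \<open>Column \<open>j\<close> of \<open>M\<close> is \<open>M (V c)\<close>, where \<open>c\<close> is the conjugated row \<open>j\<close> of \<open>V\<close> cut off at \<open>r\<close>; the cut
    is harmless because the later columns of \<open>Z\<close> vanish.\<close>
  have colM: "(\<Sum>i\<in>{r..<d1}. (cmod (M $$ (i, j)))\<^sup>2) \<le> b\<^sup>2 * (\<Sum>k<r. (cmod (V $$ (j, k)))\<^sup>2)"
    if j: "j < d2" for j
  proof -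
    define c where "c = vec d2 (\<lambda>k. if k < r then cnj (V $$ (j, k)) else 0)"
    have c: "c \<in> carrier_vec d2" by (simp add: c_def)
    have Vc: "V *\<^sub>v c \<in> carrier_vec d2" by (rule mult_mat_vec_carrier[OF v(1) c])
    have MV: "M = Z * mat_adjoint V"
      unfolding Z_def using assoc_mult_mat[OF M v(1,2)] v(4) M by simp
    have "(M *\<^sub>v (V *\<^sub>v c)) $ i = M $$ (i, j)" if i: "i < d1" for i
    proof -
      have "M *\<^sub>v (V *\<^sub>v c) = Z *\<^sub>v c" unfolding Z_def by (rule assoc_mult_mat_vec[OF M v(1) c, symmetric])
      then have "(M *\<^sub>v (V *\<^sub>v c)) $ i = (\<Sum>k<d2. Z $$ (i, k) * c $ k)"
        using index_mult_mat_vec_sum[OF Z c i] by simp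
      also have "\<dots> = (\<Sum>k<d2. Z $$ (i, k) * mat_adjoint V $$ (k, j))"
        by (rule sum.cong) (use v(1) j i zcol0 in \<open>auto simp: c_def not_less\<close>)
      also have "\<dots> = (Z * mat_adjoint V) $$ (i, j)"
        by (rule index_mult_mat_sum[OF Z v(2) i j, symmetric])
      finally show ?thesis using MV by simp
    qed
    then have "(\<Sum>i\<in>{r..<d1}. (cmod (M $$ (i, j)))\<^sup>2)
        = (\<Sum>i\<in>{r..<d1}. (cmod ((M *\<^sub>v (V *\<^sub>v c)) $ i))\<^sup>2)" by (intro sum.cong) auto
    also have "\<dots> \<le> b\<^sup>2 * (vnorm (V *\<^sub>v c))\<^sup>2" by (rule rows[OF Vc])
    also have "vnorm (V *\<^sub>v c) = vnorm c" by (rule vnorm_unitary[OF V(1) c])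
    also have "(vnorm c)\<^sup>2 = (\<Sum>k<d2. if k < r then (cmod (V $$ (j, k)))\<^sup>2 else 0)"
      unfolding vnorm_sq[OF c] by (rule sum.cong) (auto simp: c_def)
    also have "\<dots> = (\<Sum>k\<in>{..<d2} \<inter> {k. k < r}. (cmod (V $$ (j, k)))\<^sup>2)"
      by (simp add: sum.If_cases)
    also have "{..<d2} \<inter> {k. k < r} = {..<r}" using r by auto
    finally show ?thesis .
  qed
  have "(\<Sum>i\<in>{r..<d1}. \<Sum>j\<in>{r..<d2}. (cmod (M $$ (i, j)))\<^sup>2)
      = (\<Sum>j\<in>{r..<d2}. \<Sum>i\<in>{r..<d1}. (cmod (M $$ (i, j)))\<^sup>2)" by (rule sum.swap)
  also have "\<dots> \<le> (\<Sum>j\<in>{r..<d2}. b\<^sup>2 * (\<Sum>k<r. (cmod (V $$ (j, k)))\<^sup>2))"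
    by (intro sum_mono colM) simp
  also have "\<dots> = b\<^sup>2 * (\<Sum>k<r. \<Sum>j\<in>{r..<d2}. (cmod (V $$ (j, k)))\<^sup>2)"
    unfolding sum_distrib_left[symmetric] by (subst sum.swap) (rule refl)
  also have "\<dots> \<le> b\<^sup>2 * (\<Sum>k<r. (b / \<sigma>)\<^sup>2)"
    by (intro mult_left_mono sum_mono Vsmall) auto
  also have "\<dots> = real r * (b\<^sup>2 / \<sigma>)\<^sup>2" by (simp add: power_divide power2_eq_square)
  finally show ?thesis .
qed

text \<open>Trailing rows of a matrix \<open>D - E\<close> that is close to a diagonal one with small trailing entries.
  It supplies the row and column hypotheses of \<open>low_rank_corner\<close>.\<close>

lemma trailing_rows_bound:
  fixes D E :: "complex mat"
  assumes D: "D \<in> carrier_mat d1 d2" and E: "E \<in> carrier_mat d1 d2" and e: "0 \<le> e"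
    and diag: "\<And>i j. i < d1 \<Longrightarrow> j < d2 \<Longrightarrow> i \<noteq> j \<Longrightarrow> D $$ (i, j) = 0"
    and small: "\<And>i. r \<le> i \<Longrightarrow> i < d1 \<Longrightarrow> i < d2 \<Longrightarrow> cmod (D $$ (i, i)) \<le> e"
    and Ex: "\<And>x. x \<in> carrier_vec d2 \<Longrightarrow> vnorm (E *\<^sub>v x) \<le> e * vnorm x"
    and x: "x \<in> carrier_vec d2"
  shows "(\<Sum>i\<in>{r..<d1}. (cmod (((D - E) *\<^sub>v x) $ i))\<^sup>2) \<le> (2 * e)\<^sup>2 * (vnorm x)\<^sup>2"
proof -
  let ?I = "{r..<d1}"
  have Dxi: "(D *\<^sub>v x) $ i = (if i < d2 then D $$ (i, i) * x $ i else 0)" if i: "i < d1" for i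
  proof -
    have "(D *\<^sub>v x) $ i = (\<Sum>k<d2. D $$ (i, k) * x $ k)" by (rule index_mult_mat_vec_sum[OF D x i])
    also have "\<dots> = (\<Sum>k<d2. if k = i then D $$ (i, i) * x $ i else 0)"
      by (rule sum.cong) (use i diag in auto)
    finally show ?thesis by simp
  qed
  have "L2_set (\<lambda>i. cmod (((D - E) *\<^sub>v x) $ i)) ?I
      \<le> L2_set (\<lambda>i. cmod ((D *\<^sub>v x) $ i) + cmod ((E *\<^sub>v x) $ i)) ?I"
  proof (rule L2_set_mono)
    fix i assume "i \<in> ?I"
    then have "((D - E) *\<^sub>v x) $ i = (D *\<^sub>v x) $ i - (E *\<^sub>v x) $ i"
      using minus_mult_distrib_mat_vec[OF D E x] D E by (simp del: index_mult_mat_vec)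
    then show "cmod (((D - E) *\<^sub>v x) $ i) \<le> cmod ((D *\<^sub>v x) $ i) + cmod ((E *\<^sub>v x) $ i)"
      by (simp only: norm_triangle_ineq4)
  qed simp
  also have "\<dots> \<le> L2_set (\<lambda>i. cmod ((D *\<^sub>v x) $ i)) ?I + L2_set (\<lambda>i. cmod ((E *\<^sub>v x) $ i)) ?I"
    by (rule L2_set_triangle_ineq)
  also have "L2_set (\<lambda>i. cmod ((E *\<^sub>v x) $ i)) ?I \<le> e * vnorm x"
  proof -
    have "L2_set (\<lambda>i. cmod ((E *\<^sub>v x) $ i)) ?I \<le> L2_set (\<lambda>i. cmod ((E *\<^sub>v x) $ i)) {..<d1}"
      unfolding L2_set_def by (intro real_sqrt_le_mono sum_mono2) auto
    also have "\<dots> = vnorm (E *\<^sub>v x)" using E by (simp add: vnorm_def)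
    also have "\<dots> \<le> e * vnorm x" by (rule Ex[OF x])
    finally show ?thesis .
  qed
  also have "L2_set (\<lambda>i. cmod ((D *\<^sub>v x) $ i)) ?I \<le> e * vnorm x"
  proof -
    have "(\<Sum>i\<in>?I. (cmod ((D *\<^sub>v x) $ i))\<^sup>2) \<le> (\<Sum>i\<in>?I. if i < d2 then e\<^sup>2 * (cmod (x $ i))\<^sup>2 else 0)"
    proof (rule sum_mono)
      fix i assume i: "i \<in> ?I"
      then show "(cmod ((D *\<^sub>v x) $ i))\<^sup>2 \<le> (if i < d2 then e\<^sup>2 * (cmod (x $ i))\<^sup>2 else 0)"
        using Dxi[of i] small[of i]
        by (auto simp: norm_mult power_mult_distrib simp del: index_mult_mat_vec
            intro!: mult_right_mono power_mono)
    qed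
    also have "\<dots> = (\<Sum>i\<in>?I \<inter> {i. i < d2}. e\<^sup>2 * (cmod (x $ i))\<^sup>2)" by (simp add: sum.If_cases)
    also have "\<dots> \<le> (\<Sum>i<d2. e\<^sup>2 * (cmod (x $ i))\<^sup>2)" by (rule sum_mono2) auto
    also have "\<dots> = (e * vnorm x)\<^sup>2"
      by (simp only: power_mult_distrib vnorm_sq[OF x] sum_distrib_left)
    finally have "sqrt (\<Sum>i\<in>?I. (cmod ((D *\<^sub>v x) $ i))\<^sup>2) \<le> sqrt ((e * vnorm x)\<^sup>2)"
      by (rule real_sqrt_le_mono)
    then show ?thesis using e by (simp add: L2_set_def del: index_mult_mat_vec)
  qed
  finally have "L2_set (\<lambda>i. cmod (((D - E) *\<^sub>v x) $ i)) ?I \<le> 2 * e * vnorm x" by simp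
  then have "(L2_set (\<lambda>i. cmod (((D - E) *\<^sub>v x) $ i)) ?I)\<^sup>2 \<le> (2 * e * vnorm x)\<^sup>2"
    by (intro power_mono) auto
  then show ?thesis by (simp add: L2_set_def sum_nonneg power_mult_distrib del: index_mult_mat_vec)
qed

section \<open>The harmonic mean weight in singular coordinates\<close>

definition frob_inner :: "complex mat \<Rightarrow> complex mat \<Rightarrow> complex" where
  "frob_inner A B = (\<Sum>i<dim_row A. \<Sum>j<dim_col A. cnj (A $$ (i, j)) * B $$ (i, j))"

lemma frob_inner_mult_left:
  fixes A X C :: "complex mat"
  assumes A: "A \<in> carrier_mat n m" and X: "X \<in> carrier_mat n l" and C: "C \<in> carrier_mat m l"
  shows "frob_inner X (A * C) = frob_inner (mat_adjoint A * X) C"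
proof -
  note aA = mat_adjoint_carrier[OF A]
  have "frob_inner X (A * C) = (\<Sum>i<n. \<Sum>j<l. cnj (X $$ (i, j)) * (\<Sum>k<m. A $$ (i, k) * C $$ (k, j)))"
    unfolding frob_inner_def using X index_mult_mat_sum[OF A C] by (simp del: index_mult_mat(1))
  also have "\<dots> = (\<Sum>i<n. \<Sum>k<m. \<Sum>j<l. cnj (X $$ (i, j)) * (A $$ (i, k) * C $$ (k, j)))"
    unfolding sum_distrib_left by (intro sum.cong refl sum.swap)
  also have "\<dots> = (\<Sum>k<m. \<Sum>i<n. \<Sum>j<l. cnj (X $$ (i, j)) * (A $$ (i, k) * C $$ (k, j)))"
    by (rule sum.swap)
  also have "\<dots> = (\<Sum>k<m. \<Sum>j<l. \<Sum>i<n. cnj (X $$ (i, j)) * (A $$ (i, k) * C $$ (k, j)))"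
    by (intro sum.cong refl sum.swap)
  also have "\<dots> = (\<Sum>k<m. \<Sum>j<l. cnj (\<Sum>i<n. mat_adjoint A $$ (k, i) * X $$ (i, j)) * C $$ (k, j))"
    using A by (intro sum.cong refl) (simp add: sum_distrib_left sum_distrib_right mult_ac)
  also have "\<dots> = frob_inner (mat_adjoint A * X) C"
    unfolding frob_inner_def using A X index_mult_mat_sum[OF aA X]
    by (simp del: index_mult_mat(1))
  finally show ?thesis .
qed

lemma frob_inner_mult_right:
  fixes V X C :: "complex mat"
  assumes V: "V \<in> carrier_mat l m" and X: "X \<in> carrier_mat n l" and C: "C \<in> carrier_mat n m"
  shows "frob_inner X (C * mat_adjoint V) = frob_inner (X * V) C"
proof -
  note aV = mat_adjoint_carrier[OF V]
  have "frob_inner X (C * mat_adjoint V)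
      = (\<Sum>i<n. \<Sum>j<l. cnj (X $$ (i, j)) * (\<Sum>k<m. C $$ (i, k) * mat_adjoint V $$ (k, j)))"
    unfolding frob_inner_def using X index_mult_mat_sum[OF C aV] by (simp del: index_mult_mat(1))
  also have "\<dots> = (\<Sum>i<n. \<Sum>k<m. \<Sum>j<l. cnj (X $$ (i, j)) * (C $$ (i, k) * mat_adjoint V $$ (k, j)))"
    unfolding sum_distrib_left by (intro sum.cong refl sum.swap)
  also have "\<dots> = (\<Sum>i<n. \<Sum>k<m. cnj (\<Sum>j<l. X $$ (i, j) * V $$ (j, k)) * C $$ (i, k))"
    using V by (intro sum.cong refl) (simp add: sum_distrib_left sum_distrib_right mult_ac)
  also have "\<dots> = frob_inner (X * V) C"
    unfolding frob_inner_def using V X index_mult_mat_sum[OF X V]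
    by (simp del: index_mult_mat(1))
  finally show ?thesis .
qed

lemma mat_vec_carrier: "X \<in> carrier_mat d1 d2 \<Longrightarrow> mat_vec X \<in> carrier_vec (d1 * d2)"
  by (auto simp: mat_vec_def)

lemma index_pair_less: "(l :: nat) < a \<Longrightarrow> q < b \<Longrightarrow> l + q * a < a * b"
proof -
  assume "l < a" "q < b"
  then have "l + q * a < Suc q * a" by simp
  also have "\<dots> \<le> b * a" using \<open>q < b\<close> by (intro mult_le_mono1) simp
  finally show ?thesis by (simp add: mult.commute)
qed

lemma mod_div_less:
  assumes "(k :: nat) < a * b"
  shows "k mod a < a" "k div a < b"
proof -
  show "k mod a < a" using assms by (cases a) auto
  show "k div a < b" using assms by (simp add: less_mult_imp_div_less mult.commute)
qed

lemma scalar_prod_mat_vec: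
  assumes X: "X \<in> carrier_mat d1 d2" and B: "B \<in> carrier_mat d1 d2"
  shows "conjugate (mat_vec X) \<bullet> mat_vec B = frob_inner X B"
proof (cases "d1 = 0")
  case True
  then show ?thesis using X B by (simp add: frob_inner_def mat_vec_def scalar_prod_def)
next
  case False
  have "conjugate (mat_vec X) \<bullet> mat_vec B
      = (\<Sum>k<d1 * d2. cnj (X $$ (k mod d1, k div d1)) * B $$ (k mod d1, k div d1))"
    unfolding scalar_prod_sum[OF mat_vec_carrier[OF B]]
    using X B by (intro sum.cong) (auto simp: mat_vec_def)
  also have "\<dots> = (\<Sum>(i, j)\<in>{..<d1} \<times> {..<d2}. cnj (X $$ (i, j)) * B $$ (i, j))"
    by (rule sum.reindex_bij_witness[where i = "\<lambda>(i, j). i + j * d1" and j = "\<lambda>k. (k mod d1, k div d1)"])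
      (use False index_pair_less[of _ d1 _ d2] mod_div_less[of _ d1 d2] in auto)
  also have "\<dots> = frob_inner X B"
    using X by (simp add: frob_inner_def sum.cartesian_product)
  finally show ?thesis .
qed

lemma mat_vec_add:
  assumes "X \<in> carrier_mat d1 d2" "B \<in> carrier_mat d1 d2"
  shows "mat_vec X + mat_vec B = mat_vec (X + B)"
proof (rule eq_vecI)
  fix k assume "k < dim_vec (mat_vec (X + B))"
  then have k: "k < d1 * d2" using assms by (simp add: mat_vec_def)
  show "(mat_vec X + mat_vec B) $ k = mat_vec (X + B) $ k"
    using assms k mod_div_less[OF k] by (simp add: mat_vec_def)
qed (use assms in \<open>simp add: mat_vec_def\<close>)

lemma mat_vec_zero: "mat_vec (0\<^sub>m d1 d2) = 0\<^sub>v (d1 * d2)"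
proof (rule eq_vecI)
  fix k assume "k < dim_vec (0\<^sub>v (d1 * d2) :: complex vec)"
  then have k: "k < d1 * d2" by simp
  show "mat_vec (0\<^sub>m d1 d2) $ k = 0\<^sub>v (d1 * d2) $ k"
    using k mod_div_less[OF k] by (simp add: mat_vec_def)
qed (simp add: mat_vec_def)

lemma mat_vec_inj_zero:
  assumes X: "X \<in> carrier_mat d1 d2" and z: "mat_vec X = 0\<^sub>v (d1 * d2)"
  shows "X = 0\<^sub>m d1 d2"
proof (rule eq_matI)
  fix i j assume "i < dim_row (0\<^sub>m d1 d2 :: complex mat)" "j < dim_col (0\<^sub>m d1 d2 :: complex mat)"
  then have ij: "i < d1" "j < d2" by auto
  have k: "i + j * d1 < d1 * d2" by (rule index_pair_less[OF ij])
  have "mat_vec X $ (i + j * d1) = X $$ (i, j)" using X k ij by (simp add: mat_vec_def)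
  then show "X $$ (i, j) = 0\<^sub>m d1 d2 $$ (i, j)" using z k ij by simp
qed (use X in auto)

lemma mat_vec_surj:
  assumes v: "v \<in> carrier_vec (d1 * d2)"
  shows "\<exists>X\<in>carrier_mat d1 d2. mat_vec X = v"
proof (intro bexI[of _ "mat d1 d2 (\<lambda>(i, j). v $ (i + j * d1))"] eq_vecI)
  fix k assume "k < dim_vec v"
  then have k: "k < d1 * d2" using v by simp
  show "mat_vec (mat d1 d2 (\<lambda>(i, j). v $ (i + j * d1))) $ k = v $ k"
    using k mod_div_less[OF k] by (simp add: mat_vec_def)
qed (use v in \<open>auto simp: mat_vec_def\<close>)

lemma unitary_conj_cancel:
  assumes U: "unitary_mat d1 U" and V: "unitary_mat d2 V" and Z: "Z \<in> carrier_mat d1 d2"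
  shows "mat_adjoint U * (U * Z * mat_adjoint V) * V = Z"
    and "U * (mat_adjoint U * Z * V) * mat_adjoint V = Z"
proof -
  have main: "mat_adjoint P * (P * Z * mat_adjoint Q) * Q = Z"
    if P: "unitary_mat d1 P" and Q: "unitary_mat d2 Q" for P Q
  proof -
    note p = unitary_matD[OF P] and q = unitary_matD[OF Q]
    have PZ: "P * Z \<in> carrier_mat d1 d2" by (rule mult_carrier_mat[OF p(1) Z])
    have "mat_adjoint P * (P * Z * mat_adjoint Q) = (mat_adjoint P * (P * Z)) * mat_adjoint Q"
      by (rule assoc_mult_mat[OF p(2) PZ q(2), symmetric])
    also have "mat_adjoint P * (P * Z) = Z"
      using assoc_mult_mat[OF p(2,1) Z] left_mult_one_mat[OF Z] by (simp only: p(3))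
    finally have "mat_adjoint P * (P * Z * mat_adjoint Q) * Q = Z * mat_adjoint Q * Q" by simp
    also have "\<dots> = Z"
      using assoc_mult_mat[OF Z q(2,1)] right_mult_one_mat[OF Z] by (simp only: q(3))
    finally show ?thesis .
  qed
  show "mat_adjoint U * (U * Z * mat_adjoint V) * V = Z" by (rule main[OF U V])
  show "U * (mat_adjoint U * Z * V) * mat_adjoint V = Z"
    using main[OF unitary_mat_adjoint[OF U] unitary_mat_adjoint[OF V]] by simp
qed

text \<open>On vectorised matrices the Kronecker sum acts as \<open>Z \<mapsto> A Z + Z B\<^sup>*\<close>, and \<open>A\<close> and \<open>B\<close> are diagonal in the
  bases \<open>U\<close> and \<open>V\<close>.\<close>

lemma kron_sum_mult_mat_vec:
  fixes f g :: "nat \<Rightarrow> real" and U V B :: "complex mat"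
  assumes U: "unitary_mat d1 U" and V: "unitary_mat d2 V" and B: "B \<in> carrier_mat d1 d2"
  defines "K \<equiv> kron_sum (U * mat_diag d1 (\<lambda>i. complex_of_real (f i)) * mat_adjoint U)
      (V * mat_diag d2 (\<lambda>i. complex_of_real (g i)) * mat_adjoint V)"
  shows "K *\<^sub>v mat_vec (U * B * mat_adjoint V)
    = mat_vec (U * mat d1 d2 (\<lambda>(i, j). complex_of_real (f i + g j) * B $$ (i, j)) * mat_adjoint V)"
    and "K \<in> carrier_mat (d1 * d2) (d1 * d2)"
proof -
  note u = unitary_matD[OF U] and v = unitary_matD[OF V]
  define DL where "DL = mat_diag d1 (\<lambda>i. complex_of_real (f i))"
  define DR where "DR = mat_diag d2 (\<lambda>i. complex_of_real (g i))"
  have DL: "DL \<in> carrier_mat d1 d1" and DR: "DR \<in> carrier_mat d2 d2" by (simp_all add: DL_def DR_def)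
  define HL where "HL = U * DL * mat_adjoint U"
  define HR where "HR = V * DR * mat_adjoint V"
  have HL: "HL \<in> carrier_mat d1 d1"
    unfolding HL_def by (rule mult_carrier_mat[OF mult_carrier_mat[OF u(1) DL] u(2)])
  have HR: "HR \<in> carrier_mat d2 d2"
    unfolding HR_def by (rule mult_carrier_mat[OF mult_carrier_mat[OF v(1) DR] v(2)])
  have K: "K = kron (1\<^sub>m d2) HL + kron HR (1\<^sub>m d1)"
    unfolding K_def kron_sum_def HL_def[symmetric] HR_def[symmetric] DL_def[symmetric] DR_def[symmetric]
    using HL HR by simp
  have k1: "kron (1\<^sub>m d2) HL \<in> carrier_mat (d1 * d2) (d1 * d2)"
    using HL by (auto simp: kron_def)
  have k2: "kron HR (1\<^sub>m d1) \<in> carrier_mat (d1 * d2) (d1 * d2)"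
    using HR by (auto simp: kron_def)
  show "K \<in> carrier_mat (d1 * d2) (d1 * d2)" unfolding K using k1 k2 by simp
  define Z where "Z = U * B * mat_adjoint V"
  have UB: "U * B \<in> carrier_mat d1 d2" by (rule mult_carrier_mat[OF u(1) B])
  have BV: "B * mat_adjoint V \<in> carrier_mat d1 d2" by (rule mult_carrier_mat[OF B v(2)])
  have Z: "Z \<in> carrier_mat d1 d2" unfolding Z_def by (rule mult_carrier_mat[OF UB v(2)])
  have adjDR: "mat_adjoint DR = DR" by (rule eq_matI) (auto simp: DR_def mat_diag_def)
  have adjHR: "mat_adjoint HR = HR"
    unfolding HR_def mat_adjoint_mult[OF mult_carrier_mat[OF v(1) DR] v(2)] mat_adjoint_mult[OF v(1) DR]
      mat_adjoint_adjoint adjDR by (rule assoc_mult_mat[OF v(1) DR v(2), symmetric])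
  have "K *\<^sub>v mat_vec Z = kron (1\<^sub>m d2) HL *\<^sub>v mat_vec Z + kron HR (1\<^sub>m d1) *\<^sub>v mat_vec Z"
    unfolding K by (rule add_mult_distrib_mat_vec[OF k1 k2 mat_vec_carrier[OF Z]])
  also have "kron (1\<^sub>m d2) HL *\<^sub>v mat_vec Z = mat_vec (HL * Z)"
    using kron_mult_mat_vec[OF HL one_carrier_mat Z]
    by (simp only: mat_adjoint_one right_mult_one_mat[OF mult_carrier_mat[OF HL Z]])
  also have "kron HR (1\<^sub>m d1) *\<^sub>v mat_vec Z = mat_vec (Z * HR)"
    using kron_mult_mat_vec[OF one_carrier_mat HR Z] Z adjHR by simp
  also have "mat_vec (HL * Z) + mat_vec (Z * HR) = mat_vec (HL * Z + Z * HR)"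
    by (rule mat_vec_add[OF mult_carrier_mat[OF HL Z] mult_carrier_mat[OF Z HR]])
  also have "HL * Z = U * (DL * B) * mat_adjoint V"
  proof -
    have "mat_adjoint U * Z = B * mat_adjoint V"
      unfolding Z_def assoc_mult_mat[OF u(1) B v(2)]
      using assoc_mult_mat[OF u(2,1) BV] left_mult_one_mat[OF BV] by (simp only: u(3))
    then have "HL * Z = U * DL * (B * mat_adjoint V)"
      unfolding HL_def using assoc_mult_mat[OF mult_carrier_mat[OF u(1) DL] u(2) Z] by simp
    also have "\<dots> = U * DL * B * mat_adjoint V"
      by (rule assoc_mult_mat[OF mult_carrier_mat[OF u(1) DL] B v(2), symmetric])
    also have "U * DL * B = U * (DL * B)" by (rule assoc_mult_mat[OF u(1) DL B])
    finally show ?thesis .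
  qed
  also have "Z * HR = U * (B * DR) * mat_adjoint V"
  proof -
    have ZV: "Z * V = U * B"
      unfolding Z_def using assoc_mult_mat[OF UB v(2,1)] right_mult_one_mat[OF UB] by (simp only: v(3))
    have "Z * HR = Z * (V * DR) * mat_adjoint V"
      unfolding HR_def by (rule assoc_mult_mat[OF Z mult_carrier_mat[OF v(1) DR] v(2), symmetric])
    also have "Z * (V * DR) = Z * V * DR" by (rule assoc_mult_mat[OF Z v(1) DR, symmetric])
    also have "\<dots> = U * (B * DR)" unfolding ZV by (rule assoc_mult_mat[OF u(1) B DR])
    finally show ?thesis .
  qed
  also have "U * (DL * B) * mat_adjoint V + U * (B * DR) * mat_adjoint V
      = U * (DL * B + B * DR) * mat_adjoint V"
    using add_mult_distrib_mat[OF mult_carrier_mat[OF u(1) mult_carrier_mat[OF DL B]]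
        mult_carrier_mat[OF u(1) mult_carrier_mat[OF B DR]] v(2)]
      mult_add_distrib_mat[OF u(1) mult_carrier_mat[OF DL B] mult_carrier_mat[OF B DR]] by simp
  also have "DL * B + B * DR = mat d1 d2 (\<lambda>(i, j). complex_of_real (f i + g j) * B $$ (i, j))"
  proof (rule eq_matI)
    fix i j assume "i < dim_row (mat d1 d2 (\<lambda>(i, j). complex_of_real (f i + g j) * B $$ (i, j)))"
      "j < dim_col (mat d1 d2 (\<lambda>(i, j). complex_of_real (f i + g j) * B $$ (i, j)))"
    then have ij: "i < d1" "j < d2" by auto
    have "(DL * B) $$ (i, j) = (\<Sum>k<d1. if k = i then complex_of_real (f i) * B $$ (i, j) else 0)"
      unfolding index_mult_mat_sum[OF DL B ij]
      by (rule sum.cong) (use ij in \<open>auto simp: DL_def mat_diag_def\<close>)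
    moreover have "(B * DR) $$ (i, j) = (\<Sum>k<d2. if k = j then complex_of_real (g j) * B $$ (i, j) else 0)"
      unfolding index_mult_mat_sum[OF B DR ij]
      by (rule sum.cong) (use ij in \<open>auto simp: DR_def mat_diag_def\<close>)
    ultimately show "(DL * B + B * DR) $$ (i, j)
        = mat d1 d2 (\<lambda>(i, j). complex_of_real (f i + g j) * B $$ (i, j)) $$ (i, j)"
      using ij DL DR B by (simp add: distrib_right del: index_mult_mat(1))
  qed (use DL DR B in auto)
  finally show "K *\<^sub>v mat_vec (U * B * mat_adjoint V)
    = mat_vec (U * mat d1 d2 (\<lambda>(i, j). complex_of_real (f i + g j) * B $$ (i, j)) * mat_adjoint V)"
    unfolding Z_def .
qed

text \<open>An injective square matrix has nonzero determinant, so elimination does return an inverse.\<close>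

lemma mat_inverse_exists:
  fixes K :: "complex mat"
  assumes K: "K \<in> carrier_mat n n"
    and inj: "\<And>v. v \<in> carrier_vec n \<Longrightarrow> K *\<^sub>v v = 0\<^sub>v n \<Longrightarrow> v = 0\<^sub>v n"
  shows "the (mat_inverse K) * K = 1\<^sub>m n" "the (mat_inverse K) \<in> carrier_mat n n"
proof -
  have "det K \<noteq> 0" using det_0_iff_vec_prod_zero_field[OF K] inj by blast
  then have "K \<in> Units (ring_mat TYPE(complex) n ())" by (rule det_non_zero_imp_unit[OF K])
  then have "mat_inverse K \<noteq> None" using mat_inverse(1)[OF K, of "()"] by blast
  then obtain L where "mat_inverse K = Some L" by blast
  then show "the (mat_inverse K) * K = 1\<^sub>m n" "the (mat_inverse K) \<in> carrier_mat n n"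
    using mat_inverse(2)[OF K] by auto
qed

lemma smult_mat_mult_vec:
  fixes L :: "complex mat"
  assumes L: "L \<in> carrier_mat n m" and x: "x \<in> carrier_vec m"
  shows "(c \<cdot>\<^sub>m L) *\<^sub>v x = c \<cdot>\<^sub>v (L *\<^sub>v x)"
proof (rule eq_vecI)
  fix i assume "i < dim_vec (c \<cdot>\<^sub>v (L *\<^sub>v x))"
  then have i: "i < n" using L by simp
  have "((c \<cdot>\<^sub>m L) *\<^sub>v x) $ i = (\<Sum>k<m. (c \<cdot>\<^sub>m L) $$ (i, k) * x $ k)"
    by (rule index_mult_mat_vec_sum[OF _ x i]) (use L in simp)
  also have "\<dots> = c * (\<Sum>k<m. L $$ (i, k) * x $ k)"
    unfolding sum_distrib_left by (rule sum.cong) (use L i in \<open>auto simp: mult.assoc\<close>)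
  also have "\<dots> = (c \<cdot>\<^sub>v (L *\<^sub>v x)) $ i"
    using index_mult_mat_vec_sum[OF L x i] i L by (simp del: index_mult_mat_vec)
  finally show "((c \<cdot>\<^sub>m L) *\<^sub>v x) $ i = (c \<cdot>\<^sub>v (L *\<^sub>v x)) $ i" .
qed (use L in simp)

text \<open>Invertibility of the Kronecker sum follows from its diagonal form, because every \<open>f i + g j\<close>
  is nonzero. The inverse then divides coordinates by \<open>f i + g j\<close>, and unitary changes of
  coordinates preserve the Frobenius inner product.\<close>

lemma weighted_norm_kron_sum:
  fixes f g :: "nat \<Rightarrow> real"
  assumes U: "unitary_mat d1 U" and V: "unitary_mat d2 V" and Z: "Z \<in> carrier_mat d1 d2"
    and pos: "\<And>i j. i < d1 \<Longrightarrow> j < d2 \<Longrightarrow> 0 < f i + g j"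
  shows "(weighted_norm (2 \<cdot>\<^sub>m the (mat_inverse (kron_sum
        (U * mat_diag d1 (\<lambda>i. complex_of_real (f i)) * mat_adjoint U)
        (V * mat_diag d2 (\<lambda>i. complex_of_real (g i)) * mat_adjoint V)))) (mat_vec Z))\<^sup>2
    = (\<Sum>i<d1. \<Sum>j<d2. 2 / (f i + g j) * (cmod ((mat_adjoint U * Z * V) $$ (i, j)))\<^sup>2)"
proof -
  note u = unitary_matD[OF U] and v = unitary_matD[OF V]
  define K where "K = kron_sum (U * mat_diag d1 (\<lambda>i. complex_of_real (f i)) * mat_adjoint U)
      (V * mat_diag d2 (\<lambda>i. complex_of_real (g i)) * mat_adjoint V)"
  let ?n = "d1 * d2"
  note Kvec = kron_sum_mult_mat_vec(1)[OF U V, of _ f g, folded K_def]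
  have K: "K \<in> carrier_mat ?n ?n"
    using kron_sum_mult_mat_vec(2)[OF U V zero_carrier_mat] by (simp add: K_def)
  have conjc: "U * B * mat_adjoint V \<in> carrier_mat d1 d2" if "B \<in> carrier_mat d1 d2" for B
    by (rule mult_carrier_mat[OF mult_carrier_mat[OF u(1) that] v(2)])
  have inj: "x = 0\<^sub>v ?n" if x: "x \<in> carrier_vec ?n" and Kx: "K *\<^sub>v x = 0\<^sub>v ?n" for x
  proof -
    obtain A where A: "A \<in> carrier_mat d1 d2" "mat_vec A = x" using mat_vec_surj[OF x] by blast
    define B where "B = mat_adjoint U * A * V"
    have B: "B \<in> carrier_mat d1 d2"
      unfolding B_def by (rule mult_carrier_mat[OF mult_carrier_mat[OF u(2) A(1)] v(1)])
    have AB: "A = U * B * mat_adjoint V" unfolding B_def by (rule unitary_conj_cancel(2)[OF U V A(1), symmetric])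
    define C where "C = mat d1 d2 (\<lambda>(i, j). complex_of_real (f i + g j) * B $$ (i, j))"
    have C: "C \<in> carrier_mat d1 d2" by (simp add: C_def)
    have "mat_vec (U * C * mat_adjoint V) = 0\<^sub>v ?n" using Kvec[OF B] Kx A(2) AB C_def by simp
    then have "U * C * mat_adjoint V = 0\<^sub>m d1 d2" by (rule mat_vec_inj_zero[OF conjc[OF C]])
    then have "C = mat_adjoint U * 0\<^sub>m d1 d2 * V" using unitary_conj_cancel(1)[OF U V C] by simp
    then have C0: "C = 0\<^sub>m d1 d2"
      by (simp only: right_mult_zero_mat[OF u(2)] left_mult_zero_mat[OF v(1)])
    have "B = 0\<^sub>m d1 d2"
    proof (rule eq_matI)
      fix i j assume "i < dim_row (0\<^sub>m d1 d2 :: complex mat)" "j < dim_col (0\<^sub>m d1 d2 :: complex mat)"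
      then have ij: "i < d1" "j < d2" by auto
      have "complex_of_real (f i + g j) * B $$ (i, j) = 0"
        using arg_cong[OF C0, of "\<lambda>X. X $$ (i, j)"] ij by (simp add: C_def)
      then show "B $$ (i, j) = 0\<^sub>m d1 d2 $$ (i, j)" using pos[OF ij] ij
        by (simp del: of_real_add)
    qed (use B in auto)
    then have "A = 0\<^sub>m d1 d2"
      using AB by (simp only: right_mult_zero_mat[OF u(1)] left_mult_zero_mat[OF v(2)])
    then show ?thesis using A(2) mat_vec_zero by simp
  qed
  note inv = mat_inverse_exists[OF K inj]
  define L where "L = the (mat_inverse K)"
  have L: "L * K = 1\<^sub>m ?n" "L \<in> carrier_mat ?n ?n" using inv by (simp_all add: L_def)
  define Y where "Y = mat_adjoint U * Z * V"
  have Y: "Y \<in> carrier_mat d1 d2"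
    unfolding Y_def by (rule mult_carrier_mat[OF mult_carrier_mat[OF u(2) Z] v(1)])
  have ZY: "Z = U * Y * mat_adjoint V" unfolding Y_def by (rule unitary_conj_cancel(2)[OF U V Z, symmetric])
  define B where "B = mat d1 d2 (\<lambda>(i, j). Y $$ (i, j) / complex_of_real (f i + g j))"
  have B: "B \<in> carrier_mat d1 d2" by (simp add: B_def)
  have "mat d1 d2 (\<lambda>(i, j). complex_of_real (f i + g j) * B $$ (i, j)) = Y"
  proof (rule eq_matI)
    fix i j assume "i < dim_row Y" "j < dim_col Y"
    then have ij: "i < d1" "j < d2" using Y by auto
    have "complex_of_real (f i + g j) \<noteq> 0" using pos[OF ij] by (simp del: of_real_add)
    then show "mat d1 d2 (\<lambda>(i, j). complex_of_real (f i + g j) * B $$ (i, j)) $$ (i, j) = Y $$ (i, j)"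
      using ij by (simp add: B_def del: of_real_add)
  qed (use Y in auto)
  then have KB: "K *\<^sub>v mat_vec (U * B * mat_adjoint V) = mat_vec Z" using Kvec[OF B] ZY by simp
  have "L *\<^sub>v mat_vec Z = mat_vec (U * B * mat_adjoint V)"
    unfolding KB[symmetric]
    using assoc_mult_mat_vec[OF L(2) K mat_vec_carrier[OF conjc[OF B]]]
      mat_vec_carrier[OF conjc[OF B]] by (simp add: L(1))
  then have "(2 \<cdot>\<^sub>m L) *\<^sub>v mat_vec Z = 2 \<cdot>\<^sub>v mat_vec (U * B * mat_adjoint V)"
    using smult_mat_mult_vec[OF L(2) mat_vec_carrier[OF Z]] by simp
  then have "conjugate (mat_vec Z) \<bullet> ((2 \<cdot>\<^sub>m L) *\<^sub>v mat_vec Z)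
      = 2 * frob_inner Z (U * B * mat_adjoint V)"
    using scalar_prod_mat_vec[OF Z conjc[OF B]] mat_vec_carrier[OF Z] mat_vec_carrier[OF conjc[OF B]]
    by simp
  also have "frob_inner Z (U * B * mat_adjoint V) = frob_inner (Z * V) (U * B)"
    by (rule frob_inner_mult_right[OF v(1) Z mult_carrier_mat[OF u(1) B]])
  also have "\<dots> = frob_inner (mat_adjoint U * (Z * V)) B"
    by (rule frob_inner_mult_left[OF u(1) mult_carrier_mat[OF Z v(1)] B])
  also have "mat_adjoint U * (Z * V) = Y"
    unfolding Y_def by (rule assoc_mult_mat[OF u(2) Z v(1), symmetric])
  also have "2 * frob_inner Y B
      = complex_of_real (\<Sum>i<d1. \<Sum>j<d2. 2 / (f i + g j) * (cmod (Y $$ (i, j)))\<^sup>2)"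
  proof -
    have "2 * (cnj (Y $$ (i, j)) * B $$ (i, j))
        = complex_of_real (2 / (f i + g j) * (cmod (Y $$ (i, j)))\<^sup>2)" if "i < d1" "j < d2" for i j
    proof -
      have "2 * (cnj (Y $$ (i, j)) * B $$ (i, j))
          = 2 / complex_of_real (f i + g j) * (Y $$ (i, j) * cnj (Y $$ (i, j)))"
        using that by (simp add: B_def mult_ac del: of_real_add)
      also have "\<dots> = complex_of_real (2 / (f i + g j) * (cmod (Y $$ (i, j)))\<^sup>2)"
        by (simp only: of_real_mult complex_norm_square of_real_divide of_real_numeral)
      finally show ?thesis .
    qed
    then show ?thesis
      using Y by (simp add: frob_inner_def sum_distrib_left del: of_real_mult of_real_divide)
  qed
  finally have "conjugate (mat_vec Z) \<bullet> ((2 \<cdot>\<^sub>m L) *\<^sub>v mat_vec Z)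
      = complex_of_real (\<Sum>i<d1. \<Sum>j<d2. 2 / (f i + g j) * (cmod (Y $$ (i, j)))\<^sup>2)" .
  moreover have "0 \<le> (\<Sum>i<d1. \<Sum>j<d2. 2 / (f i + g j) * (cmod (Y $$ (i, j)))\<^sup>2)"
    using pos by (intro sum_nonneg mult_nonneg_nonneg) (auto intro: less_imp_le)
  ultimately show ?thesis
    unfolding weighted_norm_def K_def[symmetric] L_def[symmetric] Y_def[symmetric]
    by (simp only: Re_complex_of_real real_sqrt_pow2)
qed


text \<open>The diagonal entries of the smoothed diagonal matrices. They do not depend on the size, so one
  function serves both sides.\<close>

definition smoothed_power :: "complex mat \<Rightarrow> real \<Rightarrow> real \<Rightarrow> nat \<Rightarrow> real" where
  "smoothed_power X \<epsilon> p i = (if i < min (dim_row X) (dim_col X)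
     then sqrt ((singular_value X (i + 1))\<^sup>2 + \<epsilon>\<^sup>2) else 0) powr (2 - p)"

lemma smoothed_power_nonneg [simp]: "0 \<le> smoothed_power X \<epsilon> p i"
  by (simp add: smoothed_power_def)

lemma smoothed_power_pos:
  assumes "\<epsilon> \<noteq> 0" "i < min (dim_row X) (dim_col X)"
  shows "0 < smoothed_power X \<epsilon> p i"
proof -
  have "0 < (singular_value X (i + 1))\<^sup>2 + \<epsilon>\<^sup>2" using assms(1) by (simp add: add_nonneg_pos)
  then have "sqrt ((singular_value X (i + 1))\<^sup>2 + \<epsilon>\<^sup>2) \<noteq> 0" by (simp only: real_sqrt_eq_0_iff)
  then have "0 < sqrt ((singular_value X (i + 1))\<^sup>2 + \<epsilon>\<^sup>2) powr (2 - p)" by (simp only: powr_gt_zero not_False_eq_True)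
  then show ?thesis using assms(2) by (simp only: smoothed_power_def if_True)
qed

text \<open>One of the two summands may vanish for non-square matrices, but not both: the smaller dimension
  has only positive smoothed values.\<close>

lemma smoothed_power_sum_pos:
  assumes "\<epsilon> \<noteq> 0" "i < dim_row X" "j < dim_col X"
  shows "0 < smoothed_power X \<epsilon> p i + smoothed_power X \<epsilon> p j"
proof (cases "dim_row X \<le> dim_col X")
  case True
  then show ?thesis using assms by (intro add_pos_nonneg smoothed_power_pos) auto
next
  case False
  then show ?thesis using assms by (intro add_nonneg_pos smoothed_power_pos) auto
qed

lemma weighted_norm_hm_weight:
  assumes X: "X \<in> carrier_mat d1 d2" and U: "unitary_mat d1 U" and V: "unitary_mat d2 V"
    and \<epsilon>: "\<epsilon> \<noteq> 0" and Z: "Z \<in> carrier_mat d1 d2"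
  shows "(weighted_norm (hm_weight X U V \<epsilon> p) (mat_vec Z))\<^sup>2
    = (\<Sum>(i, j)\<in>{..<d1} \<times> {..<d2}. 2 / (smoothed_power X \<epsilon> p i + smoothed_power X \<epsilon> p j)
         * (cmod ((mat_adjoint U * Z * V) $$ (i, j)))\<^sup>2)"
proof -
  have diag: "smoothed_diag_power X \<epsilon> p t = mat_diag t (\<lambda>i. complex_of_real (smoothed_power X \<epsilon> p i))" for t
    by (simp only: smoothed_diag_power_def smoothed_power_def)
  have "hm_weight X U V \<epsilon> p = 2 \<cdot>\<^sub>m the (mat_inverse (kron_sum
        (U * mat_diag d1 (\<lambda>i. complex_of_real (smoothed_power X \<epsilon> p i)) * mat_adjoint U)
        (V * mat_diag d2 (\<lambda>i. complex_of_real (smoothed_power X \<epsilon> p i)) * mat_adjoint V)))"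
    using X by (simp add: hm_weight_def diag)
  then show ?thesis
    using weighted_norm_kron_sum[OF U V Z, of "smoothed_power X \<epsilon> p" "smoothed_power X \<epsilon> p"]
      smoothed_power_sum_pos[OF \<epsilon>] X by (simp add: sum.cartesian_product)
qed

lemma cmod_add_scaled_sq:
  "(cmod (a + complex_of_real t * b))\<^sup>2 = (cmod a)\<^sup>2 + 2 * t * Re (cnj b * a) + t\<^sup>2 * (cmod b)\<^sup>2"
  by (simp add: cmod_power2[unfolded power2_eq_square] power2_eq_square algebra_simps)

text \<open>The quadratic function of \<open>t\<close> has a minimum at \<open>t = 0\<close>, so its linear coefficient vanishes.\<close>

lemma minimizer_orthogonal:
  fixes a b :: "'i \<Rightarrow> complex" and w :: "'i \<Rightarrow> real"
  assumes w: "\<And>i. i \<in> I \<Longrightarrow> 0 \<le> w i"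
    and min: "\<And>t :: real. (\<Sum>i\<in>I. w i * (cmod (a i))\<^sup>2)
        \<le> (\<Sum>i\<in>I. w i * (cmod (a i + complex_of_real t * b i))\<^sup>2)"
  shows "(\<Sum>i\<in>I. w i * Re (cnj (b i) * a i)) = 0"
proof -
  define \<beta> where "\<beta> = (\<Sum>i\<in>I. w i * Re (cnj (b i) * a i))"
  define \<alpha> where "\<alpha> = (\<Sum>i\<in>I. w i * (cmod (b i))\<^sup>2)"
  have \<alpha>: "0 \<le> \<alpha>" unfolding \<alpha>_def using w by (intro sum_nonneg mult_nonneg_nonneg) auto
  have quad: "0 \<le> 2 * t * \<beta> + t\<^sup>2 * \<alpha>" for t
  proof -
    have "(\<Sum>i\<in>I. w i * (cmod (a i + complex_of_real t * b i))\<^sup>2)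
        = (\<Sum>i\<in>I. w i * (cmod (a i))\<^sup>2) + 2 * t * \<beta> + t\<^sup>2 * \<alpha>"
      unfolding \<alpha>_def \<beta>_def cmod_add_scaled_sq sum_distrib_left sum.distrib[symmetric]
      by (rule sum.cong) (simp_all only: distrib_left mult_ac)
    then show ?thesis using min[of t] by simp
  qed
  define d where "d = \<alpha> + 1"
  have d: "0 < d" using \<alpha> by (simp add: d_def)
  \<comment> \<open>Adding 1 to \<open>\<alpha>\<close> avoids a separate case for a vanishing quadratic term.\<close>
  have "0 \<le> (2 * (- \<beta> / d) * \<beta> + (- \<beta> / d)\<^sup>2 * \<alpha>) * d\<^sup>2"
    by (rule mult_nonneg_nonneg[OF quad]) simp
  also have "\<dots> = - 2 * \<beta>\<^sup>2 * d + \<beta>\<^sup>2 * \<alpha>"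
    using d by (simp add: field_simps power2_eq_square)
  also have "\<dots> = - (\<beta>\<^sup>2 * (\<alpha> + 2))" by (simp add: d_def algebra_simps)
  finally have "\<beta>\<^sup>2 * (\<alpha> + 2) \<le> 0" by simp
  then have "\<beta> = 0" using \<alpha> by (simp add: mult_le_0_iff)
  then show ?thesis by (simp add: \<beta>_def)
qed

text \<open>Orthogonality turns the energy of \<open>n\<close> into its pairing with \<open>- m\<close>, which is split into the
  part on \<open>C\<close> and the part off \<open>C\<close> and estimated by Cauchy--Schwarz. Here \<open>C\<close> will be the corner,
  \<open>m\<close> the low-rank matrix and \<open>n\<close> the new error.\<close>

lemma weighted_energy_estimate:
  fixes m n :: "'i \<Rightarrow> complex" and w :: "'i \<Rightarrow> real"
  assumes fin: "finite I" and C: "C \<subseteq> I" and w: "\<And>i. i \<in> I \<Longrightarrow> 0 \<le> w i"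
    and orth: "(\<Sum>i\<in>I. w i * Re (cnj (n i) * (m i + n i))) = 0"
    and L: "0 < L" and lower: "\<And>i. i \<in> C \<Longrightarrow> 1 / L \<le> w i" and upper: "\<And>i. i \<in> C \<Longrightarrow> w i \<le> 4 / L"
    and t: "0 \<le> t" "\<And>i. i \<in> I - C \<Longrightarrow> w i \<le> t"
  defines "nrm z S \<equiv> L2_set (\<lambda>i. cmod (z i)) S"
  shows "(nrm n C)\<^sup>2 \<le> L * t * nrm m (I - C) * nrm n (I - C) + 4 * nrm m C * nrm n C"
proof -
  have cs: "(\<Sum>i\<in>S. cmod (n i) * cmod (m i)) \<le> nrm m S * nrm n S" for S
    using L2_set_mult_ineq[of "\<lambda>i. cmod (n i)" "\<lambda>i. cmod (m i)" S] by (simp add: nrm_def mult.commute)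
  have "(nrm n C)\<^sup>2 / L = (\<Sum>i\<in>C. (1 / L) * (cmod (n i))\<^sup>2)"
    by (simp add: nrm_def L2_set_def sum_nonneg sum_divide_distrib)
  also have "\<dots> \<le> (\<Sum>i\<in>C. w i * (cmod (n i))\<^sup>2)"
    using lower by (intro sum_mono mult_right_mono) auto
  also have "\<dots> \<le> (\<Sum>i\<in>I. w i * (cmod (n i))\<^sup>2)"
    using fin C w by (intro sum_mono2) auto
  also have "\<dots> = (\<Sum>i\<in>I. w i * - Re (cnj (n i) * m i))"
  proof -
    have "(\<Sum>i\<in>I. w i * Re (cnj (n i) * (m i + n i)))
        = (\<Sum>i\<in>I. w i * (cmod (n i))\<^sup>2) - (\<Sum>i\<in>I. w i * - Re (cnj (n i) * m i))"
      unfolding sum_subtractf[symmetric]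
      by (rule sum.cong) (simp_all add: cmod_power2[unfolded power2_eq_square] power2_eq_square algebra_simps)
    then show ?thesis using orth by simp
  qed
  also have "\<dots> \<le> (\<Sum>i\<in>I. w i * (cmod (n i) * cmod (m i)))"
  proof (intro sum_mono mult_left_mono)
    fix i
    have "- Re (cnj (n i) * m i) \<le> cmod (cnj (n i) * m i)"
      using complex_Re_le_cmod[of "- (cnj (n i) * m i)"] by simp
    then show "- Re (cnj (n i) * m i) \<le> cmod (n i) * cmod (m i)" by (simp add: norm_mult)
  qed (use w in auto)
  also have "\<dots> = (\<Sum>i\<in>I - C. w i * (cmod (n i) * cmod (m i))) + (\<Sum>i\<in>C. w i * (cmod (n i) * cmod (m i)))"
    by (rule sum.subset_diff[OF C fin])
  also have "\<dots> \<le> (\<Sum>i\<in>I - C. t * (cmod (n i) * cmod (m i))) + (\<Sum>i\<in>C. 4 / L * (cmod (n i) * cmod (m i)))"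
    using t upper by (intro add_mono sum_mono mult_right_mono) auto
  also have "\<dots> \<le> t * (nrm m (I - C) * nrm n (I - C)) + 4 / L * (nrm m C * nrm n C)"
    unfolding sum_distrib_left[symmetric]
    using cs t L by (intro add_mono mult_left_mono) auto
  finally show ?thesis using L by (simp add: field_simps)
qed

text \<open>From \<open>r\<close> up to the smaller dimension the smoothed singular values lie between \<open>\<epsilon>\<close> and
  \<open>sqrt 2 * \<epsilon>\<close>; before \<open>r\<close> they are at least \<open>singular_value X r\<close>. Beyond the smaller dimension they
  vanish, so that on the corner of a non-square matrix one of the two summands may be 0; this is why upper and lower bound differ by a factor of up to 4 rather than 2.\<close>

lemma hm_weight_entry_bounds:
  assumes X: "X \<in> carrier_mat d1 d2" and p: "0 < p" "p \<le> 1" and r: "1 \<le> r" "r \<le> min d1 d2"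
    and \<epsilon>: "0 < \<epsilon>" "\<epsilon> = singular_value X (r + 1)" and sr: "0 < singular_value X r"
    and ij: "i < d1" "j < d2"
  defines "w \<equiv> 2 / (smoothed_power X \<epsilon> p i + smoothed_power X \<epsilon> p j)"
  shows "r \<le> i \<Longrightarrow> r \<le> j \<Longrightarrow> 1 / (2 powr (1 - p / 2) * \<epsilon> powr (2 - p)) \<le> w"
    and "r \<le> i \<Longrightarrow> r \<le> j \<Longrightarrow> w \<le> 4 / (2 powr (1 - p / 2) * \<epsilon> powr (2 - p))"
    and "\<not> (r \<le> i \<and> r \<le> j) \<Longrightarrow> w \<le> 2 / singular_value X r powr (2 - p)"
proof -
  let ?h = "smoothed_power X \<epsilon> p"
  let ?L = "2 powr (1 - p / 2) * \<epsilon> powr (2 - p)"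
  have pos: "0 < ?h i + ?h j" using smoothed_power_sum_pos[of \<epsilon> i X j] \<epsilon> ij X by auto
  have le: "?h k \<le> ?L" if k: "r \<le> k" for k
  proof (cases "k < min d1 d2")
    case True
    have "singular_value X (Suc k) \<le> \<epsilon>" using singular_value_antimono[OF k, of X] \<epsilon>(2) by simp
    then have "(singular_value X (Suc k))\<^sup>2 \<le> \<epsilon>\<^sup>2" by (intro power_mono) auto
    then have "sqrt ((singular_value X (Suc k))\<^sup>2 + \<epsilon>\<^sup>2) \<le> sqrt (2 * \<epsilon>\<^sup>2)" by (intro real_sqrt_le_mono) simp
    also have "\<dots> = 2 powr (1 / 2) * \<epsilon>" using \<epsilon>(1) by (simp add: real_sqrt_mult powr_half_sqrt)
    finally have "sqrt ((singular_value X (Suc k))\<^sup>2 + \<epsilon>\<^sup>2) powr (2 - p) \<le> (2 powr (1 / 2) * \<epsilon>) powr (2 - p)"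
      using p by (intro powr_mono2) auto
    also have "\<dots> = ?L" using \<epsilon>(1) by (simp add: powr_mult powr_powr field_simps)
    finally show ?thesis using True X by (simp add: smoothed_power_def)
  next
    case False
    then show ?thesis using X by (auto simp: smoothed_power_def)
  qed
  have ge\<epsilon>: "\<epsilon> powr (2 - p) \<le> ?h k" if "k < min d1 d2" for k
  proof -
    have "sqrt (\<epsilon>\<^sup>2) \<le> sqrt ((singular_value X (Suc k))\<^sup>2 + \<epsilon>\<^sup>2)" by (intro real_sqrt_le_mono) simp
    then have "\<epsilon> \<le> sqrt ((singular_value X (Suc k))\<^sup>2 + \<epsilon>\<^sup>2)" using \<epsilon>(1) by simp
    then show ?thesis using that X \<epsilon>(1) p by (auto simp: smoothed_power_def intro!: powr_mono2)
  qed
  have ge\<sigma>: "singular_value X r powr (2 - p) \<le> ?h k" if "k < r" for k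
  proof -
    have "singular_value X r \<le> singular_value X (Suc k)"
      using singular_value_antimono[of k "r - 1" X] that by simp
    then have "(singular_value X r)\<^sup>2 \<le> (singular_value X (Suc k))\<^sup>2" by (rule power_mono) simp
    then have "(singular_value X r)\<^sup>2 \<le> (singular_value X (Suc k))\<^sup>2 + \<epsilon>\<^sup>2"
      using zero_le_power2[of \<epsilon>] by linarith
    then have "singular_value X r \<le> sqrt ((singular_value X (Suc k))\<^sup>2 + \<epsilon>\<^sup>2)"
      by (rule real_le_rsqrt)
    then show ?thesis using that X r p by (auto simp: smoothed_power_def intro!: powr_mono2)
  qed
  have \<epsilon>p: "0 < \<epsilon> powr (2 - p)" using \<epsilon>(1) by simp
  show "1 / ?L \<le> w" if "r \<le> i" "r \<le> j"
  proof -
    have "?h i + ?h j \<le> 2 * ?L" using le[OF that(1)] le[OF that(2)] by linarith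
    then have "2 / (2 * ?L) \<le> w" unfolding w_def using pos by (intro divide_left_mono) auto
    then show ?thesis by simp
  qed
  show "w \<le> 4 / ?L" if "r \<le> i" "r \<le> j"
  proof -
    have ge: "\<epsilon> powr (2 - p) \<le> ?h i + ?h j"
    proof -
      have "i < min d1 d2 \<or> j < min d1 d2" using ij by linarith
      then show ?thesis
        using ge\<epsilon>[of i] ge\<epsilon>[of j] smoothed_power_nonneg[of X \<epsilon> p i] smoothed_power_nonneg[of X \<epsilon> p j]
        by linarith
    qed
    have "w \<le> 2 / \<epsilon> powr (2 - p)"
      unfolding w_def using ge \<epsilon>p pos by (intro divide_left_mono) auto
    also have "2 / \<epsilon> powr (2 - p) \<le> 4 / ?L"
    proof -
      have "2 powr (1 - p / 2) \<le> 2 powr (1 :: real)" using p by (intro powr_mono) auto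
      then have "2 * ?L \<le> 4 * \<epsilon> powr (2 - p)" using \<epsilon>p by simp
      then show ?thesis using \<epsilon>p by (simp add: field_simps)
    qed
    finally show ?thesis .
  qed
  show "w \<le> 2 / singular_value X r powr (2 - p)" if "\<not> (r \<le> i \<and> r \<le> j)"
  proof -
    have ge: "singular_value X r powr (2 - p) \<le> ?h i + ?h j"
    proof -
      have "i < r \<or> j < r" using that by linarith
      then show ?thesis
        using ge\<sigma>[of i] ge\<sigma>[of j] smoothed_power_nonneg[of X \<epsilon> p i] smoothed_power_nonneg[of X \<epsilon> p j]
        by linarith
    qed
    show ?thesis unfolding w_def using ge sr pos by (intro divide_left_mono) auto
  qed
qed

section \<open>One weighted least squares step\<close>

lemma mat_adjoint_minus:
  fixes A B :: "complex mat"
  assumes "A \<in> carrier_mat n m" "B \<in> carrier_mat n m"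
  shows "mat_adjoint (A - B) = mat_adjoint A - mat_adjoint B"
  using assms by (intro eq_matI) auto

lemma conj_minus:
  fixes P A B Q :: "complex mat"
  assumes P: "P \<in> carrier_mat n d1" and A: "A \<in> carrier_mat d1 d2" and B: "B \<in> carrier_mat d1 d2"
    and Q: "Q \<in> carrier_mat d2 m"
  shows "P * (A - B) * Q = P * A * Q - P * B * Q"
  using mult_minus_distrib_mat[OF P A B]
    minus_mult_distrib_mat[OF mult_carrier_mat[OF P A] mult_carrier_mat[OF P B] Q] by simp

lemma conj_add_smult:
  fixes P A B Q :: "complex mat"
  assumes P: "P \<in> carrier_mat n d1" and A: "A \<in> carrier_mat d1 d2" and B: "B \<in> carrier_mat d1 d2"
    and Q: "Q \<in> carrier_mat d2 m"
  shows "P * (A + c \<cdot>\<^sub>m B) * Q = P * A * Q + c \<cdot>\<^sub>m (P * B * Q)"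
proof -
  have cB: "c \<cdot>\<^sub>m B \<in> carrier_mat d1 d2" using B by simp
  have "P * (A + c \<cdot>\<^sub>m B) * Q = P * A * Q + P * (c \<cdot>\<^sub>m B) * Q"
    using mult_add_distrib_mat[OF P A cB]
      add_mult_distrib_mat[OF mult_carrier_mat[OF P A] mult_carrier_mat[OF P cB] Q] by simp
  also have "P * (c \<cdot>\<^sub>m B) * Q = c \<cdot>\<^sub>m (P * B * Q)"
    using mult_smult_distrib[OF P B] mult_smult_assoc_mat[OF mult_carrier_mat[OF P B] Q] by simp
  finally show ?thesis .
qed

lemma column_sum_sq_le:
  assumes A: "A \<in> carrier_mat n m" and j: "j < m"
    and bound: "\<And>x. x \<in> carrier_vec m \<Longrightarrow> vnorm (A *\<^sub>v x) \<le> c * vnorm x"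
  shows "(\<Sum>i<n. (cmod (A $$ (i, j)))\<^sup>2) \<le> c\<^sup>2"
proof -
  have u: "unit_vec m j \<in> carrier_vec m" by simp
  have Au: "A *\<^sub>v unit_vec m j \<in> carrier_vec n" by (rule mult_mat_vec_carrier[OF A u])
  have ent: "(A *\<^sub>v unit_vec m j) $ i = A $$ (i, j)" if i: "i < n" for i
  proof -
    have "(A *\<^sub>v unit_vec m j) $ i = (\<Sum>k<m. if k = j then A $$ (i, j) else 0)"
      unfolding index_mult_mat_vec_sum[OF A u i] by (rule sum.cong) (use j in auto)
    then show ?thesis using j by simp
  qed
  have "complex_of_real ((vnorm (unit_vec m j))\<^sup>2) = conjugate (unit_vec m j) \<bullet> unit_vec m j"
    by (rule vnorm_sq_scalar_prod[OF u])
  also have "\<dots> = 1" using j by (simp add: scalar_prod_right_unit)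
  finally have "(vnorm (unit_vec m j))\<^sup>2 = 1" by (metis of_real_eq_1_iff)
  then have n1: "vnorm (unit_vec m j) = 1" using vnorm_nonneg[of "unit_vec m j"] by (simp add: power2_eq_1_iff)
  have "(\<Sum>i<n. (cmod (A $$ (i, j)))\<^sup>2) = (vnorm (A *\<^sub>v unit_vec m j))\<^sup>2"
    unfolding vnorm_sq[OF Au] by (rule sum.cong) (simp_all only: ent lessThan_iff)
  also have "\<dots> \<le> c\<^sup>2" using bound[OF u] n1 by (intro power_mono) simp_all
  finally show ?thesis .
qed

text \<open>The complement of the corner is covered by \<open>r\<close> rows and \<open>r\<close> columns.\<close>

lemma L_shape_sum_le:
  assumes M: "M \<in> carrier_mat d1 d2" and r: "r \<le> d1" "r \<le> d2"
  shows "(\<Sum>x\<in>{..<d1} \<times> {..<d2} - {r..<d1} \<times> {r..<d2}. (cmod (M $$ x))\<^sup>2)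
    \<le> 2 * real r * (singular_value M 1)\<^sup>2"
proof -
  let ?R = "{..<r} \<times> {..<d2}" and ?C = "{..<d1} \<times> {..<r}"
  let ?f = "\<lambda>x. (cmod (M $$ x))\<^sup>2"
  have "sum ?f ({..<d1} \<times> {..<d2} - {r..<d1} \<times> {r..<d2}) \<le> sum ?f (?R \<union> ?C)"
    by (rule sum_mono2) auto
  also have "\<dots> \<le> sum ?f ?R + sum ?f ?C"
    using sum.union_inter[of ?R ?C ?f] sum_nonneg[of "?R \<inter> ?C" ?f] by simp
  also have "sum ?f ?R = (\<Sum>i<r. \<Sum>j<d2. (cmod (M $$ (i, j)))\<^sup>2)"
    by (simp add: sum.cartesian_product)
  also have "\<dots> \<le> (\<Sum>i<r. (singular_value M 1)\<^sup>2)"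
  proof (rule sum_mono)
    fix i assume "i \<in> {..<r}"
    then have i: "i < d1" using r by simp
    have "(\<Sum>j<d2. (cmod (M $$ (i, j)))\<^sup>2) = (\<Sum>j<d2. (cmod (mat_adjoint M $$ (j, i)))\<^sup>2)"
      using M i by (intro sum.cong) auto
    also have "\<dots> \<le> (singular_value M 1)\<^sup>2"
      by (rule column_sum_sq_le[OF mat_adjoint_carrier[OF M] i vnorm_adjoint_mult_le[OF M]])
    finally show "(\<Sum>j<d2. (cmod (M $$ (i, j)))\<^sup>2) \<le> (singular_value M 1)\<^sup>2" .
  qed
  also have "sum ?f ?C = (\<Sum>i<d1. \<Sum>j<r. (cmod (M $$ (i, j)))\<^sup>2)"
    by (simp add: sum.cartesian_product)
  also have "\<dots> = (\<Sum>j<r. \<Sum>i<d1. (cmod (M $$ (i, j)))\<^sup>2)" by (rule sum.swap)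
  also have "\<dots> \<le> (\<Sum>j<r. (singular_value M 1)\<^sup>2)"
    using r by (intro sum_mono column_sum_sq_le[OF M _ vnorm_mult_le[OF M]]) auto
  finally show ?thesis by simp
qed

lemma singular_values_above_rank:
  assumes X: "X \<in> carrier_mat d1 d2" and rank: "vec_space.rank d1 X = r" and k: "r \<le> k"
  shows "singular_value X (Suc k) = 0"
proof -
  obtain w where w: "\<And>i. i < r \<Longrightarrow> w i \<in> carrier_vec d2"
    "\<And>x. x \<in> carrier_vec d2 \<Longrightarrow> (\<forall>i<r. w i \<bullet> x = 0) \<Longrightarrow> X *\<^sub>v x = 0\<^sub>v d1"
    using kernel_of_rank[OF X rank] by blast
  have "singular_value X (Suc r) \<le> 0"
  proof (rule singular_value_minimax[OF X order.refl w(1)])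
    fix x assume x: "x \<in> carrier_vec d2" and 0: "\<And>i. i < r \<Longrightarrow> w i \<bullet> x = 0"
    have "X *\<^sub>v x = 0\<^sub>v d1" using w(2)[OF x] 0 by blast
    then show "vnorm (X *\<^sub>v x) \<le> 0 * vnorm x" using vnorm_eq_0_iff[of "0\<^sub>v d1" d1] by simp
  qed
  then show ?thesis using singular_value_antimono[OF k, of X] singular_value_nonneg[of X "Suc k"] by linarith
qed

text \<open>A perturbation of rank \<open>r\<close> shifts singular values by at most \<open>r\<close> places, because it vanishes
  under \<open>r\<close> linear constraints.\<close>

lemma weyl_low_rank:
  assumes A: "A \<in> carrier_mat d1 d2" and B: "B \<in> carrier_mat d1 d2"
    and X0: "X0 \<in> carrier_mat d1 d2" and rank: "vec_space.rank d1 X0 = r"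
    and AB: "A = B - X0 \<or> A = B + X0"
  shows "singular_value A (Suc (r + j)) \<le> singular_value B (Suc j)"
proof (cases "r + j < d2")
  case True
  obtain w where w: "\<And>i. i < r \<Longrightarrow> w i \<in> carrier_vec d2"
    "\<And>x. x \<in> carrier_vec d2 \<Longrightarrow> (\<forall>i<r. w i \<bullet> x = 0) \<Longrightarrow> X0 *\<^sub>v x = 0\<^sub>v d1"
    using kernel_of_rank[OF X0 rank] by blast
  have "singular_value A (Suc (r + j)) \<le> singular_value B (Suc j) + 0"
  proof (rule singular_value_weyl[OF A B order.refl w(1) _ True])
    fix x assume x: "x \<in> carrier_vec d2" and 0: "\<And>i. i < r \<Longrightarrow> w i \<bullet> x = 0"
    have z: "X0 *\<^sub>v x = 0\<^sub>v d1" using w(2)[OF x] 0 by blast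
    have Bx: "B *\<^sub>v x \<in> carrier_vec d1" by (rule mult_mat_vec_carrier[OF B x])
    have "A *\<^sub>v x = B *\<^sub>v x"
      using AB minus_mult_distrib_mat_vec[OF B X0 x] add_mult_distrib_mat_vec[OF B X0 x] z Bx by auto
    then show "vnorm (A *\<^sub>v x) \<le> vnorm (B *\<^sub>v x) + 0 * vnorm x" by simp
  qed
  then show ?thesis by simp
next
  case False
  then show ?thesis using A by (simp add: singular_value_beyond)
qed

lemma weyl_perturbation:
  assumes A: "A \<in> carrier_mat d1 d2" and B: "B \<in> carrier_mat d1 d2"
  shows "singular_value A (Suc j) \<le> singular_value B (Suc j) + singular_value (B - A) 1"
proof (cases "j < d2")
  case True
  have BA: "B - A \<in> carrier_mat d1 d2" by (rule minus_carrier_mat[OF A])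
  have "singular_value A (Suc (0 + j)) \<le> singular_value B (Suc j) + singular_value (B - A) 1"
  proof (rule singular_value_weyl[OF A B _ _ _, where C = "\<lambda>_. 0\<^sub>v d2"])
    fix x :: "complex vec" assume x: "x \<in> carrier_vec d2"
    have c: "A *\<^sub>v x \<in> carrier_vec d1" "B *\<^sub>v x \<in> carrier_vec d1" "(B - A) *\<^sub>v x \<in> carrier_vec d1"
      using mult_mat_vec_carrier[OF A x] mult_mat_vec_carrier[OF B x] mult_mat_vec_carrier[OF BA x] .
    have "A *\<^sub>v x = B *\<^sub>v x + (- 1) \<cdot>\<^sub>v ((B - A) *\<^sub>v x)"
      unfolding minus_mult_distrib_mat_vec[OF B A x] using c by (intro eq_vecI) auto
    then have "vnorm (A *\<^sub>v x) \<le> vnorm (B *\<^sub>v x) + vnorm ((- 1) \<cdot>\<^sub>v ((B - A) *\<^sub>v x))"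
      using vnorm_triangle[of "B *\<^sub>v x" d1 "(- 1) \<cdot>\<^sub>v ((B - A) *\<^sub>v x)"] c by simp
    also have "vnorm ((- 1) \<cdot>\<^sub>v ((B - A) *\<^sub>v x)) = vnorm ((B - A) *\<^sub>v x)" by (simp add: vnorm_smult)
    finally show "vnorm (A *\<^sub>v x) \<le> vnorm (B *\<^sub>v x) + singular_value (B - A) 1 * vnorm x"
      using vnorm_mult_le[OF BA x] by linarith
  qed (use True in auto)
  then show ?thesis by simp
next
  case False
  then show ?thesis using A by (simp add: singular_value_beyond)
qed


lemma sum_product_split:
  fixes f :: "nat \<times> nat \<Rightarrow> real"
  shows "(\<Sum>x\<in>{..<d1} \<times> {..<d2}. f x) = (\<Sum>i<d1. \<Sum>j<d2. f (i, j))"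
    "(\<Sum>x\<in>{r..<d1} \<times> {r..<d2}. f x) = (\<Sum>i\<in>{r..<d1}. \<Sum>j\<in>{r..<d2}. f (i, j))"
  by (simp_all add: sum.cartesian_product)

text \<open>Everything is transported to the coordinates of \<open>X\<close>, where \<open>M\<close>, \<open>E\<close> and \<open>H\<close> stand for \<open>X0\<close>,
  \<open>X - X0\<close> and \<open>N\<close>. Since \<open>M\<close> is the diagonal matrix of singular values of \<open>X\<close> minus \<open>E\<close>, its trailing
  rows and columns are bounded by \<open>2 e\<close>. The energy estimate gives a quadratic inequality for the
  norm of the corner of \<open>H\<close>, in which the part off the corner is absorbed through \<open>G\<close>.\<close>

lemma corner_contraction:
  assumes X: "X \<in> carrier_mat d1 d2" and X0: "X0 \<in> carrier_mat d1 d2" and X': "X' \<in> carrier_mat d1 d2"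
    and p: "0 < p" "p \<le> 1" and r: "1 \<le> r" "2 * r \<le> min d1 d2" and rank: "vec_space.rank d1 X0 = r"
    and svd: "full_svd X U S V"
    and \<epsilon>: "0 < \<epsilon>" "\<epsilon> = singular_value X (r + 1)"
    and e: "e = singular_value (X - X0) 1" "e \<le> \<zeta> * \<sigma>" and \<zeta>: "\<zeta> < 1"
    and \<sigma>: "\<sigma> = singular_value X0 r" "0 < \<sigma>"
    and N: "N = X' - X0"
    and min: "\<And>t :: real. (weighted_norm (hm_weight X U V \<epsilon> p) (mat_vec X'))\<^sup>2
        \<le> (weighted_norm (hm_weight X U V \<epsilon> p) (mat_vec (X' + complex_of_real t \<cdot>\<^sub>m N)))\<^sup>2"
    and G: "0 \<le> G" "(\<Sum>j<2 * r. (singular_value N (Suc j))\<^sup>2)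
        \<le> G\<^sup>2 * (\<Sum>j\<in>{2 * r..<d2}. (singular_value N (Suc j))\<^sup>2)"
  shows "sqrt (\<Sum>j\<in>{2 * r..<d2}. (singular_value N (Suc j))\<^sup>2)
    \<le> sqrt (real r) * (6 * G * singular_value X0 1 * \<epsilon> powr (2 - p) / ((1 - \<zeta>) * \<sigma>) powr (2 - p)
        + 16 * e\<^sup>2 / \<sigma>)"
proof -
  have U: "unitary_mat d1 U" and V: "unitary_mat d2 V" and XS: "X = U * S * mat_adjoint V"
    and S: "S = mat d1 d2 (\<lambda>(i, j). if i = j then complex_of_real (singular_value X (i + 1)) else 0)"
    using svd X by (auto simp: full_svd_def)
  note u = unitary_matD[OF U] and v = unitary_matD[OF V]
  have Sc: "S \<in> carrier_mat d1 d2" by (simp add: S)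
  have Nc: "N \<in> carrier_mat d1 d2" unfolding N by (rule minus_carrier_mat[OF X0])
  have XX0: "X - X0 \<in> carrier_mat d1 d2" by (rule minus_carrier_mat[OF X0])
  have cc: "mat_adjoint U * A * V \<in> carrier_mat d1 d2" if "A \<in> carrier_mat d1 d2" for A
    by (rule mult_carrier_mat[OF mult_carrier_mat[OF u(2) that] v(1)])
  define M where "M = mat_adjoint U * X0 * V"
  define E where "E = mat_adjoint U * (X - X0) * V"
  define H where "H = mat_adjoint U * N * V"
  have M: "M \<in> carrier_mat d1 d2" and E: "E \<in> carrier_mat d1 d2" and H: "H \<in> carrier_mat d1 d2"
    unfolding M_def E_def H_def using cc X0 XX0 Nc by auto
  have svM: "singular_value M i = singular_value X0 i" for i
    unfolding M_def by (rule singular_value_unitary_conj[OF X0 U V])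
  have svE: "singular_value E i = singular_value (X - X0) i" for i
    unfolding E_def by (rule singular_value_unitary_conj[OF XX0 U V])
  have svH: "singular_value H i = singular_value N i" for i
    unfolding H_def by (rule singular_value_unitary_conj[OF Nc U V])
  have "mat_adjoint U * X * V = S" unfolding XS by (rule unitary_conj_cancel(1)[OF U V Sc])
  then have ES: "E = S - M" unfolding E_def M_def conj_minus[OF u(2) X X0 v(1)] by simp
  have MS: "M = S - E"
    unfolding ES using Sc M by (intro eq_matI) auto
  have e0: "0 \<le> e" by (simp add: e(1))
  have \<epsilon>e: "\<epsilon> \<le> e"
  proof -
    have "X - X0 + X0 = X" using X X0 by (intro eq_matI) auto
    then have "singular_value X (Suc (r + 0)) \<le> singular_value (X - X0) (Suc 0)"
      by (intro weyl_low_rank[OF X XX0 X0 rank]) simp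
    then show ?thesis using \<epsilon>(2) e(1) by simp
  qed
  have small: "cmod (S $$ (i, i)) \<le> e" if "r \<le> i" "i < d1" "i < d2" for i
    using singular_value_antimono[OF that(1), of X] that \<epsilon>(2) \<epsilon>e by (simp add: S)
  have rows: "(\<Sum>i\<in>{r..<d1}. (cmod ((M *\<^sub>v x) $ i))\<^sup>2) \<le> (2 * e)\<^sup>2 * (vnorm x)\<^sup>2"
    if x: "x \<in> carrier_vec d2" for x
    unfolding MS
  proof (rule trailing_rows_bound[OF Sc E e0 _ small _ x])
    show "vnorm (E *\<^sub>v y) \<le> e * vnorm y" if "y \<in> carrier_vec d2" for y
      using vnorm_mult_le[OF E that] svE e(1) by simp
  qed (auto simp: S)
  have cols: "(\<Sum>j\<in>{r..<d2}. (cmod ((mat_adjoint M *\<^sub>v y) $ j))\<^sup>2) \<le> (2 * e)\<^sup>2 * (vnorm y)\<^sup>2"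
    if y: "y \<in> carrier_vec d1" for y
    unfolding MS mat_adjoint_minus[OF Sc E]
  proof (rule trailing_rows_bound[OF mat_adjoint_carrier[OF Sc] mat_adjoint_carrier[OF E] e0 _ _ _ y])
    show "vnorm (mat_adjoint E *\<^sub>v z) \<le> e * vnorm z" if "z \<in> carrier_vec d1" for z
      using vnorm_adjoint_mult_le[OF E that] svE e(1) by simp
    show "cmod (mat_adjoint S $$ (i, i)) \<le> e" if "r \<le> i" "i < d2" "i < d1" for i
      using small[of i] that Sc by simp
  qed (use Sc in \<open>auto simp: S\<close>)
  let ?I = "{..<d1} \<times> {..<d2}" and ?C = "{r..<d1} \<times> {r..<d2}"
  define nrm where "nrm z T = L2_set (\<lambda>x. cmod (z x)) T" for z :: "nat \<times> nat \<Rightarrow> complex" and T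
  have nrm_sq: "(nrm z T)\<^sup>2 = (\<Sum>x\<in>T. (cmod (z x))\<^sup>2)" for z T
    by (simp add: nrm_def L2_set_def sum_nonneg)
  have nrm0: "0 \<le> nrm z T" for z T by (simp add: nrm_def)
  define m where "m x = M $$ x" for x
  define n where "n x = H $$ x" for x
  have q: "nrm m ?C \<le> sqrt (real r) * (4 * e\<^sup>2 / \<sigma>)"
  proof -
    have rk: "singular_value M (Suc k) = 0" if "r \<le> k" for k
      using singular_values_above_rank[OF X0 rank that] svM by simp
    have "(nrm m ?C)\<^sup>2 = (\<Sum>i\<in>{r..<d1}. \<Sum>j\<in>{r..<d2}. (cmod (M $$ (i, j)))\<^sup>2)"
      unfolding nrm_sq m_def sum_product_split ..
    also have "\<dots> \<le> real r * ((2 * e)\<^sup>2 / \<sigma>)\<^sup>2"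
      using r svM \<sigma> by (intro low_rank_corner[OF M _ _ rk _ _ rows cols]) auto
    also have "\<dots> = (sqrt (real r) * (4 * e\<^sup>2 / \<sigma>))\<^sup>2"
      by (simp add: power_mult_distrib power_divide)
    finally show ?thesis by (rule power2_le_imp_le) (use \<sigma> in simp)
  qed
  have mT: "nrm m (?I - ?C) \<le> sqrt (2 * real r) * singular_value X0 1"
  proof -
    have "(nrm m (?I - ?C))\<^sup>2 \<le> 2 * real r * (singular_value X0 1)\<^sup>2"
      unfolding nrm_sq m_def svM[symmetric] using r by (intro L_shape_sum_le[OF M]) auto
    also have "\<dots> = (sqrt (2 * real r) * singular_value X0 1)\<^sup>2" by (simp add: power_mult_distrib)
    finally show ?thesis by (rule power2_le_imp_le) simp
  qed
  let ?tail = "\<Sum>j\<in>{2 * r..<d2}. (singular_value N (Suc j))\<^sup>2"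
  have tail: "?tail \<le> (nrm n ?C)\<^sup>2"
    unfolding nrm_sq n_def sum_product_split svH[symmetric] using r by (intro tail_le_corner[OF H]) auto
  have nT: "nrm n (?I - ?C) \<le> G * nrm n ?C"
  proof -
    have "(nrm n (?I - ?C))\<^sup>2 = (\<Sum>x\<in>?I. (cmod (n x))\<^sup>2) - (nrm n ?C)\<^sup>2"
      unfolding nrm_sq by (subst sum_diff) auto
    also have "(\<Sum>x\<in>?I. (cmod (n x))\<^sup>2) = frob_sq H"
      unfolding sum_product_split n_def frob_sq_def using H by simp
    also have "\<dots> = (\<Sum>j<d2. (singular_value N (Suc j))\<^sup>2)"
      unfolding frob_sq_eq_sum_singular_values[OF H] svH ..
    also have "\<dots> = (\<Sum>j<2 * r. (singular_value N (Suc j))\<^sup>2) + ?tail"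
    proof -
      have "{..<d2} = {..<2 * r} \<union> {2 * r..<d2}" using r by auto
      then show ?thesis by (simp add: sum.union_disjoint ivl_disj_int)
    qed
    finally have "(nrm n (?I - ?C))\<^sup>2 \<le> (\<Sum>j<2 * r. (singular_value N (Suc j))\<^sup>2)" using tail by simp
    also have "\<dots> \<le> G\<^sup>2 * (nrm n ?C)\<^sup>2"
      using G(2) mult_left_mono[OF tail, of "G\<^sup>2"] by simp
    also have "\<dots> = (G * nrm n ?C)\<^sup>2" by (simp add: power_mult_distrib)
    finally show ?thesis by (rule power2_le_imp_le) (use G nrm0 in simp)
  qed
  have sr: "(1 - \<zeta>) * \<sigma> \<le> singular_value X r"
  proof -
    have "singular_value X0 (Suc (r - 1)) \<le> singular_value X (Suc (r - 1)) + singular_value (X - X0) 1"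
      by (rule weyl_perturbation[OF X0 X])
    then have "\<sigma> \<le> singular_value X r + e" using r \<sigma> e(1) by simp
    then show ?thesis using e(2) by (simp add: algebra_simps)
  qed
  have sr0: "0 < (1 - \<zeta>) * \<sigma>" using \<zeta> \<sigma> by simp
  then have sr1: "0 < singular_value X r" using sr by linarith
  define w where "w x = 2 / (smoothed_power X \<epsilon> p (fst x) + smoothed_power X \<epsilon> p (snd x))" for x
  define L where "L = 2 powr (1 - p / 2) * \<epsilon> powr (2 - p)"
  define t where "t = 2 / singular_value X r powr (2 - p)"
  have L0: "0 < L" using \<epsilon> by (simp add: L_def)
  have t0: "0 \<le> t" by (simp add: t_def)
  have r12: "r \<le> min d1 d2" using r by simp
  note bnds = hm_weight_entry_bounds[OF X p r(1) r12 \<epsilon> sr1]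
  have wpos: "0 \<le> w x" if "x \<in> ?I" for x
    unfolding w_def by simp
  have wn: "(weighted_norm (hm_weight X U V \<epsilon> p) (mat_vec Z))\<^sup>2
      = (\<Sum>x\<in>?I. w x * (cmod ((mat_adjoint U * Z * V) $$ x))\<^sup>2)" if "Z \<in> carrier_mat d1 d2" for Z
    using weighted_norm_hm_weight[OF X U V _ that, of \<epsilon> p] \<epsilon>(1)
    by (simp add: w_def split_def)
  have X'N: "X' = X0 + N" unfolding N using X' X0 by (intro eq_matI) auto
  have X'coord: "mat_adjoint U * X' * V = M + H"
  proof -
    have "1 \<cdot>\<^sub>m A = A" for A :: "complex mat" by (rule eq_matI) auto
    then show ?thesis
      using conj_add_smult[OF u(2) X0 Nc v(1), of 1] unfolding X'N M_def H_def by simp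
  qed
  have orth: "(\<Sum>x\<in>?I. w x * Re (cnj (n x) * (m x + n x))) = 0"
  proof (rule minimizer_orthogonal[OF wpos])
    fix s :: real
    have "(\<Sum>x\<in>?I. w x * (cmod (m x + n x))\<^sup>2) = (weighted_norm (hm_weight X U V \<epsilon> p) (mat_vec X'))\<^sup>2"
      unfolding wn[OF X'] X'coord m_def n_def using M H by (intro sum.cong) auto
    also have "\<dots> \<le> (weighted_norm (hm_weight X U V \<epsilon> p) (mat_vec (X' + complex_of_real s \<cdot>\<^sub>m N)))\<^sup>2"
      by (rule min)
    also have "\<dots> = (\<Sum>x\<in>?I. w x * (cmod (m x + n x + complex_of_real s * n x))\<^sup>2)"
    proof -
      have c: "X' + complex_of_real s \<cdot>\<^sub>m N \<in> carrier_mat d1 d2" using X' Nc by simp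
      have coord: "mat_adjoint U * (X' + complex_of_real s \<cdot>\<^sub>m N) * V
          = M + H + complex_of_real s \<cdot>\<^sub>m H"
        unfolding conj_add_smult[OF u(2) X' Nc v(1)] X'coord H_def ..
      show ?thesis
        unfolding wn[OF c] coord m_def n_def
        by (rule sum.cong) (use M H in \<open>auto simp: add.assoc\<close>)
    qed
    finally show "(\<Sum>x\<in>?I. w x * (cmod (m x + n x))\<^sup>2)
        \<le> (\<Sum>x\<in>?I. w x * (cmod (m x + n x + complex_of_real s * n x))\<^sup>2)" .
  qed
  have "(nrm n ?C)\<^sup>2 \<le> L * t * nrm m (?I - ?C) * nrm n (?I - ?C) + 4 * nrm m ?C * nrm n ?C"
    unfolding nrm_def
  proof (rule weighted_energy_estimate[OF _ _ wpos orth L0 _ _ t0])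
    fix x assume "x \<in> ?C"
    then have "fst x < d1" "snd x < d2" "r \<le> fst x" "r \<le> snd x" by auto
    then show "1 / L \<le> w x" "w x \<le> 4 / L" unfolding L_def w_def using bnds by blast+
  next
    fix x assume "x \<in> ?I - ?C"
    then have "fst x < d1" "snd x < d2" "\<not> (r \<le> fst x \<and> r \<le> snd x)" by auto
    then show "w x \<le> t" unfolding t_def w_def using bnds by blast
  qed auto
  also have "\<dots> \<le> L * t * (sqrt (2 * real r) * singular_value X0 1) * (G * nrm n ?C)
      + 4 * (sqrt (real r) * (4 * e\<^sup>2 / \<sigma>)) * nrm n ?C"
    using mT nT q L0 t0 nrm0 G(1) \<sigma>(2)
    by (intro add_mono mult_mono mult_left_mono mult_nonneg_nonneg) auto
  finally have quad: "(nrm n ?C)\<^sup>2 \<le> (L * t * (sqrt (2 * real r) * singular_value X0 1) * G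
      + 4 * (sqrt (real r) * (4 * e\<^sup>2 / \<sigma>))) * nrm n ?C" (is "_ \<le> ?B * _")
    by (simp add: algebra_simps)
  have B0: "0 \<le> ?B" using L0 t0 G(1) \<sigma> by (intro add_nonneg_nonneg mult_nonneg_nonneg) auto
  have yB: "nrm n ?C \<le> ?B"
  proof (cases "nrm n ?C = 0")
    case False
    then have "0 < nrm n ?C" using nrm0[of n ?C] by linarith
    then show ?thesis using quad by (simp add: power2_eq_square)
  qed (use B0 in simp)
  have "L * t \<le> 4 * \<epsilon> powr (2 - p) / ((1 - \<zeta>) * \<sigma>) powr (2 - p)"
  proof -
    have "2 powr (1 - p / 2) \<le> 2 powr (1 :: real)" using p by (intro powr_mono) auto
    then have L2: "L \<le> 2 * \<epsilon> powr (2 - p)" unfolding L_def by (intro mult_right_mono) auto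
    have "((1 - \<zeta>) * \<sigma>) powr (2 - p) \<le> singular_value X r powr (2 - p)"
      using sr sr0 p by (intro powr_mono2) auto
    moreover have "0 < ((1 - \<zeta>) * \<sigma>) powr (2 - p)" "0 < singular_value X r powr (2 - p)"
      using sr0 sr1 by (metis powr_gt_zero less_irrefl)+
    ultimately have "t \<le> 2 / ((1 - \<zeta>) * \<sigma>) powr (2 - p)"
      unfolding t_def by (intro divide_left_mono mult_pos_pos) auto
    then have "L * t \<le> (2 * \<epsilon> powr (2 - p)) * (2 / ((1 - \<zeta>) * \<sigma>) powr (2 - p))"
      using L2 L0 t0 by (intro mult_mono) auto
    then show ?thesis by simp
  qed
  then have "?B \<le> 4 * \<epsilon> powr (2 - p) / ((1 - \<zeta>) * \<sigma>) powr (2 - p) * (sqrt (2 * real r) * singular_value X0 1) * G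
      + 4 * (sqrt (real r) * (4 * e\<^sup>2 / \<sigma>))"
    using G(1) by (intro add_right_mono mult_right_mono) auto
  also have "\<dots> = sqrt (real r) * (4 * sqrt 2 * (G * singular_value X0 1 * \<epsilon> powr (2 - p) / ((1 - \<zeta>) * \<sigma>) powr (2 - p))
        + 16 * e\<^sup>2 / \<sigma>)"
    by (simp add: real_sqrt_mult algebra_simps)
  also have "\<dots> \<le> sqrt (real r) * (6 * (G * singular_value X0 1 * \<epsilon> powr (2 - p) / ((1 - \<zeta>) * \<sigma>) powr (2 - p))
        + 16 * e\<^sup>2 / \<sigma>)"
  proof -
    have "sqrt 2 \<le> sqrt ((3 / 2)\<^sup>2)" by (intro real_sqrt_le_mono) (simp add: power2_eq_square)
    then have "4 * sqrt 2 \<le> 6" by simp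
    then show ?thesis using G(1) by (intro mult_left_mono add_right_mono mult_right_mono) auto
  qed
  finally have "nrm n ?C \<le> sqrt (real r) * (6 * G * singular_value X0 1 * \<epsilon> powr (2 - p) / ((1 - \<zeta>) * \<sigma>) powr (2 - p)
        + 16 * e\<^sup>2 / \<sigma>)"
    using yB by (simp add: mult.assoc)
  moreover have "sqrt ?tail \<le> nrm n ?C" using real_sqrt_le_mono[OF tail] nrm0 by simp
  ultimately show ?thesis by linarith
qed

section \<open>The null space inequality and the contraction constant\<close>

text \<open>The tangent line at 1 lies above a concave power; here through concavity of the logarithm.\<close>

lemma powr_le_affine:
  fixes x \<theta> :: real
  assumes "0 \<le> x" "0 < \<theta>" "\<theta> \<le> 1"
  shows "x powr \<theta> \<le> \<theta> * x + (1 - \<theta>)"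
proof (cases "x = 0")
  case False
  then have x: "0 < x" using assms by simp
  define m where "m = \<theta> * x + (1 - \<theta>)"
  have m: "0 < m" unfolding m_def using x assms by (intro add_pos_nonneg mult_pos_pos) auto
  have "\<theta> * ln (x / m) + (1 - \<theta>) * ln (1 / m) \<le> \<theta> * (x / m - 1) + (1 - \<theta>) * (1 / m - 1)"
    using x m assms by (intro add_mono mult_left_mono ln_le_minus_one) auto
  also have "\<dots> = (\<theta> * x + (1 - \<theta>)) / m - 1" by (simp add: algebra_simps add_divide_distrib diff_divide_distrib)
  also have "\<dots> = 0" using m by (simp add: m_def)
  finally have "\<theta> * ln x \<le> ln m" using x m by (simp add: ln_div algebra_simps)
  then have "exp (\<theta> * ln x) \<le> exp (ln m)" by (simp only: exp_le_cancel_iff)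
  also have "\<dots> = m" using m by simp
  finally show ?thesis using x by (simp add: powr_def m_def)
qed (use assms in simp)

text \<open>Apply \<open>powr_le_affine\<close> to each square divided by the mean of the squares.\<close>

lemma power_mean_le:
  fixes a :: "'i \<Rightarrow> real"
  assumes fin: "finite I" and a: "\<And>i. i \<in> I \<Longrightarrow> 0 \<le> a i" and p: "0 < p" "p \<le> 2"
  shows "(\<Sum>i\<in>I. a i powr p) \<le> real (card I) powr (1 - p / 2) * (\<Sum>i\<in>I. (a i)\<^sup>2) powr (p / 2)"
proof (cases "(\<Sum>i\<in>I. (a i)\<^sup>2) = 0")
  case True
  then have "a i = 0" if "i \<in> I" for i using that fin by (simp add: sum_nonneg_eq_0_iff)
  then show ?thesis using p by simp
next
  case False
  define S where "S = (\<Sum>i\<in>I. (a i)\<^sup>2)"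
  define k where "k = real (card I)"
  have S: "0 < S" using False sum_nonneg[of I "\<lambda>i. (a i)\<^sup>2"] unfolding S_def by fastforce
  have "I \<noteq> {}" using False by auto
  then have k: "0 < k" using fin by (simp add: k_def card_gt_0_iff)
  define m where "m = S / k"
  have m: "0 < m" using S k by (simp add: m_def)
  have sq: "(a i)\<^sup>2 powr (p / 2) = a i powr p" if "i \<in> I" for i
    using a[OF that] p by (cases "a i = 0") (simp_all add: powr_powr flip: powr_numeral)
  have "(\<Sum>i\<in>I. a i powr p) = m powr (p / 2) * (\<Sum>i\<in>I. ((a i)\<^sup>2 / m) powr (p / 2))"
    unfolding sum_distrib_left using m by (intro sum.cong) (simp_all add: powr_divide sq)
  also have "\<dots> \<le> m powr (p / 2) * (\<Sum>i\<in>I. p / 2 * ((a i)\<^sup>2 / m) + (1 - p / 2))"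
    using m p by (intro mult_left_mono sum_mono powr_le_affine) auto
  also have "(\<Sum>i\<in>I. p / 2 * ((a i)\<^sup>2 / m) + (1 - p / 2)) = p / 2 * (S / m) + k * (1 - p / 2)"
    by (simp add: sum.distrib S_def k_def sum_distrib_left sum_divide_distrib)
  also have "\<dots> = k" using S k by (simp add: m_def field_simps)
  also have "m powr (p / 2) * k = k powr (1 - p / 2) * S powr (p / 2)"
    using S k by (simp add: m_def powr_divide powr_diff)
  finally show ?thesis by (simp add: S_def k_def)
qed

text \<open>The non-strict form of the null space inequality covers the zero matrix as well, which the new
  error may be.\<close>

locale nsp_sequence =
  fixes s :: "nat \<Rightarrow> real" and k d :: nat and p \<gamma> :: real
  assumes s: "\<And>i. 0 \<le> s i" and p: "0 < p" "p \<le> 1" and k: "1 \<le> k" "k \<le> d" and \<gamma>: "0 < \<gamma>" "\<gamma> \<le> 1"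
    and nsp: "(\<Sum>i = 1..k. (s i)\<^sup>2) powr (p / 2)
      \<le> \<gamma> / real k powr (1 - p / 2) * (\<Sum>i = k + 1..d. s i powr p)"
begin

lemma head_le_tail:
  "(\<Sum>i = 1..k. (s i)\<^sup>2)
    \<le> \<gamma> powr (2 / p) * (real (d - k) / real k) powr (2 / p - 1) * (\<Sum>i = k + 1..d. (s i)\<^sup>2)"
proof -
  let ?H = "\<Sum>i = 1..k. (s i)\<^sup>2" and ?T = "\<Sum>i = k + 1..d. (s i)\<^sup>2"
  have H: "0 \<le> ?H" and T: "0 \<le> ?T" by (simp_all add: sum_nonneg)
  have tail: "(\<Sum>i = k + 1..d. s i powr p) \<le> real (d - k) powr (1 - p / 2) * ?T powr (p / 2)"
    using power_mean_le[of "{k + 1..d}" s p] s p by simp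
  have "?H powr (p / 2) \<le> \<gamma> / real k powr (1 - p / 2) * (real (d - k) powr (1 - p / 2) * ?T powr (p / 2))"
    using nsp tail \<gamma> by (elim order.trans) (intro mult_left_mono, auto)
  also have "\<dots> = \<gamma> * (real (d - k) / real k) powr (1 - p / 2) * ?T powr (p / 2)"
    by (simp add: powr_divide)
  finally have "(?H powr (p / 2)) powr (2 / p)
      \<le> (\<gamma> * (real (d - k) / real k) powr (1 - p / 2) * ?T powr (p / 2)) powr (2 / p)"
    using p by (intro powr_mono2) auto
  also have "\<dots> = \<gamma> powr (2 / p) * (real (d - k) / real k) powr ((1 - p / 2) * (2 / p)) * ?T"
    using \<gamma> p T by (simp add: powr_mult powr_powr)
  also have "(1 - p / 2) * (2 / p) = 2 / p - 1" using p by (simp add: field_simps)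
  also have "(?H powr (p / 2)) powr (2 / p) = ?H" using p H by (simp add: powr_powr)
  finally show ?thesis .
qed

lemma schatten_le_tail:
  "(\<Sum>i = 1..d. s i powr p) powr (1 / p)
    \<le> (1 + \<gamma>) powr (1 / p) * real (d - k) powr (1 / p - 1 / 2) * sqrt (\<Sum>i = k + 1..d. (s i)\<^sup>2)"
proof -
  let ?H = "\<Sum>i = 1..k. (s i)\<^sup>2" and ?T = "\<Sum>i = k + 1..d. (s i)\<^sup>2"
  let ?Tp = "\<Sum>i = k + 1..d. s i powr p"
  have T: "0 \<le> ?T" by (simp add: sum_nonneg)
  have Tp: "0 \<le> ?Tp" by (simp add: sum_nonneg)
  have tail: "?Tp \<le> real (d - k) powr (1 - p / 2) * ?T powr (p / 2)"
    using power_mean_le[of "{k + 1..d}" s p] s p by simp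
  have "(\<Sum>i = 1..k. s i powr p) \<le> real k powr (1 - p / 2) * ?H powr (p / 2)"
    using power_mean_le[of "{1..k}" s p] s p by simp
  also have "\<dots> \<le> real k powr (1 - p / 2) * (\<gamma> / real k powr (1 - p / 2) * ?Tp)"
    using nsp by (intro mult_left_mono) auto
  also have "\<dots> = \<gamma> * ?Tp" using k by simp
  finally have head: "(\<Sum>i = 1..k. s i powr p) \<le> \<gamma> * ?Tp" .
  have "(\<Sum>i = 1..d. s i powr p) = (\<Sum>i = 1..k. s i powr p) + ?Tp"
    using k sum.ub_add_nat[of 1 k "\<lambda>i. s i powr p" "d - k"] by simp
  also have "\<dots> \<le> (1 + \<gamma>) * ?Tp" using head by (simp add: algebra_simps)
  also have "\<dots> \<le> (1 + \<gamma>) * (real (d - k) powr (1 - p / 2) * ?T powr (p / 2))"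
    using tail \<gamma> by (intro mult_left_mono) auto
  finally have "(\<Sum>i = 1..d. s i powr p) powr (1 / p)
      \<le> ((1 + \<gamma>) * (real (d - k) powr (1 - p / 2) * ?T powr (p / 2))) powr (1 / p)"
    using p by (intro powr_mono2) (auto simp: sum_nonneg)
  also have "\<dots> = (1 + \<gamma>) powr (1 / p) * (real (d - k) powr ((1 - p / 2) * (1 / p)) * ?T powr (1 / 2))"
    using \<gamma> p T by (simp add: powr_mult powr_powr)
  also have "(1 - p / 2) * (1 / p) = 1 / p - 1 / 2" using p by (simp add: field_simps)
  also have "?T powr (1 / 2) = sqrt ?T" using T by (simp add: powr_half_sqrt)
  finally show ?thesis by (simp add: mult.assoc)
qed

lemma head_le_sum:
  assumes B: "(\<Sum>i = k + 1..d. s i powr p) \<le> B"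
  shows "sqrt (\<Sum>i = 1..k. (s i)\<^sup>2) \<le> \<gamma> powr (1 / p) * real k powr (1 / 2 - 1 / p) * B powr (1 / p)"
proof -
  let ?H = "\<Sum>i = 1..k. (s i)\<^sup>2"
  have H: "0 \<le> ?H" by (simp add: sum_nonneg)
  have B0: "0 \<le> B" using B by (rule order.trans[rotated]) (simp add: sum_nonneg)
  have "?H powr (p / 2) \<le> \<gamma> / real k powr (1 - p / 2) * B"
    using nsp B \<gamma> by (elim order.trans) (intro mult_left_mono, auto)
  also have "\<dots> = \<gamma> * real k powr (p / 2 - 1) * B"
    using powr_minus_divide[of "real k" "1 - p / 2"] by simp
  finally have "(?H powr (p / 2)) powr (1 / p) \<le> (\<gamma> * real k powr (p / 2 - 1) * B) powr (1 / p)"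
    using p by (intro powr_mono2) auto
  also have "\<dots> = \<gamma> powr (1 / p) * real k powr ((p / 2 - 1) * (1 / p)) * B powr (1 / p)"
    using \<gamma> p B0 by (simp add: powr_mult powr_powr)
  also have "(p / 2 - 1) * (1 / p) = 1 / 2 - 1 / p" using p by (simp add: field_simps)
  also have "(?H powr (p / 2)) powr (1 / p) = sqrt ?H" using p H by (simp add: powr_powr powr_half_sqrt)
  finally show ?thesis .
qed

end

text \<open>Replace all entries on the left and right by the middle value \<open>s k\<close>. The strict inequality rules
  out \<open>s k = 0\<close>. The resulting lower bound on the dimension ratio is what lets powers of that ratio be
  traded freely when the constants are compared.\<close>

lemma strict_nsp_dimension:
  fixes s :: "nat \<Rightarrow> real"
  assumes s: "\<And>i. 0 \<le> s i" and mono: "\<And>i j. 1 \<le> i \<Longrightarrow> i \<le> j \<Longrightarrow> s j \<le> s i"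
    and p: "0 < p" "p \<le> 1" and k: "1 \<le> k" and \<gamma>: "0 < \<gamma>"
    and nsp: "(\<Sum>i = 1..k. (s i)\<^sup>2) powr (p / 2)
      < \<gamma> / real k powr (1 - p / 2) * (\<Sum>i = k + 1..d. s i powr p)"
  shows "real k < \<gamma> * real (d - k)"
proof -
  let ?Tp = "\<Sum>i = k + 1..d. s i powr p"
  have "real k * (s k)\<^sup>2 = (\<Sum>i = 1..k. (s k)\<^sup>2)" by simp
  also have "\<dots> \<le> (\<Sum>i = 1..k. (s i)\<^sup>2)" using s mono by (intro sum_mono power_mono) auto
  finally have "(real k * (s k)\<^sup>2) powr (p / 2) \<le> (\<Sum>i = 1..k. (s i)\<^sup>2) powr (p / 2)"
    using p by (intro powr_mono2) auto
  moreover have "(real k * (s k)\<^sup>2) powr (p / 2) = real k powr (p / 2) * s k powr p"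
    using s[of k] p by (cases "s k = 0") (simp_all add: powr_mult powr_powr flip: powr_numeral)
  moreover have "?Tp \<le> (\<Sum>i = k + 1..d. s k powr p)"
    using s mono p k by (intro sum_mono powr_mono2) auto
  then have "?Tp \<le> real (d - k) * s k powr p" by simp
  then have "\<gamma> / real k powr (1 - p / 2) * ?Tp \<le> \<gamma> / real k powr (1 - p / 2) * (real (d - k) * s k powr p)"
    using \<gamma> by (intro mult_left_mono) auto
  ultimately have "real k powr (p / 2) * s k powr p < \<gamma> / real k powr (1 - p / 2) * (real (d - k) * s k powr p)"
    using nsp by linarith
  then have "real k powr (1 - p / 2) * (real k powr (p / 2) * s k powr p) < \<gamma> * real (d - k) * s k powr p"
    using k by (simp add: field_simps)
  moreover have "real k powr (1 - p / 2) * (real k powr (p / 2) * s k powr p) = real k * s k powr p"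
    using k by (simp add: mult.assoc[symmetric] powr_add[symmetric])
  ultimately have "real k * s k powr p < \<gamma> * real (d - k) * s k powr p" by simp
  then show ?thesis using mult_less_cancel_right_disj[of "real k" "s k powr p"] powr_ge_zero[of "s k" p]
    by (simp add: not_less[symmetric])
qed


text \<open>The contraction constant enters only through this lower bound. With \<open>A\<close> the dimension ratio, its
  base satisfies \<open>B * Q \<ge> 6 (1 + \<gamma>) A\<close>: a factor 3 comes from \<open>(3 + \<gamma>) / (1 - \<gamma>) \<ge> 3\<close>, a factor 2
  from the denominator \<open>2 r\<close> of \<open>A\<close>. The exponent \<open>q = 2 / p - 1\<close> is at least 1, so \<open>6 powr q \<ge> 6\<close>, and
  \<open>192 = 32 * 6\<close>.\<close>

lemma contraction_constant_lower_bound: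
  fixes p \<gamma> \<sigma> \<kappa> \<zeta> :: real and d r :: nat
  assumes p: "0 < p" "p \<le> 1" and \<gamma>: "0 < \<gamma>" "\<gamma> < 1" and r: "1 \<le> r" "2 * r \<le> d"
    and \<sigma>: "0 < \<sigma>" and \<kappa>: "0 < \<kappa>" and \<zeta>: "\<zeta> < 1"
  defines "\<mu> \<equiv> 2 powr (5 * p) * (1 + \<gamma>) powr p
          * (\<gamma> * (3 + \<gamma>) * (1 + \<gamma>) / (1 - \<gamma>)) powr (2 - p)
          * (real (d - r) / real r) powr (2 - p / 2) * real r powr p
          * (\<sigma> powr (p * (p - 1)) / (1 - \<zeta>) powr (2 * p)) * \<kappa> powr p"
  shows "0 < \<mu>" and "192 * (1 + \<gamma>) powr (2 / p) * sqrt (real (d - r) / real r) * real r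
      * ((\<gamma> * real (d - 2 * r) / real (2 * r)) powr (2 / p - 1) * (\<kappa> * \<sigma> powr (p - 1) / (1 - \<zeta>)\<^sup>2))
    \<le> \<mu> powr (1 / p)"
proof -
  define q where "q = 2 / p - 1"
  define Q where "Q = real (d - r) / real r"
  define B where "B = \<gamma> * (3 + \<gamma>) * (1 + \<gamma>) / (1 - \<gamma>)"
  define A where "A = \<gamma> * real (d - 2 * r) / real (2 * r)"
  have q: "1 \<le> q" using p by (simp add: q_def field_simps)
  have Q: "0 < Q" using r by (simp add: Q_def)
  have B: "0 < B" using \<gamma> by (simp add: B_def)
  have z: "0 < 1 - \<zeta>" using \<zeta> by simp
  have A0: "0 \<le> A" using \<gamma> by (simp add: A_def)
  have \<mu>: "\<mu> = 2 powr (5 * p) * (1 + \<gamma>) powr p * B powr (2 - p) * Q powr (2 - p / 2) * real r powr p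
          * (\<sigma> powr (p * (p - 1)) / (1 - \<zeta>) powr (2 * p)) * \<kappa> powr p"
    by (simp only: \<mu>_def B_def Q_def)
  show "0 < \<mu>" unfolding \<mu> using \<gamma> B Q r \<sigma> z \<kappa> by (simp add: zero_less_mult_iff zero_less_divide_iff)
  have e1: "(2 - p) * (1 / p) = q" "(2 - p / 2) * (1 / p) = q + 1 / 2" "p * (p - 1) * (1 / p) = p - 1"
    "5 * p * (1 / p) = 5" "2 * p * (1 / p) = 2" "p * (1 / p) = 1"
    using p by (simp_all add: q_def field_simps)
  have "\<mu> powr (1 / p) = 2 powr 5 * (1 + \<gamma>) powr 1 * B powr q * Q powr (q + 1 / 2) * real r powr 1
          * (\<sigma> powr (p - 1) / (1 - \<zeta>) powr 2) * \<kappa> powr 1"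
    unfolding \<mu> using \<gamma> B Q r \<sigma> z \<kappa>
    by (simp only: powr_mult powr_divide powr_powr e1 powr_ge_zero)
  also have "\<dots> = 32 * (1 + \<gamma>) * (B powr q * Q powr q) * sqrt Q * real r
          * (\<kappa> * \<sigma> powr (p - 1) / (1 - \<zeta>)\<^sup>2)"
    using \<gamma> Q r z \<kappa> by (simp add: powr_add powr_half_sqrt)
  finally have root: "\<mu> powr (1 / p) = 32 * (1 + \<gamma>) * (B powr q * Q powr q) * sqrt Q * real r
          * (\<kappa> * \<sigma> powr (p - 1) / (1 - \<zeta>)\<^sup>2)" .
  have "6 * (1 + \<gamma>) * A \<le> B * Q"
  proof -
    have "2 * A \<le> \<gamma> * Q"
    proof -
      have "real (d - 2 * r) \<le> real (d - r)" by simp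
      then have "\<gamma> * real (d - 2 * r) / real r \<le> \<gamma> * real (d - r) / real r"
        using \<gamma> by (intro divide_right_mono mult_left_mono) auto
      then show ?thesis by (simp add: A_def Q_def)
    qed
    moreover have "3 * (1 + \<gamma>) * \<gamma> \<le> B"
    proof -
      have "3 * (1 + \<gamma>) * \<gamma> * (1 - \<gamma>) \<le> \<gamma> * (3 + \<gamma>) * (1 + \<gamma>)"
      proof -
        have "3 * (1 - \<gamma>) \<le> 3 + \<gamma>" using \<gamma> by simp
        then have "(\<gamma> * (1 + \<gamma>)) * (3 * (1 - \<gamma>)) \<le> (\<gamma> * (1 + \<gamma>)) * (3 + \<gamma>)"
          using \<gamma> by (intro mult_left_mono) auto
        then show ?thesis by (simp add: algebra_simps)
      qed
      then show ?thesis using \<gamma> by (simp add: B_def pos_le_divide_eq)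
    qed
    then have "3 * (1 + \<gamma>) * \<gamma> * Q \<le> B * Q" using Q by (intro mult_right_mono) auto
    moreover have "3 * (1 + \<gamma>) * (2 * A) \<le> 3 * (1 + \<gamma>) * (\<gamma> * Q)"
      using calculation(1) \<gamma> by (intro mult_left_mono) auto
    ultimately show ?thesis by (simp add: mult_ac)
  qed
  then have "(6 * (1 + \<gamma>) * A) powr q \<le> (B * Q) powr q" using A0 \<gamma> q by (intro powr_mono2) auto
  moreover have "6 * ((1 + \<gamma>) powr q * A powr q) \<le> (6 * (1 + \<gamma>) * A) powr q"
  proof -
    have "6 powr 1 \<le> 6 powr q" using q by (intro powr_mono) auto
    then have "6 * ((1 + \<gamma>) powr q * A powr q) \<le> 6 powr q * ((1 + \<gamma>) powr q * A powr q)"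
      by (intro mult_right_mono) auto
    then show ?thesis using \<gamma> A0
      by (simp add: powr_mult mult.assoc del: distrib_left_numeral)
  qed
  ultimately have le: "6 * ((1 + \<gamma>) powr q * A powr q) \<le> B powr q * Q powr q"
    using B Q by (simp add: powr_mult)
  have "192 * (1 + \<gamma>) powr (2 / p) * sqrt Q * real r * (A powr q * (\<kappa> * \<sigma> powr (p - 1) / (1 - \<zeta>)\<^sup>2))
      = 32 * (1 + \<gamma>) * (6 * ((1 + \<gamma>) powr q * A powr q)) * sqrt Q * real r
          * (\<kappa> * \<sigma> powr (p - 1) / (1 - \<zeta>)\<^sup>2)"
  proof -
    have "2 / p = q + 1" by (simp add: q_def)
    then have "(1 + \<gamma>) powr (2 / p) = (1 + \<gamma>) powr q * (1 + \<gamma>)" using \<gamma> by (simp add: powr_add)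
    then show ?thesis by (simp add: mult_ac)
  qed
  also have "\<dots> \<le> \<mu> powr (1 / p)"
    unfolding root using le \<gamma> Q \<kappa> by (intro mult_right_mono mult_left_mono) auto
  finally show "192 * (1 + \<gamma>) powr (2 / p) * sqrt (real (d - r) / real r) * real r
      * ((\<gamma> * real (d - 2 * r) / real (2 * r)) powr (2 / p - 1) * (\<kappa> * \<sigma> powr (p - 1) / (1 - \<zeta>)\<^sup>2))
    \<le> \<mu> powr (1 / p)"
    unfolding Q_def A_def q_def .
qed

text \<open>The real arithmetic of one step. Here \<open>y\<close> is the tail of the new error, \<open>A\<close> the dimension ratio
  \<open>\<gamma> (d - 2 r) / (2 r)\<close>, \<open>R\<close> the ratio \<open>(d - r) / r\<close>, and \<open>192 * sqrt R * r * K\<close> is below the root of the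
  contraction constant. The first claim keeps the full power of \<open>e\<close>; the second spends a factor
  \<open>e powr (1 - p)\<close> on the contraction hypothesis and keeps a factor \<open>\<epsilon>\<close>.\<close>

lemma error_recursion:
  fixes p \<gamma> \<sigma> \<zeta> e \<epsilon> A s1 y G K R :: real and r :: nat
  assumes p: "0 < p" "p \<le> 1" and \<gamma>: "0 < \<gamma>" "\<gamma> < 1" and r: "1 \<le> r" and \<sigma>: "0 < \<sigma>" "\<sigma> \<le> s1"
    and \<zeta>: "0 < \<zeta>" "\<zeta> < 1" and e: "0 < e" "e \<le> \<zeta> * \<sigma>" and \<epsilon>: "0 < \<epsilon>" "\<epsilon> \<le> e"
    and A: "1 \<le> A" "A \<le> R"
    and G: "G = sqrt \<gamma> * A powr (1 / p - 1 / 2)"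
    and K: "K = A powr (2 / p - 1) * (s1 / \<sigma> * \<sigma> powr (p - 1) / (1 - \<zeta>)\<^sup>2)"
    and y: "0 \<le> y" "y \<le> sqrt (real r) * (6 * G * s1 * \<epsilon> powr (2 - p) / ((1 - \<zeta>) * \<sigma>) powr (2 - p)
        + 16 * e\<^sup>2 / \<sigma>)"
  shows "A powr (1 / p - 1 / 2) * y \<le> 22 * sqrt (real r) * K * e powr (2 - p)"
    and "192 * sqrt R * real r * K * e powr (1 - p) < 1 \<Longrightarrow>
      e \<le> A powr (1 / p) * sqrt (2 * real r) * \<epsilon> \<Longrightarrow> G * y \<le> \<epsilon>"
proof -
  define a where "a = A powr (1 / p - 1 / 2)"
  define J where "J = s1 / \<sigma> * \<sigma> powr (p - 1) / (1 - \<zeta>)\<^sup>2"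
  have s1: "0 < s1" using \<sigma> by simp
  have z: "0 < 1 - \<zeta>" "1 - \<zeta> \<le> 1" using \<zeta> by auto
  have J0: "0 \<le> J" using s1 \<sigma> by (simp add: J_def)
  have "A powr 0 \<le> a" unfolding a_def using A p by (intro powr_mono) (auto simp: field_simps)
  then have a1: "1 \<le> a" using A by simp
  have aa: "a * a = A powr (2 / p - 1)" unfolding a_def by (simp add: powr_add[symmetric])
  have sg: "0 < sqrt \<gamma>" "sqrt \<gamma> \<le> 1" using \<gamma> by auto
  have G0: "0 \<le> G" unfolding G using sg by simp
  have Ga: "G \<le> a" unfolding G a_def[symmetric] using mult_right_mono[OF sg(2), of a] a1 by simp
  have GG: "G * G \<le> a * a" by (rule mult_mono[OF Ga Ga]) (use a1 G0 in auto)
  have KJ: "K = a * a * J" by (simp add: K aa J_def)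
  have e\<sigma>: "e \<le> \<sigma>" using e(2) \<zeta> \<sigma> by (smt (verit) mult_left_le_one_le)
  have first: "s1 / ((1 - \<zeta>) * \<sigma>) powr (2 - p) \<le> J"
  proof -
    have "(1 - \<zeta>) powr 2 \<le> (1 - \<zeta>) powr (2 - p)" using z p by (intro powr_mono') auto
    then have zz: "(1 - \<zeta>)\<^sup>2 \<le> (1 - \<zeta>) powr (2 - p)" using z by simp
    have "s1 / ((1 - \<zeta>) * \<sigma>) powr (2 - p) = s1 / \<sigma> * \<sigma> powr (p - 1) / (1 - \<zeta>) powr (2 - p)"
    proof -
      have v: "\<sigma> powr (p - 1) * \<sigma> powr (2 - p) = \<sigma>" using \<sigma> by (simp add: powr_add[symmetric])
      have "0 < \<sigma> powr (2 - p)" using \<sigma> by simp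
      then have "s1 / \<sigma> * \<sigma> powr (p - 1) = s1 / \<sigma> powr (2 - p)"
        using \<sigma>(1) arg_cong[OF v, of "\<lambda>x. s1 * x"] by (simp add: field_simps)
      moreover have "((1 - \<zeta>) * \<sigma>) powr (2 - p) = \<sigma> powr (2 - p) * (1 - \<zeta>) powr (2 - p)"
        using z \<sigma> by (simp only: powr_mult mult.commute)
      ultimately show ?thesis by (simp only: divide_divide_eq_left)
    qed
    also have "\<dots> \<le> J" unfolding J_def using zz z s1 \<sigma> by (intro divide_left_mono) auto
    finally show ?thesis .
  qed
  have \<sigma>J: "\<sigma> powr (p - 1) \<le> J"
  proof -
    have "(1 - \<zeta>)\<^sup>2 \<le> 1" using z by (simp add: power_le_one)
    moreover have "\<sigma> powr (p - 1) \<le> s1 / \<sigma> * \<sigma> powr (p - 1)"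
      using mult_right_mono[of 1 "s1 / \<sigma>" "\<sigma> powr (p - 1)"] \<sigma> by simp
    ultimately show ?thesis
      unfolding J_def using z s1 \<sigma> by (simp add: pos_le_divide_eq) (smt (verit) mult_left_le powr_ge_zero)
  qed
  have \<sigma>p: "\<sigma> powr p / \<sigma> = \<sigma> powr (p - 1)" using \<sigma> by (simp add: powr_diff)
  have e_over: "e / \<sigma> \<le> J * e powr (1 - p)"
  proof -
    have "e = e powr (1 - p) * e powr p" using e(1) by (simp add: powr_add[symmetric])
    also have "\<dots> \<le> e powr (1 - p) * \<sigma> powr p" using e\<sigma> e(1) p by (intro mult_left_mono powr_mono2) auto
    finally have "e / \<sigma> \<le> e powr (1 - p) * \<sigma> powr p / \<sigma>" using \<sigma> by (intro divide_right_mono) auto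
    also have "\<dots> = \<sigma> powr (p - 1) * e powr (1 - p)" unfolding \<sigma>p[symmetric] by simp
    also have "\<dots> \<le> J * e powr (1 - p)" using \<sigma>J by (intro mult_right_mono) auto
    finally show ?thesis .
  qed
  have second: "e\<^sup>2 / \<sigma> \<le> J * e powr (2 - p)"
  proof -
    have "e\<^sup>2 / \<sigma> = e * (e / \<sigma>)" by (simp add: power2_eq_square)
    also have "\<dots> \<le> e * (J * e powr (1 - p))" using e_over e(1) by (intro mult_left_mono) auto
    also have "\<dots> = J * (e powr 1 * e powr (1 - p))" using e(1) by simp
    also have "e powr 1 * e powr (1 - p) = e powr (2 - p)" by (simp only: powr_add[symmetric]) simp
    finally show ?thesis .
  qed
  have y': "y \<le> sqrt (real r) * (6 * G * (J * \<epsilon> powr (2 - p)) + 16 * (e\<^sup>2 / \<sigma>))"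
  proof -
    have "6 * G * s1 * \<epsilon> powr (2 - p) / ((1 - \<zeta>) * \<sigma>) powr (2 - p)
        = 6 * G * (s1 / ((1 - \<zeta>) * \<sigma>) powr (2 - p) * \<epsilon> powr (2 - p))" by simp
    also have "\<dots> \<le> 6 * G * (J * \<epsilon> powr (2 - p))"
      using first G0 by (intro mult_left_mono mult_right_mono) auto
    finally show ?thesis using y(2) by (elim order.trans) (intro mult_left_mono, auto)
  qed
  show "A powr (1 / p - 1 / 2) * y \<le> 22 * sqrt (real r) * K * e powr (2 - p)"
  proof -
    have "\<epsilon> powr (2 - p) \<le> e powr (2 - p)" using \<epsilon> p by (intro powr_mono2) auto
    then have "J * \<epsilon> powr (2 - p) \<le> J * e powr (2 - p)" using J0 by (intro mult_left_mono) auto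
    then have "6 * G * (J * \<epsilon> powr (2 - p)) \<le> 6 * a * (J * e powr (2 - p))"
      by (rule mult_mono[rotated]) (use Ga G0 a1 J0 in auto)
    moreover have "16 * (e\<^sup>2 / \<sigma>) \<le> 16 * a * (J * e powr (2 - p))"
    proof -
      have "e\<^sup>2 / \<sigma> \<le> 1 * (J * e powr (2 - p))" using second by simp
      also have "\<dots> \<le> a * (J * e powr (2 - p))" using a1 J0 by (intro mult_right_mono) auto
      finally show ?thesis by simp
    qed
    ultimately have "6 * G * (J * \<epsilon> powr (2 - p)) + 16 * (e\<^sup>2 / \<sigma>) \<le> 22 * a * (J * e powr (2 - p))" by simp
    then have "y \<le> sqrt (real r) * (22 * a * (J * e powr (2 - p)))"
      using y' by (elim order.trans) (intro mult_left_mono, auto)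
    then have "a * y \<le> a * (sqrt (real r) * (22 * a * (J * e powr (2 - p))))"
      using a1 by (intro mult_left_mono) auto
    then show ?thesis by (simp add: KJ a_def[symmetric] mult_ac)
  qed
  assume contr: "192 * sqrt R * real r * K * e powr (1 - p) < 1"
    and low: "e \<le> A powr (1 / p) * sqrt (2 * real r) * \<epsilon>"
  have K0: "0 \<le> K" using KJ J0 a1 by simp
  define P where "P = sqrt R * real r * K * e powr (1 - p)"
  have P0: "0 \<le> P" unfolding P_def using K0 A by simp
  have P192: "192 * P < 1" using contr by (simp add: P_def mult_ac)
  have R1: "1 \<le> sqrt R" using A by simp
  have r1: "sqrt (real r) \<le> real r"
    using r by (intro real_le_lsqrt) (auto simp: power2_eq_square)
  have part1: "G * (sqrt (real r) * (6 * G * (J * \<epsilon> powr (2 - p)))) \<le> 6 * P * \<epsilon>"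
  proof -
    have "\<epsilon> powr (2 - p) = \<epsilon> powr (1 - p) * \<epsilon>"
      using \<epsilon>(1) powr_add[of \<epsilon> "1 - p" 1] by simp
    also have "\<dots> \<le> e powr (1 - p) * \<epsilon>" using \<epsilon> p by (intro mult_right_mono powr_mono2) auto
    finally have ee: "\<epsilon> powr (2 - p) \<le> e powr (1 - p) * \<epsilon>" .
    have "G * (sqrt (real r) * (6 * G * (J * \<epsilon> powr (2 - p)))) = 6 * (sqrt (real r) * ((G * G) * (J * \<epsilon> powr (2 - p))))"
      by (simp add: mult_ac)
    also have "\<dots> \<le> 6 * (real r * ((a * a) * (J * (e powr (1 - p) * \<epsilon>))))"
      using r1 Ga ee J0 G0 a1 \<epsilon> by (intro mult_left_mono mult_mono) auto
    also have "\<dots> = 6 * (1 * (real r * K * e powr (1 - p) * \<epsilon>))" by (simp add: KJ mult_ac)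
    also have "\<dots> \<le> 6 * (sqrt R * (real r * K * e powr (1 - p) * \<epsilon>))"
      using R1 K0 \<epsilon> by (intro mult_left_mono mult_right_mono) auto
    finally show ?thesis by (simp add: P_def mult_ac)
  qed
  have part2: "G * (sqrt (real r) * (16 * (e\<^sup>2 / \<sigma>))) \<le> 32 * P * \<epsilon>"
  proof -
    have Ap: "A powr (1 / p) = a * sqrt A"
      using A by (simp add: a_def powr_half_sqrt[symmetric] powr_add[symmetric])
    have "sqrt A \<le> sqrt R" using A by simp
    then have e_low: "e \<le> a * sqrt R * sqrt (2 * real r) * \<epsilon>"
      using low a1 \<epsilon> unfolding Ap by (elim order.trans) (intro mult_right_mono mult_left_mono, auto)
    have "e\<^sup>2 / \<sigma> = e * (e / \<sigma>)" by (simp add: power2_eq_square)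
    also have "\<dots> \<le> (a * sqrt R * sqrt (2 * real r) * \<epsilon>) * (J * e powr (1 - p))"
      using e_low e_over e(1) \<sigma>(1) a1 \<epsilon> A by (intro mult_mono) auto
    finally have "G * (sqrt (real r) * (16 * (e\<^sup>2 / \<sigma>)))
        \<le> a * (sqrt (real r) * (16 * ((a * sqrt R * sqrt (2 * real r) * \<epsilon>) * (J * e powr (1 - p)))))"
      using Ga G0 a1 e(1) \<sigma>(1) by (intro mult_mono mult_left_mono) auto
    also have "\<dots> = 16 * sqrt 2 * P * \<epsilon>"
    proof -
      have "sqrt (real r) * sqrt (2 * real r) = sqrt 2 * real r" by (simp add: real_sqrt_mult)
      then have "a * (sqrt (real r) * (16 * ((a * sqrt R * sqrt (2 * real r) * \<epsilon>) * (J * e powr (1 - p)))))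
         = 16 * (sqrt 2 * real r) * (a * a * J) * sqrt R * \<epsilon> * e powr (1 - p)"
        by (simp add: mult_ac)
      then show ?thesis by (simp add: P_def KJ mult_ac)
    qed
    also have "\<dots> \<le> 32 * P * \<epsilon>"
    proof -
      have "sqrt 2 \<le> sqrt (2\<^sup>2)" by (intro real_sqrt_le_mono) simp
      then have "16 * sqrt 2 \<le> 32" by simp
      then show ?thesis using P0 \<epsilon> by (intro mult_right_mono) auto
    qed
    finally show ?thesis .
  qed
  have "G * y \<le> G * (sqrt (real r) * (6 * G * (J * \<epsilon> powr (2 - p)) + 16 * (e\<^sup>2 / \<sigma>)))"
    using y' G0 by (intro mult_left_mono) auto
  also have "\<dots> \<le> 6 * P * \<epsilon> + 32 * P * \<epsilon>" using part1 part2 by (simp add: distrib_left)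
  also have "\<dots> = (38 * P) * \<epsilon>" by simp
  also have "\<dots> \<le> 1 * \<epsilon>" using P192 P0 \<epsilon> by (intro mult_right_mono) auto
  finally show "G * y \<le> \<epsilon>" by simp
qed

section \<open>The algorithm\<close>

lemma singular_value_zero_mat: "singular_value (0\<^sub>m d1 d2) i = 0"
proof (cases i)
  case 0
  then show ?thesis by (simp add: singular_value_def)
next
  case (Suc k)
  have "singular_value (0\<^sub>m d1 d2) (Suc 0) \<le> 0"
  proof (rule singular_value_minimax[where C = "\<lambda>_. 0\<^sub>v d2"])
    fix x :: "complex vec" assume x: "x \<in> carrier_vec d2"
    have "0\<^sub>m d1 d2 *\<^sub>v x = 0\<^sub>v d1" using x by (intro eq_vecI) auto
    then show "vnorm (0\<^sub>m d1 d2 *\<^sub>v x) \<le> 0 * vnorm x" using vnorm_eq_0_iff[of "0\<^sub>v d1" d1] by simp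
  qed auto
  then have "singular_value (0\<^sub>m d1 d2) (Suc k) = 0"
    using singular_value_antimono[of 0 k "0\<^sub>m d1 d2"] singular_value_nonneg[of "0\<^sub>m d1 d2" "Suc k"]
    by linarith
  then show ?thesis using Suc by simp
qed

lemma linear_measurementD:
  assumes "linear_measurement d1 d2 m \<Phi>" and A: "A \<in> carrier_mat d1 d2" and B: "B \<in> carrier_mat d1 d2"
  shows "\<Phi> A \<in> carrier_vec m" "\<Phi> (A + B) = \<Phi> A + \<Phi> B" "\<Phi> (c \<cdot>\<^sub>m A) = c \<cdot>\<^sub>v \<Phi> A"
proof -
  interpret linear_map class_ring "module_mat TYPE(complex) d1 d2" "module_vec TYPE(complex) m" \<Phi>
    by (rule assms(1))
  show "\<Phi> A \<in> carrier_vec m" using A f_im by (auto simp: module_mat_simps module_vec_simps)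
  show "\<Phi> (A + B) = \<Phi> A + \<Phi> B" using f_add[of A B] A B by (simp add: module_mat_simps module_vec_simps)
  show "\<Phi> (c \<cdot>\<^sub>m A) = c \<cdot>\<^sub>v \<Phi> A" using f_smult[of c A] A by (simp add: module_mat_simps module_vec_simps)
qed

lemma linear_measurement_diff:
  assumes \<Phi>: "linear_measurement d1 d2 m \<Phi>" and A: "A \<in> carrier_mat d1 d2" and B: "B \<in> carrier_mat d1 d2"
    and eq: "\<Phi> A = \<Phi> B"
  shows "\<Phi> (A - B) = 0\<^sub>v m"
proof -
  have AB: "A - B = A + (- 1) \<cdot>\<^sub>m B" using A B by (intro eq_matI) auto
  have "(- 1) \<cdot>\<^sub>m B \<in> carrier_mat d1 d2" using B by simp
  then have "\<Phi> (A - B) = \<Phi> B + (- 1) \<cdot>\<^sub>v \<Phi> B"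
    unfolding AB using linear_measurementD[OF \<Phi> A] linear_measurementD[OF \<Phi> B A] eq by simp
  then show ?thesis using linear_measurementD(1)[OF \<Phi> B A] by (intro eq_vecI) auto
qed

lemma strong_schatten_nspD:
  assumes \<Phi>: "linear_measurement d1 d2 m \<Phi>" and nsp: "strong_schatten_nsp d1 d2 m \<Phi> p k \<gamma>"
    and H: "H \<in> carrier_mat d1 d2" "\<Phi> H = 0\<^sub>v m" "H \<noteq> 0\<^sub>m d1 d2"
  shows "(\<Sum>i = 1..k. (singular_value H i)\<^sup>2) powr (p / 2)
          < \<gamma> / real k powr (1 - p / 2) * (\<Sum>i = k + 1..min d1 d2. singular_value H i powr p)"
proof -
  have "H \<in> mod_hom.ker (module_mat TYPE(complex) d1 d2) (module_vec TYPE(complex) m) \<Phi>"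
  proof -
    interpret linear_map class_ring "module_mat TYPE(complex) d1 d2" "module_vec TYPE(complex) m" \<Phi>
      by (rule \<Phi>)
    show ?thesis using H by (simp add: ker_def module_mat_simps module_vec_simps)
  qed
  then show ?thesis using nsp H(3) unfolding strong_schatten_nsp_def by blast
qed

lemma nsp_sequence_kernel:
  assumes \<Phi>: "linear_measurement d1 d2 m \<Phi>" and nsp: "strong_schatten_nsp d1 d2 m \<Phi> p k \<gamma>"
    and H: "H \<in> carrier_mat d1 d2" "\<Phi> H = 0\<^sub>v m" and p: "0 < p" "p \<le> 1" and k: "1 \<le> k" "k \<le> min d1 d2"
  shows "nsp_sequence (singular_value H) k (min d1 d2) p \<gamma>"
proof (rule nsp_sequence.intro)
  show "0 < \<gamma>" "\<gamma> \<le> 1" using nsp by (simp_all add: strong_schatten_nsp_def)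
  show "(\<Sum>i = 1..k. (singular_value H i)\<^sup>2) powr (p / 2)
      \<le> \<gamma> / real k powr (1 - p / 2) * (\<Sum>i = k + 1..min d1 d2. singular_value H i powr p)"
  proof (cases "H = 0\<^sub>m d1 d2")
    case True
    then show ?thesis using p by (simp add: singular_value_zero_mat)
  next
    case False
    then show ?thesis using strong_schatten_nspD[OF \<Phi> nsp H] by simp
  qed
qed (use p k in auto)

lemma sum_tail_index:
  assumes H: "H \<in> carrier_mat d1 d2"
  shows "(\<Sum>i = k + 1..min d1 d2. (singular_value H i)\<^sup>2) = (\<Sum>j\<in>{k..<d2}. (singular_value H (Suc j))\<^sup>2)"
proof -
  have "(\<Sum>i = k + 1..min d1 d2. (singular_value H i)\<^sup>2)
      = (\<Sum>j\<in>{k..<min d1 d2}. (singular_value H (Suc j))\<^sup>2)"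
    by (rule sum.reindex_bij_witness[of _ Suc "\<lambda>i. i - 1"]) auto
  also have "\<dots> = (\<Sum>j\<in>{k..<d2}. (singular_value H (Suc j))\<^sup>2)"
    by (rule sum.mono_neutral_left) (use H in \<open>auto simp: singular_value_beyond\<close>)
  finally show ?thesis .
qed

text \<open>The error differs from \<open>X\<close> by a matrix of rank \<open>r\<close>, so its singular values beyond \<open>2 r\<close> are
  dominated by those of \<open>X\<close> beyond \<open>r\<close>.\<close>

lemma error_tail_le:
  assumes X: "X \<in> carrier_mat d1 d2" and X0: "X0 \<in> carrier_mat d1 d2"
    and rank: "vec_space.rank d1 X0 = r" and i: "2 * r < i"
  shows "singular_value (X - X0) i \<le> singular_value X (r + 1)"
proof -
  define j where "j = i - 1 - r"
  have j: "i = Suc (r + j)" "r \<le> j" using i by (auto simp: j_def)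
  have "singular_value (X - X0) (Suc (r + j)) \<le> singular_value X (Suc j)"
    by (rule weyl_low_rank[OF minus_carrier_mat[OF X0] X X0 rank]) simp
  also have "\<dots> \<le> singular_value X (Suc r)" by (rule singular_value_antimono[OF j(2)])
  finally show ?thesis using j(1) by simp
qed

lemma trailing_value_le_error:
  assumes X: "X \<in> carrier_mat d1 d2" and X0: "X0 \<in> carrier_mat d1 d2"
    and rank: "vec_space.rank d1 X0 = r"
  shows "singular_value X (r + 1) \<le> singular_value (X - X0) 1"
proof -
  have "X - X0 + X0 = X" using X X0 by (intro eq_matI) auto
  then have "singular_value X (Suc (r + 0)) \<le> singular_value (X - X0) (Suc 0)"
    by (intro weyl_low_rank[OF X minus_carrier_mat[OF X0] X0 rank]) simp
  then show ?thesis by simp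
qed

lemma singular_value_1_le_head:
  "1 \<le> k \<Longrightarrow> singular_value H 1 \<le> sqrt (\<Sum>i = 1..k. (singular_value H i)\<^sup>2)"
proof (rule real_le_rsqrt)
  assume "1 \<le> k"
  then show "(singular_value H 1)\<^sup>2 \<le> (\<Sum>i = 1..k. (singular_value H i)\<^sup>2)"
    by (intro member_le_sum[of 1 "{1..k}" "\<lambda>i. (singular_value H i)\<^sup>2"]) auto
qed

text \<open>One iteration. The bound on the corner becomes a bound on the operator norm through the head of
  \<open>N\<close>, and on the Schatten norm through its tail. For the latter, the operator norm of the old error
  has to be bounded by its Schatten norm with the gain \<open>\<gamma> powr (1 / p) * k powr (1 / 2 - 1 / p)\<close> that
  the null space property gives; without this gain the dimension factor would be too large.\<close>

lemma hm_irls_step: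
  assumes p: "0 < p" "p \<le> 1" and r: "1 \<le> r" "2 * r \<le> min d1 d2"
    and \<Phi>: "linear_measurement d1 d2 m \<Phi>"
    and nsp: "strong_schatten_nsp d1 d2 m \<Phi> p (2 * r) \<gamma>" "\<gamma> < 1"
    and X0: "X0 \<in> carrier_mat d1 d2" "vec_space.rank d1 X0 = r" "\<Phi> X0 = Y"
    and X: "X \<in> carrier_mat d1 d2" "\<Phi> X = Y" and X': "X' \<in> carrier_mat d1 d2" "\<Phi> X' = Y"
    and svd: "full_svd X U S V"
    and min: "\<And>Z. Z \<in> carrier_mat d1 d2 \<Longrightarrow> \<Phi> Z = Y \<Longrightarrow>
      (weighted_norm (hm_weight X U V \<epsilon> p) (mat_vec X'))\<^sup>2 \<le> (weighted_norm (hm_weight X U V \<epsilon> p) (mat_vec Z))\<^sup>2"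
    and \<epsilon>: "0 < \<epsilon>" "\<epsilon> = singular_value X (r + 1)"
    and e: "e = singular_value (X - X0) 1" "e \<le> \<zeta> * \<sigma>" and \<zeta>: "0 < \<zeta>" "\<zeta> < 1"
    and \<sigma>: "\<sigma> = singular_value X0 r"
    and Q: "192 * (1 + \<gamma>) powr (2 / p) * sqrt (real (min d1 d2 - r) / real r) * real r
      * ((\<gamma> * real (min d1 d2 - 2 * r) / real (2 * r)) powr (2 / p - 1)
         * (singular_value X0 1 / \<sigma> * \<sigma> powr (p - 1) / (1 - \<zeta>)\<^sup>2)) \<le> Q"
    and contr: "Q * e powr (1 - p) < 1"
  shows "singular_value (X' - X0) 1 \<le> Q * e powr (2 - p)"
    and "schatten_norm p (X' - X0) \<le> Q * schatten_norm p (X - X0) powr (2 - p)"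
    and "singular_value X' (r + 1) \<le> \<epsilon>"
    and "singular_value (X' - X0) 1 \<le> e"
proof -
  define d where "d = min d1 d2"
  define k where "k = 2 * r"
  define R where "R = real (d - r) / real r"
  define A where "A = \<gamma> * real (d - k) / real k"
  define a where "a = A powr (1 / p - 1 / 2)"
  define G where "G = sqrt \<gamma> * a"
  define K where "K = A powr (2 / p - 1) * (singular_value X0 1 / \<sigma> * \<sigma> powr (p - 1) / (1 - \<zeta>)\<^sup>2)"
  define H where "H = X - X0"
  define N where "N = X' - X0"
  have \<gamma>: "0 < \<gamma>" using nsp(1) by (simp add: strong_schatten_nsp_def)
  have k: "1 \<le> k" "k \<le> d" using r by (auto simp: k_def d_def)
  have Hc: "H \<in> carrier_mat d1 d2" and Nc: "N \<in> carrier_mat d1 d2"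
    unfolding H_def N_def by (rule minus_carrier_mat[OF X0(1)])+
  have H0: "\<Phi> H = 0\<^sub>v m" unfolding H_def using X X0 by (intro linear_measurement_diff[OF \<Phi>]) auto
  have N0: "\<Phi> N = 0\<^sub>v m" unfolding N_def using X' X0 by (intro linear_measurement_diff[OF \<Phi>]) auto
  interpret H: nsp_sequence "singular_value H" k d p \<gamma>
    unfolding k_def d_def using r p by (intro nsp_sequence_kernel[OF \<Phi> nsp(1) Hc H0]) auto
  interpret N: nsp_sequence "singular_value N" k d p \<gamma>
    unfolding k_def d_def using r p by (intro nsp_sequence_kernel[OF \<Phi> nsp(1) Nc N0]) auto
  have \<epsilon>e: "\<epsilon> \<le> e" unfolding \<epsilon>(2) e(1) by (rule trailing_value_le_error[OF X(1) X0(1,2)])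
  then have e0: "0 < e" using \<epsilon>(1) by simp
  then have \<sigma>0: "0 < \<sigma>" using e(2) \<zeta> by (metis less_le_trans zero_less_mult_pos)
  have \<sigma>1: "\<sigma> \<le> singular_value X0 1" using singular_value_antimono[of 0 "r - 1" X0] r \<sigma> by simp
  have "H \<noteq> 0\<^sub>m d1 d2" using e0 e(1) singular_value_zero_mat[of d1 d2 1] by (auto simp: H_def)
  from strong_schatten_nspD[OF \<Phi> nsp(1) Hc H0 this]
  have "real k < \<gamma> * real (d - k)"
    unfolding k_def[symmetric] d_def[symmetric]
  proof (rule strict_nsp_dimension[rotated 2, OF p k(1) \<gamma>])
    show "singular_value H j \<le> singular_value H i" if "1 \<le> i" "i \<le> j" for i j
      using singular_value_antimono[of "i - 1" "j - 1" H] that by simp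
  qed simp
  then have A1: "1 \<le> A" using k by (simp add: A_def pos_le_divide_eq)
  have AR: "A \<le> R"
  proof -
    have "\<gamma> * real (d - k) \<le> 1 * real (d - r)" using nsp(2) \<gamma> by (intro mult_mono) (auto simp: k_def)
    then have "A \<le> real (d - r) / real k" unfolding A_def by (intro divide_right_mono) auto
    also have "\<dots> \<le> R" unfolding R_def using r by (intro divide_left_mono) (auto simp: k_def)
    finally show ?thesis .
  qed
  have a1: "1 \<le> a"
  proof -
    have "A powr 0 \<le> a" unfolding a_def using A1 p by (intro powr_mono) (auto simp: field_simps)
    then show ?thesis using A1 by simp
  qed
  have sg: "0 < sqrt \<gamma>" "sqrt \<gamma> \<le> 1" using \<gamma> nsp(2) by auto
  have G0: "0 \<le> G" using sg a1 by (simp add: G_def)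
  have Ga: "G \<le> a" unfolding G_def using mult_right_mono[OF sg(2), of a] a1 by simp
  have G2: "G\<^sup>2 = \<gamma> powr (2 / p) * (real (d - k) / real k) powr (2 / p - 1)"
  proof -
    have "a\<^sup>2 = A powr (2 / p - 1)" unfolding a_def power2_eq_square by (simp add: powr_add[symmetric])
    then have "G\<^sup>2 = \<gamma> * A powr (2 / p - 1)" using \<gamma> by (simp add: G_def power_mult_distrib)
    also have "A = \<gamma> * (real (d - k) / real k)" by (simp add: A_def)
    also have "\<gamma> * (\<gamma> * (real (d - k) / real k)) powr (2 / p - 1)
        = (\<gamma> powr 1 * \<gamma> powr (2 / p - 1)) * (real (d - k) / real k) powr (2 / p - 1)"
      using \<gamma> by (simp add: powr_mult powr_divide mult.assoc)
    also have "\<gamma> powr 1 * \<gamma> powr (2 / p - 1) = \<gamma> powr (2 / p)"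
      using powr_add[of \<gamma> 1 "2 / p - 1"] by simp
    finally show ?thesis .
  qed
  define T where "T = (\<Sum>i = k + 1..d. (singular_value N i)\<^sup>2)"
  define y where "y = sqrt T"
  have T0: "0 \<le> T" unfolding T_def by (simp add: sum_nonneg)
  have Tidx: "T = (\<Sum>j\<in>{2 * r..<d2}. (singular_value N (Suc j))\<^sup>2)"
    unfolding T_def d_def sum_tail_index[OF Nc] k_def ..
  have head: "(\<Sum>i = 1..k. (singular_value N i)\<^sup>2) \<le> G\<^sup>2 * T"
    unfolding G2 T_def by (rule N.head_le_tail)
  have headidx: "(\<Sum>i = 1..k. (singular_value N i)\<^sup>2) = (\<Sum>j<2 * r. (singular_value N (Suc j))\<^sup>2)"
    unfolding k_def by (simp add: sum.atLeast1_atMost_eq)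
  have ybound: "y \<le> sqrt (real r) * (6 * G * singular_value X0 1 * \<epsilon> powr (2 - p) / ((1 - \<zeta>) * \<sigma>) powr (2 - p)
        + 16 * e\<^sup>2 / \<sigma>)"
    unfolding y_def Tidx
  proof (rule corner_contraction[OF X(1) X0(1) X'(1) p r X0(2) svd \<epsilon> e \<zeta>(2) \<sigma> \<sigma>0 N_def _ G0])
    show "(\<Sum>j<2 * r. (singular_value N (Suc j))\<^sup>2) \<le> G\<^sup>2 * (\<Sum>j\<in>{2 * r..<d2}. (singular_value N (Suc j))\<^sup>2)"
      using head unfolding headidx Tidx .
  next
    fix t :: real
    have tN: "complex_of_real t \<cdot>\<^sub>m N \<in> carrier_mat d1 d2" using Nc by simp
    have "\<Phi> (X' + complex_of_real t \<cdot>\<^sub>m N) = Y + complex_of_real t \<cdot>\<^sub>v 0\<^sub>v m"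
      using linear_measurementD(2)[OF \<Phi> X'(1) tN] linear_measurementD(3)[OF \<Phi> Nc X'(1)] N0 X'(2) by simp
    also have "\<dots> = Y" using linear_measurementD(1)[OF \<Phi> X'(1) tN] X'(2) by auto
    finally show "(weighted_norm (hm_weight X U V \<epsilon> p) (mat_vec X'))\<^sup>2
        \<le> (weighted_norm (hm_weight X U V \<epsilon> p) (mat_vec (X' + complex_of_real t \<cdot>\<^sub>m N)))\<^sup>2"
      using X' tN by (intro min) auto
  qed
  have y0: "0 \<le> y" using T0 by (simp add: y_def)
  note rec = error_recursion[OF p \<gamma> nsp(2) r(1) \<sigma>0 \<sigma>1 \<zeta> e0 e(2) \<epsilon>(1) \<epsilon>e A1 AR G_def[unfolded a_def] K_def y0 ybound]
  have J0: "0 \<le> singular_value X0 1 / \<sigma> * \<sigma> powr (p - 1) / (1 - \<zeta>)\<^sup>2" using \<sigma>0 by simp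
  have K0: "0 \<le> K" unfolding K_def using J0 by (intro mult_nonneg_nonneg) auto
  have R1: "1 \<le> sqrt R" using A1 AR by simp
  have r1: "sqrt (real r) \<le> real r" using r by (intro real_le_lsqrt) (auto simp: power2_eq_square)
  have Q': "192 * (1 + \<gamma>) powr (2 / p) * sqrt R * real r * K \<le> Q"
    using Q unfolding R_def K_def A_def d_def k_def .
  have \<gamma>p: "1 \<le> (1 + \<gamma>) powr (2 / p)" using \<gamma> p by (intro ge_one_powr_ge_zero) auto
  have Q1: "192 * sqrt R * real r * K \<le> Q"
  proof -
    have "1 * (192 * sqrt R * real r * K) \<le> (1 + \<gamma>) powr (2 / p) * (192 * sqrt R * real r * K)"
      using \<gamma>p K0 R1 by (intro mult_right_mono) auto
    then show ?thesis using Q' by (simp add: mult_ac)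
  qed
  have Q2: "22 * (1 + \<gamma>) powr (1 / p) * sqrt (real r) * K \<le> Q"
  proof -
    have "(1 + \<gamma>) powr (1 / p) \<le> (1 + \<gamma>) powr (2 / p)"
      using \<gamma> p by (intro powr_mono) (auto simp: field_simps)
    then have "22 * (1 + \<gamma>) powr (1 / p) * sqrt (real r) * K \<le> 192 * (1 + \<gamma>) powr (2 / p) * real r * K"
      using r1 K0 by (intro mult_right_mono mult_mono) auto
    also have "\<dots> = 192 * (1 + \<gamma>) powr (2 / p) * 1 * real r * K" by simp
    also have "\<dots> \<le> 192 * (1 + \<gamma>) powr (2 / p) * sqrt R * real r * K"
      using R1 K0 by (intro mult_right_mono mult_left_mono) auto
    finally show ?thesis using Q' by linarith
  qed
  have low: "e \<le> A powr (1 / p) * sqrt (2 * real r) * \<epsilon>"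
  proof -
    have "(\<Sum>i = k + 1..d. singular_value H i powr p) \<le> (\<Sum>i = k + 1..d. \<epsilon> powr p)"
      using error_tail_le[OF X(1) X0(1,2)] p \<epsilon>(2)
      by (intro sum_mono powr_mono2) (auto simp: H_def k_def)
    then have B: "(\<Sum>i = k + 1..d. singular_value H i powr p) \<le> real (d - k) * \<epsilon> powr p" by simp
    have "e \<le> sqrt (\<Sum>i = 1..k. (singular_value H i)\<^sup>2)"
      unfolding e(1) H_def by (rule singular_value_1_le_head[OF k(1)])
    also have "\<dots> \<le> \<gamma> powr (1 / p) * real k powr (1 / 2 - 1 / p) * (real (d - k) * \<epsilon> powr p) powr (1 / p)"
      by (rule H.head_le_sum[OF B])
    also have "(real (d - k) * \<epsilon> powr p) powr (1 / p) = real (d - k) powr (1 / p) * \<epsilon>"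
      using p \<epsilon>(1) by (simp add: powr_mult powr_powr)
    also have "\<gamma> powr (1 / p) * real k powr (1 / 2 - 1 / p) * (real (d - k) powr (1 / p) * \<epsilon>)
        = A powr (1 / p) * sqrt (real k) * \<epsilon>"
      using \<gamma> k by (simp add: A_def powr_mult powr_divide powr_diff powr_half_sqrt)
    finally show ?thesis by (simp add: k_def)
  qed
  have ep: "0 < e powr (1 - p)" using e0 by simp
  have "192 * sqrt R * real r * K * e powr (1 - p) \<le> Q * e powr (1 - p)"
    using Q1 by (intro mult_right_mono) auto
  then have small: "192 * sqrt R * real r * K * e powr (1 - p) < 1" using contr by linarith
  have N1: "singular_value N 1 \<le> G * y"
  proof -
    have "singular_value N 1 \<le> sqrt (\<Sum>i = 1..k. (singular_value N i)\<^sup>2)"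
      by (rule singular_value_1_le_head[OF k(1)])
    also have "\<dots> \<le> sqrt (G\<^sup>2 * T)" using head by (rule real_sqrt_le_mono)
    also have "\<dots> = G * y" using G0 by (simp add: real_sqrt_mult y_def)
    finally show ?thesis .
  qed
  have Gy: "G * y \<le> \<epsilon>" by (rule rec(2)[OF small low])
  show "singular_value (X' - X0) 1 \<le> e" using N1 Gy \<epsilon>e by (simp add: N_def)
  show "singular_value X' (r + 1) \<le> \<epsilon>"
    using trailing_value_le_error[OF X'(1) X0(1,2)] N1 Gy by (simp add: N_def)
  have ay: "a * y \<le> 22 * sqrt (real r) * K * e powr (2 - p)" using rec(1) by (simp only: a_def)
  show "singular_value (X' - X0) 1 \<le> Q * e powr (2 - p)"
  proof -
    have "singular_value N 1 \<le> a * y" using N1 mult_right_mono[OF Ga y0] by linarith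
    also note ay
    also have "22 * sqrt (real r) * K * e powr (2 - p) \<le> Q * e powr (2 - p)"
    proof (intro mult_right_mono)
      have "1 \<le> (1 + \<gamma>) powr (1 / p)" using \<gamma> p by (intro ge_one_powr_ge_zero) auto
      then have "1 * (22 * sqrt (real r) * K) \<le> (1 + \<gamma>) powr (1 / p) * (22 * sqrt (real r) * K)"
        using K0 by (intro mult_right_mono) auto
      then show "22 * sqrt (real r) * K \<le> Q" using Q2 by (simp add: mult_ac)
    qed simp
    finally show ?thesis by (simp add: N_def)
  qed
  show "schatten_norm p (X' - X0) \<le> Q * schatten_norm p (X - X0) powr (2 - p)"
  proof -
    define P where "P = schatten_norm p H"
    have P: "P = (\<Sum>i = 1..d. singular_value H i powr p) powr (1 / p)"
      using Hc by (simp add: P_def schatten_norm_def d_def)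
    have P0: "0 \<le> P" by (simp add: P)
    define x where "x = \<gamma> powr (1 / p) * real k powr (1 / 2 - 1 / p)"
    have x0: "0 \<le> x" by (simp add: x_def)
    have x1: "x \<le> 1"
    proof -
      have "\<gamma> powr (1 / p) \<le> 1" using \<gamma> nsp(2) p by (intro powr_le1) auto
      moreover have "real k powr (1 / 2 - 1 / p) \<le> real k powr 0"
        using k p by (intro powr_mono) (auto simp: field_simps)
      ultimately show ?thesis using k unfolding x_def by (intro mult_le_one) auto
    qed
    have "e \<le> sqrt (\<Sum>i = 1..k. (singular_value H i)\<^sup>2)"
      unfolding e(1) H_def by (rule singular_value_1_le_head[OF k(1)])
    also have "\<dots> \<le> x * P"
      unfolding x_def P
    proof (rule H.head_le_sum)
      show "(\<Sum>i = k + 1..d. singular_value H i powr p) \<le> (\<Sum>i = 1..d. singular_value H i powr p)"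
        by (rule sum_mono2) auto
    qed
    finally have "e powr (2 - p) \<le> (x * P) powr (2 - p)" using e0 p by (intro powr_mono2) auto
    also have "\<dots> = x powr (2 - p) * P powr (2 - p)" using x0 P0 by (simp add: powr_mult)
    also have "\<dots> \<le> x powr 1 * P powr (2 - p)"
      using x0 x1 p by (intro mult_right_mono powr_mono') auto
    finally have exP: "e powr (2 - p) \<le> x * P powr (2 - p)" using x0 by simp
    \<comment> \<open>The gain \<open>x\<close> cancels the loss \<open>(d - k) powr (1 / p - 1 / 2)\<close> of the passage to the Schatten norm.\<close>
    have dx: "real (d - k) powr (1 / p - 1 / 2) * x \<le> a"
    proof -
      have "real (d - k) powr (1 / p - 1 / 2) * x
          = \<gamma> powr (1 / p) * (real (d - k) / real k) powr (1 / p - 1 / 2)"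
      proof -
        have "real k powr (1 / 2 - 1 / p) = 1 / real k powr (1 / p - 1 / 2)"
          using powr_minus_divide[of "real k" "1 / p - 1 / 2"] by simp
        then show ?thesis by (simp add: x_def powr_divide)
      qed
      also have "\<dots> \<le> \<gamma> powr (1 / p - 1 / 2) * (real (d - k) / real k) powr (1 / p - 1 / 2)"
        using \<gamma> nsp(2) by (intro mult_right_mono powr_mono') auto
      also have "\<dots> = a" using \<gamma> by (simp add: a_def A_def powr_mult powr_divide)
      finally show ?thesis .
    qed
    have "schatten_norm p N = (\<Sum>i = 1..d. singular_value N i powr p) powr (1 / p)"
      using Nc by (simp add: schatten_norm_def d_def)
    also have "\<dots> \<le> (1 + \<gamma>) powr (1 / p) * real (d - k) powr (1 / p - 1 / 2) * y"
      unfolding y_def T_def by (rule N.schatten_le_tail)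
    finally have "a * schatten_norm p N
        \<le> a * ((1 + \<gamma>) powr (1 / p) * real (d - k) powr (1 / p - 1 / 2) * y)"
      using a1 by (intro mult_left_mono) auto
    also have "\<dots> = (1 + \<gamma>) powr (1 / p) * real (d - k) powr (1 / p - 1 / 2) * (a * y)" by (simp add: mult_ac)
    also have "\<dots> \<le> (1 + \<gamma>) powr (1 / p) * real (d - k) powr (1 / p - 1 / 2)
        * (22 * sqrt (real r) * K * (x * P powr (2 - p)))"
    proof (rule mult_left_mono)
      have "22 * sqrt (real r) * K * e powr (2 - p) \<le> 22 * sqrt (real r) * K * (x * P powr (2 - p))"
        using exP K0 by (intro mult_left_mono) auto
      then show "a * y \<le> 22 * sqrt (real r) * K * (x * P powr (2 - p))" using ay by linarith
    qed simp
    also have "\<dots> = (real (d - k) powr (1 / p - 1 / 2) * x)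
        * (22 * (1 + \<gamma>) powr (1 / p) * sqrt (real r) * K * P powr (2 - p))" by (simp add: mult_ac)
    also have "\<dots> \<le> a * (Q * P powr (2 - p))"
    proof (rule mult_mono[OF dx])
      show "22 * (1 + \<gamma>) powr (1 / p) * sqrt (real r) * K * P powr (2 - p) \<le> Q * P powr (2 - p)"
        using Q2 by (intro mult_right_mono) auto
      show "0 \<le> 22 * (1 + \<gamma>) powr (1 / p) * sqrt (real r) * K * P powr (2 - p)"
        using K0 by simp
    qed (use a1 in simp)
    finally have "schatten_norm p N \<le> Q * P powr (2 - p)" using a1 by simp
    then show ?thesis by (simp add: N_def P_def H_def)
  qed
qed


lemma hm_irls_run_step:
  assumes "hm_irls_run d1 d2 \<Phi> Y r p X \<epsilon> W"
  shows "\<epsilon> n = 0 \<Longrightarrow> X (n + 1) = X n" and "\<epsilon> n = 0 \<Longrightarrow> \<epsilon> (n + 1) = 0"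
    and "\<epsilon> n \<noteq> 0 \<Longrightarrow> is_arg_min (\<lambda>Z. (weighted_norm (W n) (mat_vec Z))\<^sup>2)
           (\<lambda>Z. Z \<in> carrier_mat d1 d2 \<and> \<Phi> Z = Y) (X (n + 1))"
    and "\<epsilon> n \<noteq> 0 \<Longrightarrow> \<epsilon> (n + 1) = min (\<epsilon> n) (singular_value (X (n + 1)) (r + 1))"
    and "\<epsilon> n \<noteq> 0 \<Longrightarrow> \<epsilon> (n + 1) \<noteq> 0 \<Longrightarrow> \<exists>U S V. full_svd (X (n + 1)) U S V \<and>
              W (n + 1) = hm_weight (X (n + 1)) U V (\<epsilon> (n + 1)) p"
  using assms unfolding hm_irls_run_def by meson+

lemma hm_irls_run_feasible:
  assumes run: "hm_irls_run d1 d2 \<Phi> Y r p X \<epsilon> W" and n: "1 \<le> n"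
  shows "X n \<in> carrier_mat d1 d2 \<and> \<Phi> (X n) = Y"
  using n
proof (induction n rule: nat_induct_at_least)
  case base
  have "\<epsilon> 0 \<noteq> 0" using run by (simp add: hm_irls_run_def)
  then show ?case using hm_irls_run_step(3)[OF run, of 0] by (simp add: is_arg_min_def)
next
  case (Suc n)
  then show ?case
    using hm_irls_run_step(1)[OF run, of n] hm_irls_run_step(3)[OF run, of n]
    by (cases "\<epsilon> n = 0") (simp_all add: is_arg_min_def)
qed

lemma hm_irls_run_weight:
  assumes run: "hm_irls_run d1 d2 \<Phi> Y r p X \<epsilon> W" and n: "1 \<le> n" and \<epsilon>: "\<epsilon> n \<noteq> 0"
  shows "\<exists>U S V. full_svd (X n) U S V \<and> W n = hm_weight (X n) U V (\<epsilon> n) p"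
proof -
  obtain k where k: "n = k + 1" using n by (metis add.commute le_add_diff_inverse)
  have "\<epsilon> k \<noteq> 0" using hm_irls_run_step(2)[OF run, of k] \<epsilon> k by auto
  then show ?thesis using hm_irls_run_step(5)[OF run, of k] \<epsilon> k by simp
qed

text \<open>The tail of the error vanishes together with \<open>singular_value X (r + 1)\<close>, which contradicts the strict
  null space inequality for a nonzero error. So an algorithm that has stopped has found \<open>X0\<close>.\<close>

lemma error_zero_if_rank_exhausted:
  assumes \<Phi>: "linear_measurement d1 d2 m \<Phi>" and nsp: "strong_schatten_nsp d1 d2 m \<Phi> p (2 * r) \<gamma>"
    and X0: "X0 \<in> carrier_mat d1 d2" "vec_space.rank d1 X0 = r" "\<Phi> X0 = Y"
    and X: "X \<in> carrier_mat d1 d2" "\<Phi> X = Y" and 0: "singular_value X (r + 1) = 0"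
  shows "X - X0 = 0\<^sub>m d1 d2"
proof (rule ccontr)
  assume nz: "X - X0 \<noteq> 0\<^sub>m d1 d2"
  have H: "X - X0 \<in> carrier_mat d1 d2" by (rule minus_carrier_mat[OF X0(1)])
  have H0: "\<Phi> (X - X0) = 0\<^sub>v m" using X X0 by (intro linear_measurement_diff[OF \<Phi>]) auto
  have "singular_value (X - X0) i = 0" if "2 * r < i" for i
    using error_tail_le[OF X(1) X0(1,2) that] 0 singular_value_nonneg[of "X - X0" i] by linarith
  then have "(\<Sum>i = 2 * r + 1..min d1 d2. singular_value (X - X0) i powr p) = 0" by simp
  then show False
    using strong_schatten_nspD[OF \<Phi> nsp H H0 nz] by (metis mult_zero_right not_less powr_ge_zero)
qed

theorem theorem11:
  fixes d1 d2 d m r nbar :: nat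
    and p \<gamma> \<kappa> \<zeta> \<mu> :: real
    and \<Phi> :: "complex mat \<Rightarrow> complex vec" and Y :: "complex vec"
    and X0 :: "complex mat"
    and X W \<eta> :: "nat \<Rightarrow> complex mat" and \<epsilon> :: "nat \<Rightarrow> real"
  assumes p: "0 < p" "p \<le> 1"
    and r: "1 \<le> r"
    and d: "d = min d1 d2"
    and \<Phi>: "linear_measurement d1 d2 m \<Phi>"
    and nsp: "strong_schatten_nsp d1 d2 m \<Phi> p (2 * r) \<gamma>" "\<gamma> < 1"
    and X0: "X0 \<in> carrier_mat d1 d2" "vec_space.rank d1 X0 = r" "real r \<le> real d / 2" "\<Phi> X0 = Y"
    and run: "hm_irls_run d1 d2 \<Phi> Y r p X \<epsilon> W"
    and \<kappa>: "\<kappa> = singular_value X0 1 / singular_value X0 r"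
    and \<eta>: "\<And>n. \<eta> n = X n - X0"
    and nbar: "1 \<le> nbar"
    and \<zeta>: "0 < \<zeta>" "\<zeta> < 1"
    and close: "schatten_inf_norm (\<eta> nbar) \<le> \<zeta> * singular_value X0 r"
    and eps: "\<epsilon> nbar = singular_value (X nbar) (r + 1)"
    and \<mu>: "\<mu> = 2 powr (5 * p) * (1 + \<gamma>) powr p
          * (\<gamma> * (3 + \<gamma>) * (1 + \<gamma>) / (1 - \<gamma>)) powr (2 - p)
          * (real (d - r) / real r) powr (2 - p / 2) * real r powr p
          * (singular_value X0 r powr (p * (p - 1)) / (1 - \<zeta>) powr (2 * p)) * \<kappa> powr p"
    and contraction: "\<mu> * real_pow (schatten_inf_norm (\<eta> nbar)) (p * (1 - p)) < 1"
  shows "\<forall>n\<ge>nbar.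
    schatten_inf_norm (\<eta> (n + 1)) \<le> \<mu> powr (1 / p) * schatten_inf_norm (\<eta> n) powr (2 - p) \<and>
    schatten_norm p (\<eta> (n + 1)) \<le> \<mu> powr (1 / p) * schatten_norm p (\<eta> n) powr (2 - p)"
proof -
  define e where "e n = singular_value (\<eta> n) 1" for n
  define \<sigma> where "\<sigma> = singular_value X0 r"
  have inf: "schatten_inf_norm (\<eta> n) = e n" for n by (simp add: schatten_inf_norm_def e_def)
  have r2: "2 * r \<le> min d1 d2"
  proof -
    have "real (2 * r) \<le> real d" using X0(3) by simp
    then show ?thesis using d by linarith
  qed
  have \<gamma>0: "0 < \<gamma>" using nsp(1) by (simp add: strong_schatten_nsp_def)
  have feas: "X n \<in> carrier_mat d1 d2" "\<Phi> (X n) = Y" if "nbar \<le> n" for n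
    using hm_irls_run_feasible[OF run, of n] that nbar by auto
  have en0: "0 \<le> e n" for n by (simp add: e_def)

  \<comment> \<open>The smallness of the error and the identity for the smoothing parameter propagate together.\<close>
  define invar where "invar n \<longleftrightarrow> e n \<le> e nbar \<and> \<epsilon> n = singular_value (X n) (r + 1)" for n
  define goal where "goal n \<longleftrightarrow>
    schatten_inf_norm (\<eta> (n + 1)) \<le> \<mu> powr (1 / p) * schatten_inf_norm (\<eta> n) powr (2 - p) \<and>
    schatten_norm p (\<eta> (n + 1)) \<le> \<mu> powr (1 / p) * schatten_norm p (\<eta> n) powr (2 - p)" for n
  have step: "goal n \<and> invar (n + 1)" if n: "nbar \<le> n" and I: "invar n" for n
  proof (cases "\<epsilon> n = 0")
    case True
    have "singular_value (X n) (r + 1) = 0" using I True by (simp add: invar_def)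
    then have \<eta>0: "\<eta> n = 0\<^sub>m d1 d2"
      using error_zero_if_rank_exhausted[OF \<Phi> nsp(1) X0(1,2,4) feas[OF n]] \<eta> by simp
    have Xn: "X (n + 1) = X n" by (rule hm_irls_run_step(1)[OF run True])
    then have \<eta>1: "\<eta> (n + 1) = 0\<^sub>m d1 d2" using \<eta>0 \<eta> by simp
    have "goal n"
      unfolding goal_def \<eta>0 \<eta>1 schatten_inf_norm_def schatten_norm_def
      using p by (simp add: singular_value_zero_mat)
    moreover have "invar (n + 1)"
      using hm_irls_run_step(2)[OF run True] I True Xn en0
      unfolding invar_def e_def \<eta>1 by (simp add: singular_value_zero_mat)
    ultimately show ?thesis by blast
  next
    case False
    have \<epsilon>n: "\<epsilon> n = singular_value (X n) (r + 1)" using I by (simp add: invar_def)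
    have \<epsilon>pos: "0 < \<epsilon> n" using False \<epsilon>n singular_value_nonneg[of "X n" "r + 1"] by linarith
    have n1: "1 \<le> n" using n nbar by simp
    have "\<epsilon> n \<le> e n" unfolding \<epsilon>n e_def \<eta> by (rule trailing_value_le_error[OF feas(1)[OF n] X0(1,2)])
    then have epos: "0 < e n" using \<epsilon>pos by linarith
    have ebar: "e n \<le> e nbar" using I by (simp add: invar_def)
    have e\<zeta>: "e n \<le> \<zeta> * \<sigma>" using ebar close by (simp add: inf \<sigma>_def)
    then have \<sigma>0: "0 < \<sigma>" using epos \<zeta> by (metis less_le_trans zero_less_mult_pos)
    have "\<sigma> \<le> singular_value X0 1" using singular_value_antimono[of 0 "r - 1" X0] r by (simp add: \<sigma>_def)
    then have \<kappa>0: "0 < \<kappa>" using \<sigma>0 by (simp add: \<kappa> flip: \<sigma>_def)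
    note const = contraction_constant_lower_bound[OF p \<gamma>0 nsp(2) r r2 \<sigma>0 \<kappa>0 \<zeta>(2),
        folded d, unfolded \<sigma>_def, folded \<mu>, folded \<sigma>_def]
    have Q: "192 * (1 + \<gamma>) powr (2 / p) * sqrt (real (min d1 d2 - r) / real r) * real r
      * ((\<gamma> * real (min d1 d2 - 2 * r) / real (2 * r)) powr (2 / p - 1)
         * (singular_value X0 1 / \<sigma> * \<sigma> powr (p - 1) / (1 - \<zeta>)\<^sup>2)) \<le> \<mu> powr (1 / p)"
      using const(2) unfolding \<kappa> d \<sigma>_def[symmetric] .
    have contr: "\<mu> powr (1 / p) * e n powr (1 - p) < 1"
    proof -
      have pos: "0 < e nbar" using epos ebar by linarith
      have "real_pow (e nbar) (p * (1 - p)) = e nbar powr (p * (1 - p))"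
        using pos by (simp add: real_pow_def)
      then have "\<mu> * e nbar powr (p * (1 - p)) < 1" using contraction by (simp add: inf)
      moreover have "0 < \<mu> * e nbar powr (p * (1 - p))" using const(1) pos by simp
      ultimately have "(\<mu> * e nbar powr (p * (1 - p))) powr (1 / p) < 1 powr (1 / p)"
        using p by (intro powr_less_mono2) auto
      then have "\<mu> powr (1 / p) * e nbar powr (1 - p) < 1"
        using const(1) p by (simp add: powr_mult powr_powr)
      moreover have "e n powr (1 - p) \<le> e nbar powr (1 - p)"
        using epos ebar p by (intro powr_mono2) auto
      then have "\<mu> powr (1 / p) * e n powr (1 - p) \<le> \<mu> powr (1 / p) * e nbar powr (1 - p)"
        by (intro mult_left_mono) auto
      ultimately show ?thesis by linarith
    qed
    obtain U S V where svd: "full_svd (X n) U S V" and W: "W n = hm_weight (X n) U V (\<epsilon> n) p"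
      using hm_irls_run_weight[OF run n1 False] by blast
    have argmin: "is_arg_min (\<lambda>Z. (weighted_norm (W n) (mat_vec Z))\<^sup>2)
           (\<lambda>Z. Z \<in> carrier_mat d1 d2 \<and> \<Phi> Z = Y) (X (n + 1))"
      by (rule hm_irls_run_step(3)[OF run False])
    have min: "(weighted_norm (hm_weight (X n) U V (\<epsilon> n) p) (mat_vec (X (n + 1))))\<^sup>2
        \<le> (weighted_norm (hm_weight (X n) U V (\<epsilon> n) p) (mat_vec Z))\<^sup>2"
      if "Z \<in> carrier_mat d1 d2" "\<Phi> Z = Y" for Z
      using argmin that unfolding is_arg_min_def W by (auto simp: not_less)
    have n': "nbar \<le> n + 1" using n by simp
    note concl = hm_irls_step[OF p r r2 \<Phi> nsp X0(1,2,4) feas[OF n] feas[OF n'] svd min \<epsilon>pos \<epsilon>n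
        e_def[of n, unfolded \<eta>] e\<zeta> \<zeta> \<sigma>_def Q contr]
    have "goal n"
      unfolding goal_def inf using concl(1,2) by (simp add: e_def \<eta>)
    moreover have "invar (n + 1)"
    proof -
      have "e (n + 1) \<le> e nbar" using concl(4) ebar by (simp add: e_def \<eta>)
      moreover have "\<epsilon> (n + 1) = singular_value (X (n + 1)) (r + 1)"
        using hm_irls_run_step(4)[OF run False] concl(3) by simp
      ultimately show ?thesis by (simp add: invar_def)
    qed
    ultimately show ?thesis by blast
  qed
  have "invar n" if "nbar \<le> n" for n
    using that
  proof (induction n rule: nat_induct_at_least)
    case base
    then show ?case using eps by (simp add: invar_def)
  next
    case (Suc n)
    then show ?case using step[of n] by simp
  qed
  then show ?thesis using step unfolding goal_def by blast
qed

end
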